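(* Let $X$ be an infinite-dimensional complex Banach space and $A\in L(X)$. The following conditions are equivalent: (i) $A$ is left generalized Drazin-meromorphic invertible, i.e. there is $B\in L(X)$ such that $ABA=BA^2$, $B^2A=B$ and $A-ABA$ is meromorphic; (ii) there exists $C\in L(X)$ such that $ACA=CA^2$, $C^2A=C=CAC$ and $A-ACA$ is meromorphic; (iii) there exists $(M,N)\in Red(A)$ such that $A_M$ is left invertible and $A_N$ is meromorphic; (iv) there exists a projector $P\in L(X)$ commuting with $A$ such that $A+P$ is left Drazin invertible and $AP$ is meromorphic; (v) there exists a projector $P\in L(X)$ commuting with $A$ such that $A(I-P)+P$ is left Drazin invertible and $AP$ is meromorphic; (vi) there exist $C,D,P\in L(X)$ such that $C$ is left Drazin invertible, $D$ is meromorphic, $P$ is a projector commuting with $C$ and $D$, and $A=C(I-P)+DP$; (vii) $A$ is left meromorphic-quasipolar; (viii) $A$ admits a GS($\mathcal M$)D and $0\notin \mathrm{int}\,\sigma_l(A)$; (ix) $A$ admits a GS($\mathcal M$)D and $A$ has the SVEP at $0$; (x) $A$ admits a GS($\mathcal M$)D and $0\notin \mathrm{acc}\,\sigma_{D}^l(A)$; (xi) $A$ admits a GS($\mathcal M$)D and $0\notin \mathrm{int}\,\sigma_{D}^l(A)$; (xii) $A$ admits a GS($\mathcal M$)D and $0\notin \mathrm{acc}\,\sigma_{D}^+(A)$; (xiii) $A$ admits a GS($\mathcal M$)D and $0\notin \mathrm{int}\,\sigma_{D}^+(A)$; (xiv) $A$ admits a GS($\mathcal M$)D and $0\notin \mathr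m{int}\,\sigma_{p}(A)$.
   Context: $L(X)$ is the algebra of bounded linear operators on $X$; $\mathcal N(A)$, $\mathcal R(A)$ denote null-space and range; a projector is an idempotent in $L(X)$. For $K\subset\mathbb C$, $\mathrm{int}\,K$ is its interior and $\mathrm{acc}\,K$ its set of accumulation points. The notions below are used for operators on any complex Banach space, in particular on closed invariant subspaces (possibly $\{0\}$). $(M,N)\in Red(A)$ means: $M,N$ are closed $A$-invariant subspaces with $X=M\oplus N$; $A_M:M\to M$, $A_N:N\to N$ are the restrictions of $A$. A subspace is complemented if it is closed and has a closed algebraic complement. The ascent is $a(A)=\inf\{n\ge 0: \mathcal N(A)\cap \mathcal R(A^n)=\{0\}\}$ ($\inf\emptyset=\infty$). $A$ is left Drazin invertible if $a(A)<\infty$ and $\mathcal R(A)+\mathcal N(A^{a(A)})$ is a complemented subspace. $A$ is upper Drazin invertible if $a(A)<\infty$ and $\mathcal R(A^{a(A)+1})$ is closed. $A$ is meromorphic if every nonzero point of its spectrum is a pole of its resolvent. $A$ is Kato if $\mathcal R(A)$ is closed and $\mathcal N(A)\subset\mathcal R(A^n)$ for every $n\in\mathbb N$; $A$ is Saphar if it is Kato and $\mathcal N(A)$, $\mathcal R(A)$ are complemented. $A$ admits a GS($\mathcal M$)D (generalized Saphar-meromorphic decomposition) if there is $(M,N)\in Red(A)$ such that $A_M$ is Saphar and $A_N$ is meromorphic. $A$ is left meromorphic-quasipolar if there is a projector $Q\in L(X)$ with $AQ=QA$, $A(I-Q)$ meromorphic, and $Q\in L(X)A=\{TA:T\in L(X)\}$.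 $A$ has the SVEP at $\lambda_0$ if for every open disc $D_{\lambda_0}$ centered at $\lambda_0$ the only analytic $f:D_{\lambda_0}\to X$ with $(A-\lambda I)f(\lambda)=0$ for all $\lambda\in D_{\lambda_0}$ is $f\equiv0$. Spectra: $\sigma_l(A)$ (left spectrum), $\sigma_{D}^l(A)$, $\sigma_D^+(A)$ are the sets of $\lambda\in\mathbb C$ such that $A-\lambda I$ is not left invertible, not left Drazin invertible, not upper Drazin invertible, respectively; $\sigma_p(A)$ is the point spectrum (set of eigenvalues). *)

theory Defs
  imports "HOL-Analysis.Analysis"
begin

class complex_banach = banach +
  fixes scaleC :: "complex \<Rightarrow> 'a \<Rightarrow> 'a"  (infixr "*\<^sub>C" 75)
  assumes scaleC_add_right: "a *\<^sub>C (x + y) = a *\<^sub>C x + a *\<^sub>C y"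
    and scaleC_add_left: "(a + b) *\<^sub>C x = a *\<^sub>C x + b *\<^sub>C x"
    and scaleC_scaleC: "a *\<^sub>C (b *\<^sub>C x) = (a * b) *\<^sub>C x"
    and scaleC_one: "1 *\<^sub>C x = x"
    and scaleR_scaleC: "r *\<^sub>R x = complex_of_real r *\<^sub>C x"
    and norm_scaleC: "norm (a *\<^sub>C x) = cmod a * norm x"

global_interpretation cvec: vector_space "scaleC :: complex \<Rightarrow> 'a::complex_banach \<Rightarrow> 'a"
  by unfold_locales
    (simp_all add: scaleC_add_right scaleC_add_left scaleC_scaleC scaleC_one)

(* Operators are functions on the ambient Banach space, considered on a carrier M, which
   is always a closed complex subspace (M = UNIV gives the whole space). Thus a restriction
   to M is the same function with carrier M, and every notion below depends
   only on the values on M. Since M is closed, closedness relative to M and in the ambient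
   space agree for subsets of M. *)

definition closed_csubspace :: "'a::complex_banach set \<Rightarrow> bool" where
  "closed_csubspace M \<longleftrightarrow> closed M \<and> cvec.subspace M"

definition infinite_dimensional :: "'a::complex_banach set \<Rightarrow> bool" where
  "infinite_dimensional M \<longleftrightarrow> \<not> (\<exists>B. finite B \<and> B \<subseteq> M \<and> cvec.span B = M)"

(* The algebra L(M); functions agreeing on M represent the same operator. *)
definition bop :: "'a::complex_banach set \<Rightarrow> ('a \<Rightarrow> 'a) set" where
  "bop M = {T. (\<forall>x\<in>M. T x \<in> M) \<and>
               (\<forall>x\<in>M. \<forall>y\<in>M. T (x + y) = T x + T y) \<and>
               (\<forall>c. \<forall>x\<in>M. T (c *\<^sub>C x) = c *\<^sub>C T x) \<and>
               (\<exists>K. \<forall>x\<in>M. norm (T x) \<le> K * norm x)}"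

definition nullspace :: "'a::complex_banach set \<Rightarrow> ('a \<Rightarrow> 'a) \<Rightarrow> 'a set" where
  "nullspace M A = {x \<in> M. A x = 0}"

definition op_shift :: "('a::complex_banach \<Rightarrow> 'a) \<Rightarrow> complex \<Rightarrow> 'a \<Rightarrow> 'a" where
  "op_shift A z = (\<lambda>x. A x - z *\<^sub>C x)"

definition projector :: "('a::complex_banach \<Rightarrow> 'a) \<Rightarrow> bool" where
  "projector P \<longleftrightarrow> P \<in> bop UNIV \<and> P \<circ> P = P"

definition ssum :: "'a::complex_banach set \<Rightarrow> 'a set \<Rightarrow> 'a set" where
  "ssum V W = {v + w | v w. v \<in> V \<and> w \<in> W}"

definition complemented_in :: "'a::complex_banach set \<Rightarrow> 'a set \<Rightarrow> bool" where
  "complemented_in M V \<longleftrightarrow> closed_csubspace V \<and> V \<subseteq> M \<and>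
     (\<exists>W. closed_csubspace W \<and> W \<subseteq> M \<and> V \<inter> W = {0} \<and> ssum V W = M)"

definition Red :: "('a::complex_banach \<Rightarrow> 'a) \<Rightarrow> ('a set \<times> 'a set) set" where
  "Red A = {(M, N). closed_csubspace M \<and> closed_csubspace N \<and>
                    A ` M \<subseteq> M \<and> A ` N \<subseteq> N \<and> M \<inter> N = {0} \<and> ssum M N = UNIV}"

definition left_invertible :: "'a::complex_banach set \<Rightarrow> ('a \<Rightarrow> 'a) \<Rightarrow> bool" where
  "left_invertible M A \<longleftrightarrow> (\<exists>B\<in>bop M. \<forall>x\<in>M. B (A x) = x)"

definition invertible_op :: "'a::complex_banach set \<Rightarrow> ('a \<Rightarrow> 'a) \<Rightarrow> bool" where
  "invertible_op M A \<longleftrightarrow> (\<exists>B\<in>bop M. \<forall>x\<in>M. B (A x) = x \<and> A (B x) = x)"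

definition ascent :: "'a::complex_banach set \<Rightarrow> ('a \<Rightarrow> 'a) \<Rightarrow> enat" where
  "ascent M A = Inf {enat n | n. nullspace M A \<inter> (A ^^ n) ` M = {0}}"

definition left_Drazin :: "'a::complex_banach set \<Rightarrow> ('a \<Rightarrow> 'a) \<Rightarrow> bool" where
  "left_Drazin M A \<longleftrightarrow> ascent M A < \<infinity> \<and>
     complemented_in M (ssum (A ` M) (nullspace M (A ^^ the_enat (ascent M A))))"

definition upper_Drazin :: "'a::complex_banach set \<Rightarrow> ('a \<Rightarrow> 'a) \<Rightarrow> bool" where
  "upper_Drazin M A \<longleftrightarrow> ascent M A < \<infinity> \<and> closed ((A ^^ (the_enat (ascent M A) + 1)) ` M)"

definition op_spectrum :: "'a::complex_banach set \<Rightarrow> ('a \<Rightarrow> 'a) \<Rightarrow> complex set" where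
  "op_spectrum M A = {z. \<not> invertible_op M (op_shift A z)}"

definition left_spectrum :: "'a::complex_banach set \<Rightarrow> ('a \<Rightarrow> 'a) \<Rightarrow> complex set" where
  "left_spectrum M A = {z. \<not> left_invertible M (op_shift A z)}"

definition left_Drazin_spectrum :: "'a::complex_banach set \<Rightarrow> ('a \<Rightarrow> 'a) \<Rightarrow> complex set" where
  "left_Drazin_spectrum M A = {z. \<not> left_Drazin M (op_shift A z)}"

definition upper_Drazin_spectrum :: "'a::complex_banach set \<Rightarrow> ('a \<Rightarrow> 'a) \<Rightarrow> complex set" where
  "upper_Drazin_spectrum M A = {z. \<not> upper_Drazin M (op_shift A z)}"

definition point_spectrum :: "'a::complex_banach set \<Rightarrow> ('a \<Rightarrow> 'a) \<Rightarrow> complex set" where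
  "point_spectrum M A = {z. \<exists>x\<in>M. x \<noteq> 0 \<and> A x = z *\<^sub>C x}"

(* Represents (A - z I)^(-1) on M; meaningful for z outside the spectrum. *)
definition resolvent :: "'a::complex_banach set \<Rightarrow> ('a \<Rightarrow> 'a) \<Rightarrow> complex \<Rightarrow> 'a \<Rightarrow> 'a" where
  "resolvent M A z = inv_into M (op_shift A z)"

(* w is an isolated singularity of the resolvent whose Laurent expansion
     (A - z I)^(-1) = sum over n >= 0 of (z - w)^(n - p) B_n,  B_n in L(M),
   starts with a nonzero term of order -p, p >= 1. Convergence is in the operator norm,
   i.e. uniform on the unit ball of M. *)
definition pole_of_resolvent :: "'a::complex_banach set \<Rightarrow> ('a \<Rightarrow> 'a) \<Rightarrow> complex \<Rightarrow> bool" where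
  "pole_of_resolvent M A w \<longleftrightarrow>
     (\<exists>r>0. \<exists>p\<ge>1. \<exists>B :: nat \<Rightarrow> 'a \<Rightarrow> 'a.
        (\<forall>n. B n \<in> bop M) \<and> (\<exists>x\<in>M. B 0 x \<noteq> 0) \<and>
        (\<forall>z\<in>ball w r - {w}. z \<notin> op_spectrum M A \<and>
           uniform_limit {x \<in> M. norm x \<le> 1}
             (\<lambda>k x. \<Sum>n<k. ((z - w) powi (int n - int p)) *\<^sub>C B n x)
             (resolvent M A z) sequentially))"

definition meromorphic_op :: "'a::complex_banach set \<Rightarrow> ('a \<Rightarrow> 'a) \<Rightarrow> bool" where
  "meromorphic_op M A \<longleftrightarrow> (\<forall>z\<in>op_spectrum M A. z \<noteq> 0 \<longrightarrow> pole_of_resolvent M A z)"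

definition Kato_op :: "'a::complex_banach set \<Rightarrow> ('a \<Rightarrow> 'a) \<Rightarrow> bool" where
  "Kato_op M A \<longleftrightarrow> closed (A ` M) \<and> (\<forall>n. nullspace M A \<subseteq> (A ^^ n) ` M)"

definition Saphar_op :: "'a::complex_banach set \<Rightarrow> ('a \<Rightarrow> 'a) \<Rightarrow> bool" where
  "Saphar_op M A \<longleftrightarrow> Kato_op M A \<and> complemented_in M (nullspace M A) \<and> complemented_in M (A ` M)"

definition admits_GSMD :: "('a::complex_banach \<Rightarrow> 'a) \<Rightarrow> bool" where
  "admits_GSMD A \<longleftrightarrow> (\<exists>(M, N)\<in>Red A. Saphar_op M A \<and> meromorphic_op N A)"

definition left_meromorphic_quasipolar :: "('a::complex_banach \<Rightarrow> 'a) \<Rightarrow> bool" where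
  "left_meromorphic_quasipolar A \<longleftrightarrow>
     (\<exists>Q. projector Q \<and> A \<circ> Q = Q \<circ> A \<and> meromorphic_op UNIV (\<lambda>x. A (x - Q x)) \<and>
          (\<exists>T\<in>bop UNIV. Q = T \<circ> A))"

definition left_gD_meromorphic_invertible :: "('a::complex_banach \<Rightarrow> 'a) \<Rightarrow> bool" where
  "left_gD_meromorphic_invertible A \<longleftrightarrow>
     (\<exists>B\<in>bop UNIV. A \<circ> B \<circ> A = B \<circ> A \<circ> A \<and> B \<circ> B \<circ> A = B \<and>
        meromorphic_op UNIV (\<lambda>x. A x - (A \<circ> B \<circ> A) x))"

(* Complex differentiability of a vector-valued function; used for open S only. *)
definition vec_analytic_on :: "(complex \<Rightarrow> 'a::complex_banach) \<Rightarrow> complex set \<Rightarrow> bool" where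
  "vec_analytic_on f S \<longleftrightarrow> (\<forall>z\<in>S. \<exists>D. (f has_derivative (\<lambda>h. h *\<^sub>C D)) (at z))"

definition SVEP_at :: "('a::complex_banach \<Rightarrow> 'a) \<Rightarrow> complex \<Rightarrow> bool" where
  "SVEP_at A w \<longleftrightarrow>
     (\<forall>r>0. \<forall>f. vec_analytic_on f (ball w r) \<and> (\<forall>z\<in>ball w r. op_shift A z (f z) = 0)
        \<longrightarrow> (\<forall>z\<in>ball w r. f z = 0))"

end

theory Submission
  imports Defs "HOL-Complex_Analysis.Conformal_Mappings"
begin

text \<open>
  Everything is reduced to one algebraic configuration, here called a left meromorphic splitting: a
  bounded projector \<open>Q\<close> commuting with \<open>A\<close>, an operator \<open>T\<close> with \<open>T A = Q\<close>, and \<open>A\<close> meromorphic on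
  the kernel of \<open>Q\<close>. On the range of \<open>Q\<close> such an \<open>A\<close> is left invertible, so this is the
  quasipolarity condition, read as a reducing decomposition. The identities \<open>A B A = B A A\<close> and
  \<open>B B A = B\<close> make \<open>Q = B A\<close> a projector commuting with \<open>A\<close>; conversely \<open>C = Q T Q\<close> satisfies
  \<open>C A = Q\<close> and all the required identities.

  Working with decompositions is possible because being meromorphic is an algebraic property:
  a point \<open>w\<close> of the spectrum is a pole of the resolvent if and only if \<open>U = A - w\<close> is
  Drazin invertible, that is \<open>S U = U S\<close> and \<open>U^(p+1) S = U^p\<close> for some \<open>S\<close>
  (\<open>meromorphic_iff_Drazin\<close>). One direction reads \<open>S\<close> off the Laurent coefficients, the other sums the
  Laurent series explicitly. Drazin invertibility passes to and from the two summands
  of a reducing decomposition (\<open>Drazin_on_kernel\<close>, \<open>Drazin_on_glue\<close>).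

  Left Drazin invertibility becomes algebraic as well: it holds if and only if the space splits into an
  invariant part on which the operator is left invertible and one on which it is nilpotent
  (\<open>left_Drazin_imp_split\<close>, \<open>split_imp_left_and_upper_Drazin\<close>). This turns the conditions on
  \<open>A + P\<close>, on \<open>A (I - P) + P\<close> and on \<open>A = C (I - P) + D P\<close> into statements about direct sums: a
  nilpotent summand can always be moved to the meromorphic part, and adding \<open>1\<close> to a meromorphic
  operator makes it Drazin invertible.

  For the local spectral conditions, let \<open>A\<close> have a generalized Saphar-meromorphic decomposition. If
  the Saphar part is injective, it is left invertible and the splitting is found. Otherwise take
  \<open>x0 \<noteq> 0\<close> in its kernel and a generalized inverse \<open>S\<close>. The function
  \<open>f(z) = (I - z S)^(-1) x0\<close> is analytic near \<open>0\<close>, vanishes nowhere and satisfies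
  \<open>(A - z) f(z) = 0\<close>; moreover \<open>f(z)\<close> lies in the range of every power of \<open>A - z\<close>
  (\<open>Saphar_noninjective\<close>). Hence the single-valued extension property fails at \<open>0\<close>, and a whole disc
  around \<open>0\<close> consists of eigenvalues at which the ascent is infinite, so that the disc lies in all
  the spectra in question. Conversely, given a splitting, \<open>A - z\<close> is left invertible plus Drazin
  invertible for small \<open>z \<noteq> 0\<close>, and it is left invertible on discs arbitrarily close to \<open>0\<close>;
  an identity theorem for vector-valued analytic functions then yields the extension property.
\<close>

section \<open>Bounded preimages under surjections of Banach spaces\<close>

text \<open>
  The Baire category half of the open mapping theorem, in a form that avoids open sets: some
  ball of \<open>D\<close> has an image that is dense in a ball, and rescaling solves \<open>T x = y\<close> up to half of
  \<open>norm y\<close> with linear control of \<open>x\<close>.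
\<close>

lemma surjective_approx_preimage:
  fixes T :: "'b::banach \<Rightarrow> 'a::banach"
  assumes T: "bounded_linear T" and D: "subspace D" and surj: "T ` D = UNIV"
  shows "\<exists>K>0. \<forall>y. \<exists>x\<in>D. norm x \<le> K * norm y \<and> norm (y - T x) \<le> norm y / 2"
proof -
  interpret T: bounded_linear T by fact
  define C where "C n = closure (T ` (D \<inter> cball 0 (real n)))" for n
  have U: "(\<Union>n. C n) = UNIV"
  proof -
    have "y \<in> (\<Union>n. C n)" for y
    proof -
      obtain x where x: "x \<in> D" "T x = y" using surj by (metis UNIV_I imageE)
      obtain n where "norm x \<le> real n" using real_arch_simple by blast
      then have "y \<in> C n" using x closure_subset unfolding C_def by fastforce
      then show ?thesis by blast
    qed
    then show ?thesis by blast
  qed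
  have "\<exists>n. interior (C n) \<noteq> {}"
  proof (rule ccontr)
    assume "\<not> ?thesis"
    then have "euclidean interior_of \<Union>(range C) = {}"
      by (intro Baire_category_alt)
        (auto simp: C_def completely_metrizable_space_euclidean)
    then show False using U by simp
  qed
  then obtain n y0 where "y0 \<in> interior (C n)" by blast
  then obtain e where e: "e > 0" "ball y0 e \<subseteq> C n"
    using mem_interior by blast
  let ?K = "4 * real (Suc n) / e"
  have "\<exists>x\<in>D. norm x \<le> ?K * norm y \<and> norm (y - T x) \<le> norm y / 2" for y
  proof (cases "y = 0")
    case True
    then show ?thesis using D by (intro bexI[of _ 0]) (auto simp: subspace_0 T.zero)
  next
    case False
    define s where "s = 2 * norm y / e"
    have s: "s > 0" using False e by (simp add: s_def)
    define y' where "y' = y /\<^sub>R s"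
    have "norm y' = e / 2" using False e by (simp add: y'_def s_def)
    then have "y0 + y' \<in> C n" "y0 \<in> C n" using e by (auto simp: subset_iff dist_norm)
    moreover have e8: "e / 8 > 0" using e by simp
    ultimately have ap: "\<exists>x\<in>D \<inter> cball 0 (real n). dist (T x) (y0 + y') < e / 8"
        "\<exists>x\<in>D \<inter> cball 0 (real n). dist (T x) y0 < e / 8"
      using e8 unfolding C_def closure_approachable by blast+
    then obtain x1 x2 where x: "x1 \<in> D" "norm x1 \<le> n" "x2 \<in> D" "norm x2 \<le> n"
      "dist (T x1) (y0 + y') < e / 8" "dist (T x2) y0 < e / 8"
      by auto
    define x where "x = x1 - x2"
    have "norm (T x1 - (y0 + y') - (T x2 - y0)) < e / 8 + e / 8"
      using x(5,6) norm_triangle_ineq4[of "T x1 - (y0 + y')" "T x2 - y0"]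
      by (simp add: dist_norm)
    then have 1: "norm (T x - y') \<le> e / 4" by (simp add: x_def T.diff algebra_simps)
    have 2: "norm x \<le> 2 * n" using norm_triangle_ineq4[of x1 x2] x by (simp add: x_def)
    have "norm (y - T (s *\<^sub>R x)) = s * norm (T x - y')"
    proof -
      have "y - T (s *\<^sub>R x) = s *\<^sub>R (y' - T x)"
        using s by (simp add: y'_def T.scaleR algebra_simps)
      then show ?thesis using s by (simp add: norm_minus_commute)
    qed
    also have "\<dots> \<le> s * (e / 4)" using 1 s by (intro mult_left_mono) auto
    also have "\<dots> = norm y / 2" using e by (simp add: s_def)
    finally have A: "norm (y - T (s *\<^sub>R x)) \<le> norm y / 2" .
    have "norm (s *\<^sub>R x) \<le> s * (2 * Suc n)" using 2 s by (simp add: mult_left_mono)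
    also have "\<dots> = ?K * norm y" by (simp add: s_def)
    finally have B: "norm (s *\<^sub>R x) \<le> ?K * norm y" .
    have "s *\<^sub>R x \<in> D" using D x by (simp add: x_def subspace_diff subspace_scale)
    with A B show ?thesis by blast
  qed
  moreover have "?K > 0" using e by simp
  ultimately show ?thesis by blast
qed

text \<open>
  Successive approximation removes the error: the remainders decrease like powers of \<open>1/2\<close>, and
  the corrections sum to an element of the closed set \<open>D\<close>.
\<close>

lemma bounded_preimage:
  fixes T :: "'b::banach \<Rightarrow> 'a::banach"
  assumes T: "bounded_linear T" and D: "subspace D" "closed D" and surj: "T ` D = UNIV"
  obtains K where "\<And>y. \<exists>x\<in>D. T x = y \<and> norm x \<le> K * norm y"
proof -
  interpret T: bounded_linear T by fact
  obtain K g where K: "K > 0" and g: "\<And>y. g y \<in> D" "\<And>y. norm (g y) \<le> K * norm y"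
      "\<And>y. norm (y - T (g y)) \<le> norm y / 2"
    using surjective_approx_preimage[OF T D(1) surj] by metis
  have "\<exists>x\<in>D. T x = y \<and> norm x \<le> (2 * K) * norm y" for y
  proof -
    define r where "r k = ((\<lambda>y. y - T (g y)) ^^ k) y" for k
    have r: "r 0 = y" "r (Suc k) = r k - T (g (r k))" for k by (auto simp: r_def)
    have nr: "norm (r k) \<le> norm y * (1/2) ^ k" for k
    proof (induction k)
      case (Suc k) then show ?case using g(3)[of "r k"] by (simp add: r)
    qed (simp add: r)
    have ng: "norm (g (r k)) \<le> (K * norm y) * (1/2) ^ k" for k
    proof -
      have "norm (g (r k)) \<le> K * norm (r k)" by (rule g)
      also have "\<dots> \<le> K * (norm y * (1/2) ^ k)" using nr K by (intro mult_left_mono) auto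
      finally show ?thesis by simp
    qed
    have geo: "(\<lambda>k. (K * norm y) * (1/2) ^ k) sums ((K * norm y) * 2)"
      using sums_mult[OF geometric_sums[of "1/2::real"], of "K * norm y"] by simp
    have sm: "summable (\<lambda>k. g (r k))"
      by (rule summable_comparison_test[of _ "\<lambda>k. (K * norm y) * (1/2) ^ k"])
        (use ng geo sums_summable in auto)
    define x where "x = (\<Sum>k. g (r k))"
    have lim: "(\<lambda>n. \<Sum>k<n. g (r k)) \<longlonglongrightarrow> x"
      using sm by (simp add: x_def summable_LIMSEQ)
    have "x \<in> D"
      by (rule closed_sequentially[OF D(2) _ lim]) (use g D(1) in \<open>simp add: subspace_sum\<close>)
    moreover have "norm x \<le> (2 * K) * norm y"
      using norm_suminf_le[OF ng sums_summable[OF geo]] sums_unique[OF geo] by (simp add: x_def)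
    moreover have "T x = y"
    proof -
      have "(\<lambda>n. T (\<Sum>k<n. g (r k))) \<longlonglongrightarrow> T x" by (rule T.tendsto[OF lim])
      moreover have "T (\<Sum>k<n. g (r k)) = y - r n" for n
        by (induction n) (auto simp: r T.zero T.add)
      moreover have "r \<longlonglongrightarrow> 0"
      proof (rule Lim_null_comparison)
        show "\<forall>\<^sub>F n in sequentially. norm (r n) \<le> norm y * (1/2) ^ n" using nr by simp
        show "(\<lambda>n. norm y * (1/2) ^ n) \<longlonglongrightarrow> 0"
          by (intro tendsto_mult_right_zero LIMSEQ_power_zero) simp
      qed
      then have "(\<lambda>n. y - r n) \<longlonglongrightarrow> y - 0" by (intro tendsto_intros)
      ultimately show ?thesis using LIMSEQ_unique by fastforce
    qed
    ultimately show ?thesis by blast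
  qed
  then show ?thesis using that by blast
qed

section \<open>Bounded operators on invariant subspaces\<close>

lemma csubspaceD:
  assumes "cvec.subspace M"
  shows "0 \<in> M" "\<And>x y. x \<in> M \<Longrightarrow> y \<in> M \<Longrightarrow> x + y \<in> M"
    "\<And>x y. x \<in> M \<Longrightarrow> y \<in> M \<Longrightarrow> x - y \<in> M" "\<And>x. x \<in> M \<Longrightarrow> - x \<in> M"
    "\<And>c x. x \<in> M \<Longrightarrow> c *\<^sub>C x \<in> M"
  using cvec.subspace_0[OF assms] cvec.subspace_add[OF assms] cvec.subspace_diff[OF assms]
    cvec.subspace_neg[OF assms] cvec.subspace_scale[OF assms]
  by auto

lemma csubspace_subspace: "cvec.subspace M \<Longrightarrow> subspace M"
  by (rule subspaceI) (auto simp: csubspaceD scaleR_scaleC)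

lemma bopD:
  assumes "T \<in> bop M"
  shows "\<And>x. x \<in> M \<Longrightarrow> T x \<in> M"
    "\<And>x y. x \<in> M \<Longrightarrow> y \<in> M \<Longrightarrow> T (x + y) = T x + T y"
    "\<And>c x. x \<in> M \<Longrightarrow> T (c *\<^sub>C x) = c *\<^sub>C T x"
  using assms unfolding bop_def by blast+

lemma bop_bound:
  assumes "T \<in> bop M"
  obtains K where "K > 0" "\<And>x. x \<in> M \<Longrightarrow> norm (T x) \<le> K * norm x"
proof -
  obtain K where "\<And>x. x \<in> M \<Longrightarrow> norm (T x) \<le> K * norm x" using assms unfolding bop_def by blast
  then have "norm (T x) \<le> max K 1 * norm x" if "x \<in> M" for x
    using that by (meson max.cobounded1 mult_right_mono norm_ge_zero order_trans)
  then show ?thesis using that[of "max K 1"] by auto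
qed

lemma bop_0: "T \<in> bop M \<Longrightarrow> 0 \<in> M \<Longrightarrow> T 0 = 0"
  using bopD(3)[of T M 0 0] by simp

lemma bop_minus:
  assumes "T \<in> bop M" "cvec.subspace M" "x \<in> M" shows "T (- x) = - T x"
  using bopD(3)[OF assms(1,3), of "-1"] by (metis cvec.scale_minus_left cvec.scale_one)

lemma bop_diff:
  assumes "T \<in> bop M" "cvec.subspace M" "x \<in> M" "y \<in> M" shows "T (x - y) = T x - T y"
  using bopD(2)[OF assms(1,3), of "-y"] bop_minus[OF assms(1,2,4)] assms(4) csubspaceD(4)[OF assms(2)] by simp

lemma bop_sum:
  assumes "T \<in> bop M" "cvec.subspace M" "\<And>i. i \<in> I \<Longrightarrow> f i \<in> M"
  shows "T (sum f I) = (\<Sum>i\<in>I. T (f i))"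
  using assms(3)
proof (induction I rule: infinite_finite_induct)
  case (insert i I)
  then show ?case using bopD(2)[OF assms(1)] cvec.subspace_sum[OF assms(2), of I f] by auto
qed (use bop_0[OF assms(1)] csubspaceD(1)[OF assms(2)] in auto)

lemmas bop_lin = bopD(2,3) bop_0 bop_minus bop_diff bop_sum

lemma subspace_UNIV [simp]: "cvec.subspace UNIV" by (rule cvec.subspace_UNIV)

lemma closed_csubspace_UNIV [simp]: "closed_csubspace UNIV" by (simp add: closed_csubspace_def)

lemma bop_UNIV_simps:
  assumes "T \<in> bop UNIV"
  shows "T (x + y) = T x + T y" "T (c *\<^sub>C x) = c *\<^sub>C T x" "T 0 = 0" "T (- x) = - T x"
    "T (x - y) = T x - T y" "T (sum f I) = (\<Sum>i\<in>I. T (f i))"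
  using bop_lin[OF assms] by auto

lemma bop_bounded_linear: "T \<in> bop UNIV \<Longrightarrow> bounded_linear T"
proof -
  assume T: "T \<in> bop UNIV"
  obtain K where "\<And>x. norm (T x) \<le> K * norm x" using bop_bound[OF T] by auto
  then show ?thesis
    by (intro bounded_linear_intro[of T K]) (simp_all add: bop_UNIV_simps[OF T] scaleR_scaleC mult.commute)
qed

lemma bopI:
  assumes "\<And>x. x \<in> M \<Longrightarrow> T x \<in> M"
    "\<And>x y. x \<in> M \<Longrightarrow> y \<in> M \<Longrightarrow> T (x + y) = T x + T y"
    "\<And>c x. x \<in> M \<Longrightarrow> T (c *\<^sub>C x) = c *\<^sub>C T x"
    "\<And>x. x \<in> M \<Longrightarrow> norm (T x) \<le> K * norm x"
  shows "T \<in> bop M"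
  using assms unfolding bop_def by blast

lemma bop_id: "(\<lambda>x. x) \<in> bop M"
  by (rule bopI[of _ _ 1]) auto

lemma bop_zero: "0 \<in> M \<Longrightarrow> (\<lambda>x. 0) \<in> bop M"
  by (rule bopI[of _ _ 0]) auto

lemma bop_comp:
  assumes S: "S \<in> bop M" and T: "T \<in> bop M" shows "(\<lambda>x. S (T x)) \<in> bop M"
proof -
  obtain K L where K: "K > 0" "\<And>x. x \<in> M \<Longrightarrow> norm (S x) \<le> K * norm x"
    and L: "L > 0" "\<And>x. x \<in> M \<Longrightarrow> norm (T x) \<le> L * norm x"
    using bop_bound[OF S] bop_bound[OF T] by metis
  have "norm (S (T x)) \<le> (K * L) * norm x" if "x \<in> M" for x
    using order_trans[OF K(2)[OF bopD(1)[OF T that]] mult_left_mono[OF L(2)[OF that] less_imp_le[OF K(1)]]]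
    by (simp add: mult.assoc)
  then show ?thesis using S T by (intro bopI[of _ _ "K * L"]) (auto simp: bopD)
qed

lemma bop_add:
  assumes "cvec.subspace M" and S: "S \<in> bop M" and T: "T \<in> bop M" shows "(\<lambda>x. S x + T x) \<in> bop M"
proof -
  obtain K L where K: "\<And>x. x \<in> M \<Longrightarrow> norm (S x) \<le> K * norm x"
    and L: "\<And>x. x \<in> M \<Longrightarrow> norm (T x) \<le> L * norm x"
    using bop_bound[OF S] bop_bound[OF T] by metis
  have "norm (S x + T x) \<le> (K + L) * norm x" if "x \<in> M" for x
    using norm_triangle_ineq[of "S x" "T x"] K[OF that] L[OF that] by (simp add: algebra_simps)
  then show ?thesis using S T assms(1)
    by (intro bopI[of _ _ "K + L"]) (auto simp: bopD csubspaceD algebra_simps scaleC_add_right)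
qed

lemma bop_scale:
  assumes "cvec.subspace M" and S: "S \<in> bop M" shows "(\<lambda>x. c *\<^sub>C S x) \<in> bop M"
proof -
  obtain K where K: "\<And>x. x \<in> M \<Longrightarrow> norm (S x) \<le> K * norm x"
    using bop_bound[OF S] by metis
  then have "norm (c *\<^sub>C S x) \<le> (cmod c * K) * norm x" if "x \<in> M" for x
    using mult_left_mono[OF K[OF that], of "cmod c"] by (simp add: norm_scaleC)
  then show ?thesis using S assms(1)
    by (intro bopI[of _ _ "cmod c * K"]) (auto simp: bopD csubspaceD scaleC_add_right scaleC_scaleC mult.commute)
qed

lemma bop_neg: "cvec.subspace M \<Longrightarrow> S \<in> bop M \<Longrightarrow> (\<lambda>x. - S x) \<in> bop M"
  using bop_scale[of M S "-1"] by simp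

lemma bop_sub: "cvec.subspace M \<Longrightarrow> S \<in> bop M \<Longrightarrow> T \<in> bop M \<Longrightarrow> (\<lambda>x. S x - T x) \<in> bop M"
  using bop_add[of M S "\<lambda>x. - T x"] bop_neg by auto

lemma bop_sum_of_ops: "cvec.subspace M \<Longrightarrow> (\<And>i. i \<in> I \<Longrightarrow> S i \<in> bop M) \<Longrightarrow> (\<lambda>x. \<Sum>i\<in>I. S i x) \<in> bop M"
proof (induction I rule: infinite_finite_induct)
  case (insert i I)
  have "(\<lambda>x. S i x + (\<Sum>i\<in>I. S i x)) \<in> bop M"
  proof (rule bop_add)
    show "S i \<in> bop M" using insert.prems(2)[of i] by simp
    show "(\<lambda>x. \<Sum>i\<in>I. S i x) \<in> bop M"
      by (rule insert.IH) (simp_all add: insert.prems)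
  qed (rule insert.prems)
  then show ?case using insert(1,2) by simp
qed (simp_all add: bop_zero csubspaceD(1))

lemma bop_funpow: "T \<in> bop M \<Longrightarrow> (T ^^ n) \<in> bop M"
proof (induction n)
  case 0 then show ?case using bop_id[of M] by (simp add: id_def)
next
  case (Suc n) then show ?case using bop_comp[of T M "T ^^ n"] by (simp add: comp_def)
qed

lemma bop_shift: "cvec.subspace M \<Longrightarrow> T \<in> bop M \<Longrightarrow> op_shift T z \<in> bop M"
  unfolding op_shift_def by (intro bop_sub bop_scale bop_id)

text \<open>
  Composition is left out, since its higher-order pattern unifies with every operator.
\<close>

lemmas bop_intros = subspace_UNIV UNIV_I bop_id bop_zero bop_add bop_scale bop_neg bop_sub bop_sum_of_ops
  bop_shift

lemma bop_restrict: "T \<in> bop UNIV \<Longrightarrow> (\<And>x. x \<in> M \<Longrightarrow> T x \<in> M) \<Longrightarrow> T \<in> bop M"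
  by (rule bop_bound[of T UNIV], assumption, rule bopI) (auto simp: bop_UNIV_simps)

lemma closed_csubspace_kernel:
  assumes "T \<in> bop UNIV" shows "closed_csubspace {x. T x = 0}"
  unfolding closed_csubspace_def
proof
  show "closed {x. T x = 0}"
    by (intro closed_Collect_eq linear_continuous_on bop_bounded_linear assms continuous_on_const)
  show "cvec.subspace {x. T x = 0}"
    using assms by (auto intro!: cvec.subspaceI simp: bop_UNIV_simps)
qed

lemma closed_csubspace_range:
  assumes "F \<in> bop UNIV" "\<And>x. F (F x) = F x"
  shows "closed_csubspace {x. F x = x}" "{x. F x = x} = range F"
proof -
  have "{x. F x = x} = {x. (\<lambda>x. x - F x) x = 0}" by auto
  moreover have "(\<lambda>x. x - F x) \<in> bop UNIV" by (intro assms(1) bop_intros)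
  ultimately show "closed_csubspace {x. F x = x}" using closed_csubspace_kernel by metis
  show "{x. F x = x} = range F" using assms(2) by (auto simp: image_iff dest: sym)
qed

lemma funpow_mem: "(\<And>x. x \<in> M \<Longrightarrow> T x \<in> M) \<Longrightarrow> x \<in> M \<Longrightarrow> (T ^^ n) x \<in> M"
  by (induction n) auto

lemma funpow_commute_on:
  assumes "\<And>x. x \<in> M \<Longrightarrow> T x \<in> M" "\<And>x. x \<in> M \<Longrightarrow> S x \<in> M"
    "\<And>x. x \<in> M \<Longrightarrow> S (T x) = T (S x)" "x \<in> M"
  shows "S ((T ^^ n) x) = (T ^^ n) (S x)"
  by (induction n) (use assms funpow_mem[of M T] in auto)

section \<open>Neumann inverses and projections\<close>

text \<open>
  \<open>R = (I - z S)^(-1)\<close>. The equation \<open>y = x + z S y\<close> has a unique solution in the complete set \<open>M\<close> by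
  the contraction principle, and uniqueness makes the solution operator linear. Working on an
  arbitrary closed invariant \<open>M\<close> shows at once that \<open>R\<close> preserves \<open>M\<close>.
\<close>

lemma neumann_inverse:
  assumes M: "closed_csubspace M" and S: "S \<in> bop M"
    and K: "\<And>x. x \<in> M \<Longrightarrow> norm (S x) \<le> K * norm x" and z: "cmod z * K < 1" and "K \<ge> 0"
  shows "\<exists>R\<in>bop M. \<forall>x\<in>M. R (x - z *\<^sub>C S x) = x \<and> R x - z *\<^sub>C S (R x) = x \<and>
    norm (R x) \<le> norm x / (1 - cmod z * K)"
proof -
  have sM: "cvec.subspace M" and cM: "complete M"
    using M by (auto simp: closed_csubspace_def complete_eq_closed)
  note mem = csubspaceD[OF sM] bopD(1)[OF S]
  let ?c = "cmod z * K"
  have "\<exists>!y. y \<in> M \<and> x + z *\<^sub>C S y = y" if x: "x \<in> M" for x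
  proof -
    have "\<exists>!y\<in>M. x + z *\<^sub>C S y = y"
    proof (rule Banach_fix[OF cM, of ?c])
      show "M \<noteq> {}" using x by blast
      show "(\<lambda>y. x + z *\<^sub>C S y) ` M \<subseteq> M" using x mem by auto
      fix u v assume uv: "u \<in> M" "v \<in> M"
      have "dist (x + z *\<^sub>C S u) (x + z *\<^sub>C S v) = cmod z * norm (S (u - v))"
        using uv by (simp add: dist_norm bop_diff[OF S sM] norm_scaleC flip: cvec.scale_right_diff_distrib)
      also have "\<dots> \<le> cmod z * (K * norm (u - v))" using uv mem K by (intro mult_left_mono) auto
      finally show "dist (x + z *\<^sub>C S u) (x + z *\<^sub>C S v) \<le> ?c * dist u v" by (simp add: dist_norm)
    qed (use assms in auto)
    then show ?thesis by blast
  qed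
  then obtain R where R: "\<And>x. x \<in> M \<Longrightarrow> R x \<in> M" "\<And>x. x \<in> M \<Longrightarrow> x + z *\<^sub>C S (R x) = R x"
    and uniq: "\<And>x y. x \<in> M \<Longrightarrow> y \<in> M \<Longrightarrow> x + z *\<^sub>C S y = y \<Longrightarrow> R x = y"
    by metis
  have b: "norm (R x) \<le> norm x / (1 - ?c)" if x: "x \<in> M" for x
  proof -
    have "norm (R x) \<le> norm x + cmod z * norm (S (R x))"
      using norm_triangle_ineq[of x "z *\<^sub>C S (R x)"] R(2)[OF x] by (simp add: norm_scaleC)
    also have "\<dots> \<le> norm x + cmod z * (K * norm (R x))"
      using K[OF R(1)[OF x]] by (simp add: mult_left_mono)
    finally show ?thesis using z by (simp add: field_simps)
  qed
  have "R \<in> bop M"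
  proof (rule bopI[of _ _ "1 / (1 - ?c)"])
    fix x y assume "x \<in> M" "y \<in> M"
    moreover from this have "x + y + z *\<^sub>C S (R x + R y) = (x + z *\<^sub>C S (R x)) + (y + z *\<^sub>C S (R y))"
      using R(1) by (simp add: bopD(2)[OF S] scaleC_add_right)
    ultimately show "R (x + y) = R x + R y"
      using R mem by (intro uniq) auto
  next
    fix c x assume x: "x \<in> M"
    have "c *\<^sub>C x + z *\<^sub>C S (c *\<^sub>C R x) = c *\<^sub>C (x + z *\<^sub>C S (R x))"
      using R(1)[OF x] by (simp add: bopD(3)[OF S] scaleC_add_right scaleC_scaleC mult.commute)
    then show "R (c *\<^sub>C x) = c *\<^sub>C R x"
      using R x mem by (intro uniq) auto
  qed (use R b in auto)
  moreover have "R (x - z *\<^sub>C S x) = x" if "x \<in> M" for x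
    using that mem by (intro uniq) auto
  moreover have "R x - z *\<^sub>C S (R x) = x" if "x \<in> M" for x
    using R(2)[OF that] by (simp add: algebra_simps)
  ultimately show ?thesis using b by blast
qed

text \<open>
  The projection along a closed complement is bounded, because addition \<open>M \<times> N \<rightarrow> X\<close> is
  a surjection with bounded preimages.
\<close>

lemma direct_sum_projection:
  assumes M: "closed_csubspace M" and N: "closed_csubspace N"
    and MN: "M \<inter> N = {0}" "ssum M N = UNIV"
  obtains Q where "Q \<in> bop UNIV" "\<And>x. Q x \<in> M" "\<And>x. x - Q x \<in> N"
    "\<And>x. x \<in> M \<Longrightarrow> Q x = x" "\<And>x. x \<in> N \<Longrightarrow> Q x = 0"
proof -
  have sM: "cvec.subspace M" and sN: "cvec.subspace N" and cl: "closed M" "closed N"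
    using M N by (auto simp: closed_csubspace_def)
  have "bounded_linear (\<lambda>p::'a \<times> 'a. fst p + snd p)"
    by (intro bounded_linear_add bounded_linear_fst bounded_linear_snd)
  moreover have "subspace (M \<times> N)" by (intro subspace_Times csubspace_subspace sM sN)
  moreover have "closed (M \<times> N)" using cl by (rule closed_Times)
  moreover have "(\<lambda>p. fst p + snd p) ` (M \<times> N) = UNIV"
    using MN(2) unfolding ssum_def by (force simp: image_def)
  ultimately obtain K where K: "\<And>y. \<exists>p\<in>M \<times> N. fst p + snd p = y \<and> norm p \<le> K * norm y"
    by (rule bounded_preimage) blast
  then obtain p where p: "\<And>y. p y \<in> M \<times> N" "\<And>y. fst (p y) + snd (p y) = y" "\<And>y. norm (p y) \<le> K * norm y"
    by metis
  have uniq: "fst (p y) = u" if "u \<in> M" "y - u \<in> N" for y u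
  proof -
    have "fst (p y) - u = (y - u) - snd (p y)" using p(2)[of y] by (simp add: algebra_simps)
    moreover have "fst (p y) - u \<in> M" "(y - u) - snd (p y) \<in> N"
      using p(1)[of y] that csubspaceD[OF sM] csubspaceD[OF sN] by (auto simp: mem_Times_iff)
    ultimately show ?thesis using MN(1) by (metis IntI eq_iff_diff_eq_0 singletonD)
  qed
  have P: "fst (p y) \<in> M" "y - fst (p y) \<in> N" for y
  proof -
    have "fst (p y) + snd (p y) - fst (p y) = snd (p y)" by simp
    then have e: "y - fst (p y) = snd (p y)" unfolding p(2) .
    show "fst (p y) \<in> M" "y - fst (p y) \<in> N" unfolding e using p(1)[of y] by (simp_all add: mem_Times_iff)
  qed
  have "(\<lambda>y. fst (p y)) \<in> bop UNIV"
  proof (rule bopI[of _ _ K])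
    show "fst (p (x + y)) = fst (p x) + fst (p y)" for x y
    proof (rule uniq)
      show "fst (p x) + fst (p y) \<in> M" using P csubspaceD[OF sM] by auto
      have "(x - fst (p x)) + (y - fst (p y)) \<in> N" by (rule csubspaceD(2)[OF sN P(2) P(2)])
      then show "x + y - (fst (p x) + fst (p y)) \<in> N" by (simp add: algebra_simps)
    qed
    show "fst (p (c *\<^sub>C x)) = c *\<^sub>C fst (p x)" for c x
    proof (rule uniq)
      show "c *\<^sub>C fst (p x) \<in> M" using P csubspaceD[OF sM] by auto
      have "c *\<^sub>C (x - fst (p x)) \<in> N" by (rule csubspaceD(5)[OF sN P(2)])
      then show "c *\<^sub>C x - c *\<^sub>C fst (p x) \<in> N" by (simp add: cvec.scale_right_diff_distrib)
    qed
    show "norm (fst (p x)) \<le> K * norm x" for x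
      using p(3)[of x] norm_fst_le[of "fst (p x)" "snd (p x)"] by simp
  qed auto
  moreover have "fst (p x) = x" if "x \<in> M" for x
    using that csubspaceD(1)[OF sN] by (intro uniq) auto
  moreover have "fst (p x) = 0" if "x \<in> N" for x
    using that csubspaceD(1)[OF sM] by (intro uniq) auto
  ultimately show ?thesis using P that by blast
qed

section \<open>Drazin invertibility and poles of the resolvent\<close>

text \<open>
  The weak form of the Drazin equations is used because it is inherited by compressions to
  reducing subspaces without first proving that \<open>S\<close> commutes with the projector.
\<close>

definition Drazin_on :: "'a::complex_banach set \<Rightarrow> ('a \<Rightarrow> 'a) \<Rightarrow> bool" where
  "Drazin_on M U \<longleftrightarrow> (\<exists>S\<in>bop M. \<exists>p. \<forall>x\<in>M. S (U x) = U (S x) \<and> (U ^^ Suc p) (S x) = (U ^^ p) x)"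

text \<open>
  \<open>S^(p+1) U^p\<close> is the genuine Drazin inverse: it satisfies in addition \<open>S U S = S\<close>, so that
  \<open>S U\<close> is a projector onto the part where \<open>U\<close> is invertible, with \<open>U\<close> nilpotent on the kernel.
\<close>

lemma Drazin_inverse:
  assumes sM: "cvec.subspace M" and U: "U \<in> bop M" and D: "Drazin_on M U"
  shows "\<exists>S\<in>bop M. \<exists>p. \<forall>x\<in>M. S (U x) = U (S x) \<and> S (U (S x)) = S x \<and> (U ^^ p) (x - S (U x)) = 0"
proof -
  obtain S0 p where S0: "S0 \<in> bop M" and com: "\<And>x. x \<in> M \<Longrightarrow> S0 (U x) = U (S0 x)"
    and pw: "\<And>x. x \<in> M \<Longrightarrow> (U ^^ Suc p) (S0 x) = (U ^^ p) x"
    using D unfolding Drazin_on_def by blast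
  note mem = bopD(1)[OF U] bopD(1)[OF S0]
  have Um: "(U ^^ i) x \<in> M" and Sm: "(S0 ^^ i) x \<in> M" if "x \<in> M" for i x
    using that U S0 bop_funpow bopD(1) by blast+
  have c1: "(S0 ^^ i) ((U ^^ j) x) = (U ^^ j) ((S0 ^^ i) x)" if "x \<in> M" for i j x
  proof -
    have "S0 ((U ^^ j) x) = (U ^^ j) (S0 x)" if "x \<in> M" for x
      by (rule funpow_commute_on[of M]) (use that mem com in auto)
    then show ?thesis using that
      using funpow_commute_on[of M S0 "U ^^ j" x i] Um mem by simp
  qed
  have a: "(U ^^ (p + k)) ((S0 ^^ k) x) = (U ^^ p) x" if "x \<in> M" for k x
  proof (induction k)
    case (Suc k)
    have "(U ^^ (p + Suc k)) ((S0 ^^ Suc k) x) = (U ^^ k) ((U ^^ Suc p) (S0 ((S0 ^^ k) x)))"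
      by (simp add: funpow_add[symmetric, THEN fun_cong, unfolded comp_def] add.commute
          del: funpow.simps(2)) simp
    also have "\<dots> = (U ^^ (p + k)) ((S0 ^^ k) x)"
      using pw[OF Sm[OF that]] by (simp add: funpow_add add.commute[of p] del: funpow.simps(2))
    finally show ?case using Suc by simp
  qed simp
  define S where "S x = (S0 ^^ Suc p) ((U ^^ p) x)" for x
  have S: "S \<in> bop M" unfolding S_def by (rule bop_comp[OF bop_funpow[OF S0] bop_funpow[OF U]])
  \<comment> \<open>\<open>U^(2p+1) S0^(p+1) = U^p\<close>\<close>
  have key: "(U ^^ p) ((U ^^ Suc p) ((S0 ^^ Suc p) x)) = (U ^^ p) x" if "x \<in> M" for x
    using a[OF that, of "Suc p"] by (metis comp_apply funpow_add)
  have k1: "S (U x) = U (S x)" if "x \<in> M" for x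
    unfolding S_def using c1[OF Um[OF that, of p], of "Suc p" 1]
    by (simp add: funpow_swap1[of U])
  have k2: "S (U (S x)) = S x" if "x \<in> M" for x
  proof -
    let ?y = "(S0 ^^ Suc p) ((U ^^ p) x)"
    have "(U ^^ p) (U ?y) = (U ^^ Suc p) ((U ^^ p) ((S0 ^^ Suc p) x))"
      by (subst c1[OF that]) (simp add: funpow_swap1)
    also have "\<dots> = (U ^^ p) ((U ^^ Suc p) ((S0 ^^ Suc p) x))"
      by (metis add.commute comp_apply funpow_add)
    also have "\<dots> = (U ^^ p) x" by (rule key[OF that])
    finally show ?thesis unfolding S_def by simp
  qed
  have k3: "(U ^^ p) (x - S (U x)) = 0" if "x \<in> M" for x
  proof -
    have "S (U x) = (U ^^ Suc p) ((S0 ^^ Suc p) x)"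
      unfolding S_def using c1[OF that, of "Suc p" "Suc p"] by (simp add: funpow_swap1)
    moreover have "(U ^^ p) (x - S (U x)) = (U ^^ p) x - (U ^^ p) (S (U x))"
      by (rule bop_diff[OF bop_funpow[OF U] sM that]) (use S mem that bopD(1) in blast)
    ultimately show ?thesis using key[OF that] by simp
  qed
  show ?thesis using S k1 k2 k3 by metis
qed

lemma op_shift_op_shift: "op_shift (op_shift A w) u = op_shift A (w + u)"
  by (auto simp: op_shift_def scaleC_add_left)

text \<open>
  \<open>G\<close> is the Laurent expansion of \<open>(U - u)^(-1)\<close> in closed form: the regular part
  \<open>S (I - u S)^(-1)\<close> inverts \<open>U - u\<close> where \<open>U\<close> is invertible, and the finite principal part is the
  geometric series inverting \<open>U - u\<close> where \<open>U\<close> is nilpotent.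
\<close>

lemma Drazin_shift_invertible:
  assumes M: "closed_csubspace M" and U: "U \<in> bop M" and S: "S \<in> bop M"
    and com: "\<And>x. x \<in> M \<Longrightarrow> S (U x) = U (S x)"
    and SUS: "\<And>x. x \<in> M \<Longrightarrow> S (U (S x)) = S x"
    and nil: "\<And>x. x \<in> M \<Longrightarrow> (U ^^ p) (x - S (U x)) = 0"
    and K: "\<And>x. x \<in> M \<Longrightarrow> norm (S x) \<le> K * norm x" "K \<ge> 0" and u: "cmod u * K < 1" "u \<noteq> 0"
    and R: "R \<in> bop M" "\<And>x. x \<in> M \<Longrightarrow> R (x - u *\<^sub>C S x) = x" "\<And>x. x \<in> M \<Longrightarrow> R x - u *\<^sub>C S (R x) = x"
  defines "G \<equiv> (\<lambda>x. S (R x) - (\<Sum>k<p. (1/u) ^ Suc k *\<^sub>C (U ^^ k) (x - S (U x))))"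
  shows "G \<in> bop M" "\<And>x. x \<in> M \<Longrightarrow> op_shift U u (G x) = x" "\<And>x. x \<in> M \<Longrightarrow> G (op_shift U u x) = x"
proof -
  have sM: "cvec.subspace M" using M by (simp add: closed_csubspace_def)
  note mem = bopD(1)[OF U] bopD(1)[OF S] bopD(1)[OF R(1)] csubspaceD[OF sM]
    bopD(1)[OF bop_funpow[OF U]]
  note lin = bop_lin[OF U] bop_lin[OF S]
  note linp = bop_lin[OF bop_funpow[OF U]]
  show G: "G \<in> bop M" unfolding G_def
    by (intro sM S U R(1) bop_intros bop_comp[OF S] bop_comp[OF bop_funpow[OF U]])
  show right: "op_shift U u (G x) = x" if x: "x \<in> M" for x
  proof -
    define y where "y = x - S (U x)"
    define T where "T = (\<Sum>k<p. (1/u) ^ Suc k *\<^sub>C (U ^^ k) y)"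
    have y: "y \<in> M" using x mem by (simp add: y_def)
    have T: "T \<in> M" unfolding T_def by (intro cvec.subspace_sum sM) (use y mem in auto)
    have "U T - u *\<^sub>C T = (\<Sum>k<p. (1/u) ^ Suc k *\<^sub>C (U ^^ Suc k) y - (1/u) ^ k *\<^sub>C (U ^^ k) y)"
    proof -
      have "U T = (\<Sum>k<p. (1/u) ^ Suc k *\<^sub>C (U ^^ Suc k) y)"
        unfolding T_def using y mem by (subst bop_sum[OF U sM]) (auto simp: bopD(3)[OF U])
      moreover have "u *\<^sub>C T = (\<Sum>k<p. (1/u) ^ k *\<^sub>C (U ^^ k) y)"
        unfolding T_def by (simp add: cvec.scale_sum_right scaleC_scaleC u)
      ultimately show ?thesis by (simp add: sum_subtractf)
    qed
    also have "\<dots> = (1/u)^p *\<^sub>C (U ^^ p) y - y"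
      by (subst sum_lessThan_telescope[of "\<lambda>k. (1/u) ^ k *\<^sub>C (U ^^ k) y" p]) simp
    also have "\<dots> = - y" using nil[OF x] by (simp add: y_def)
    finally have 1: "U T - u *\<^sub>C T = - y" .
    have Rx: "R x \<in> M" using x mem by auto
    have "U (S (R x)) = U (S (x + u *\<^sub>C S (R x)))" using R(3)[OF x] by (metis add.commute diff_add_cancel)
    also have "\<dots> = U (S x) + u *\<^sub>C U (S (S (R x)))" using x Rx mem by (simp add: lin)
    also have "U (S (S (R x))) = S (R x)" using SUS com Rx mem by metis
    finally have 2: "U (S (R x)) - u *\<^sub>C S (R x) = S (U x)" using com[OF x] by simp
    have "op_shift U u (G x) = (U (S (R x)) - u *\<^sub>C S (R x)) - (U T - u *\<^sub>C T)"
      unfolding G_def op_shift_def y_def[symmetric] T_def[symmetric]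
      using T Rx mem bop_diff[OF U sM] by (simp add: cvec.scale_right_diff_distrib)
    then show ?thesis using 1 2 by (simp add: y_def)
  qed
  have inj: "x = 0" if x: "x \<in> M" and 0: "op_shift U u x = 0" for x
  proof -
    have Ux: "U x = u *\<^sub>C x" using 0 by (simp add: op_shift_def)
    have pw: "(U ^^ k) x = u ^ k *\<^sub>C x" for k
      by (induction k) (use x mem in \<open>auto simp: Ux bopD(3)[OF U] scaleC_scaleC\<close>)
    have "S ((U ^^ p) x) = (U ^^ p) (S x)"
      by (rule funpow_commute_on[of M]) (use x mem com in auto)
    then have Up: "(U ^^ p) (S x) = u ^ p *\<^sub>C S x" using x by (simp add: pw bopD(3)[OF S])
    have "0 = (U ^^ p) (x - u *\<^sub>C S x)" using nil[OF x] x by (simp add: Ux bopD(3)[OF S])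
    also have "\<dots> = (U ^^ p) x - u *\<^sub>C (U ^^ p) (S x)"
      using x mem by (simp add: bop_diff[OF bop_funpow[OF U] sM] bopD(3)[OF bop_funpow[OF U]])
    also have "\<dots> = u ^ p *\<^sub>C (x - u *\<^sub>C S x)"
      by (simp add: pw Up cvec.scale_right_diff_distrib scaleC_scaleC mult.commute)
    finally have "x - u *\<^sub>C S x = 0" using u by simp
    then show ?thesis using R(2)[OF x] bop_0[OF R(1)] mem(4) by simp
  qed
  show "G (op_shift U u x) = x" if x: "x \<in> M" for x
  proof -
    have s: "op_shift U u \<in> bop M" by (intro sM U bop_shift)
    note m = bopD(1)[OF s x] bopD(1)[OF G bopD(1)[OF s x]]
    have "op_shift U u (G (op_shift U u x) - x) = 0"
      using bop_diff[OF s sM m(2) x] right[OF m(1)] by simp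
    then show ?thesis using inj[of "G (op_shift U u x) - x"] m x mem by simp
  qed
qed

text \<open>
  The Neumann series with its exact remainder; it yields uniform convergence on the unit ball.
\<close>

lemma geometric_remainder:
  assumes S: "S \<in> bop M" and sM: "cvec.subspace M" and x: "y \<in> M" and eq: "y - u *\<^sub>C S y = x"
  shows "y = (\<Sum>j<k. u ^ j *\<^sub>C (S ^^ j) x) + u ^ k *\<^sub>C (S ^^ k) y"
proof (induction k)
  case (Suc k)
  have "(S ^^ k) y = (S ^^ k) (x + u *\<^sub>C S y)" using eq by (simp add: algebra_simps)
  also have "x \<in> M"
    unfolding eq[symmetric] by (intro csubspaceD(3,5)[OF sM] bopD(1)[OF S] x)
  then have "(S ^^ k) (x + u *\<^sub>C S y) = (S ^^ k) x + u *\<^sub>C (S ^^ k) (S y)"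
    using x csubspaceD[OF sM] bopD[OF S] bopD(2,3)[OF bop_funpow[OF S]] by simp
  also have "(S ^^ k) (S y) = (S ^^ Suc k) y" by (simp add: funpow_swap1)
  finally have "u ^ k *\<^sub>C (S ^^ k) y = u ^ k *\<^sub>C (S ^^ k) x + u ^ Suc k *\<^sub>C (S ^^ Suc k) y"
    by (simp add: scaleC_add_right scaleC_scaleC mult.commute del: funpow.simps)
  then show ?case using Suc by (simp add: add.assoc del: funpow.simps power_Suc)
qed simp

lemma bop_funpow_bound:
  assumes S: "S \<in> bop M" and K: "\<And>x. x \<in> M \<Longrightarrow> norm (S x) \<le> K * norm x" "K \<ge> 0" and x: "x \<in> M"
  shows "norm ((S ^^ k) x) \<le> K ^ k * norm x"
proof (induction k)
  case (Suc k)
  have "norm ((S ^^ Suc k) x) \<le> K * norm ((S ^^ k) x)"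
    using K(1)[OF bopD(1)[OF bop_funpow[OF S] x]] by simp
  also have "\<dots> \<le> K * (K ^ k * norm x)" using Suc K by (intro mult_left_mono)
  finally show ?case by (simp add: mult.assoc)
qed simp

lemma resolvent_eq_inverse:
  assumes "G \<in> bop M" "\<And>x. x \<in> M \<Longrightarrow> op_shift A z (G x) = x" "\<And>x. x \<in> M \<Longrightarrow> G (op_shift A z x) = x"
    and x: "x \<in> M"
  shows "resolvent M A z x = G x"
  unfolding resolvent_def
  using assms by (intro inv_into_f_eq inj_on_inverseI[of _ G]) (auto simp: bopD(1))

text \<open>
  Taking \<open>p\<close> minimal makes the coefficient of order \<open>-p\<close> nonzero, and \<open>p \<ge> 1\<close> because \<open>w\<close>
  belongs to the spectrum.
\<close>

lemma Drazin_imp_pole: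
  assumes M: "closed_csubspace M" and A: "A \<in> bop M" and D: "Drazin_on M (op_shift A w)"
    and w: "w \<in> op_spectrum M A"
  shows "pole_of_resolvent M A w"
proof -
  define U where "U = op_shift A w"
  have sM: "cvec.subspace M" using M by (simp add: closed_csubspace_def)
  have U: "U \<in> bop M" unfolding U_def by (intro sM A bop_shift)
  obtain S p0 where S: "S \<in> bop M" and com: "\<And>x. x \<in> M \<Longrightarrow> S (U x) = U (S x)"
    and SUS: "\<And>x. x \<in> M \<Longrightarrow> S (U (S x)) = S x"
    and nil0: "\<And>x. x \<in> M \<Longrightarrow> (U ^^ p0) (x - S (U x)) = 0"
    using Drazin_inverse[OF sM U D[folded U_def]] by metis
  define p where "p = (LEAST p. \<forall>x\<in>M. (U ^^ p) (x - S (U x)) = 0)"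
  have nil: "(U ^^ p) (x - S (U x)) = 0" if "x \<in> M" for x
    using LeastI[of "\<lambda>p. \<forall>x\<in>M. (U ^^ p) (x - S (U x)) = 0" p0] nil0 that unfolding p_def by blast
  have p1: "p \<ge> 1"
  proof (rule ccontr)
    assume "\<not> p \<ge> 1"
    then have "p = 0" by simp
    then have "\<forall>x\<in>M. S (U x) = x" using nil by simp
    then have "\<forall>x\<in>M. S (U x) = x \<and> U (S x) = x" using com by simp
    then show False using w S unfolding op_spectrum_def invertible_op_def U_def by blast
  qed
  have "\<not> (\<forall>x\<in>M. (U ^^ (p - 1)) (x - S (U x)) = 0)"
    using not_less_Least[of "p - 1" "\<lambda>p. \<forall>x\<in>M. (U ^^ p) (x - S (U x)) = 0"] p1 unfolding p_def[symmetric]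
    by simp
  then obtain x0 where x0: "x0 \<in> M" "(U ^^ (p - 1)) (x0 - S (U x0)) \<noteq> 0" by blast
  define B where "B n x = (if n < p then - (U ^^ (p - Suc n)) (x - S (U x)) else (S ^^ Suc (n - p)) x)" for n x
  have B: "B n \<in> bop M" for n
  proof (cases "n < p")
    case True
    have "(\<lambda>x. - (U ^^ (p - Suc n)) (x - S (U x))) \<in> bop M"
      by (intro sM S U bop_intros bop_comp[OF bop_funpow[OF U]] bop_comp[OF S])
    then show ?thesis using True by (simp add: B_def[abs_def])
  next
    case False
    then show ?thesis using bop_funpow[OF S, of "Suc (n - p)"] by (simp add: B_def[abs_def] comp_def)
  qed
  obtain K where K: "K > 0" "\<And>x. x \<in> M \<Longrightarrow> norm (S x) \<le> K * norm x" using bop_bound[OF S] by blast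
  define r where "r = 1 / K"
  have main: "z \<notin> op_spectrum M A \<and> uniform_limit {x \<in> M. norm x \<le> 1}
             (\<lambda>k x. \<Sum>n<k. ((z - w) powi (int n - int p)) *\<^sub>C B n x) (resolvent M A z) sequentially"
    if z: "z \<in> ball w r - {w}" for z
  proof -
    define u where "u = z - w"
    have u: "u \<noteq> 0" "cmod u * K < 1" using z K by (auto simp: u_def r_def dist_norm norm_minus_commute field_simps)
    obtain R where R: "R \<in> bop M" "\<And>x. x \<in> M \<Longrightarrow> R (x - u *\<^sub>C S x) = x"
       "\<And>x. x \<in> M \<Longrightarrow> R x - u *\<^sub>C S (R x) = x"
      using neumann_inverse[OF M S K(2) u(2) less_imp_le[OF K(1)]] by metis
    define T where "T x = (\<Sum>k<p. (1/u) ^ Suc k *\<^sub>C (U ^^ k) (x - S (U x)))" for x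
    define G where "G x = S (R x) - T x" for x
    have sh: "op_shift U u = op_shift A z" by (simp add: U_def op_shift_op_shift u_def)
    note * = Drazin_shift_invertible[OF M U S com SUS nil K(2) less_imp_le[OF K(1)] u(2,1) R, folded T_def, folded G_def, unfolded sh]
    have "z \<notin> op_spectrum M A" unfolding op_spectrum_def invertible_op_def using * by blast
    moreover have res: "resolvent M A z x = G x" if "x \<in> M" for x
      using resolvent_eq_inverse[OF * that] by blast
    obtain L where L: "L > 0" "\<And>x. x \<in> M \<Longrightarrow> norm (R x) \<le> L * norm x" using bop_bound[OF R(1)] by blast
    have part: "(\<Sum>n<k. (u powi (int n - int p)) *\<^sub>C B n x) = G x - S (u ^ (k - p) *\<^sub>C (S ^^ (k - p)) (R x))"
      if k: "k \<ge> p" and x: "x \<in> M" for k x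
    proof -
      have "(\<Sum>n<k. (u powi (int n - int p)) *\<^sub>C B n x) =
        (\<Sum>n<p. (u powi (int n - int p)) *\<^sub>C B n x) + (\<Sum>n=p..<k. (u powi (int n - int p)) *\<^sub>C B n x)"
        using k by (simp add: sum.atLeastLessThan_concat lessThan_atLeast0)
      also have "(\<Sum>n<p. (u powi (int n - int p)) *\<^sub>C B n x) = - T x"
      proof -
        have "T x = (\<Sum>n<p. (1/u) ^ Suc (p - Suc n) *\<^sub>C (U ^^ (p - Suc n)) (x - S (U x)))"
          unfolding T_def by (rule sum.nat_diff_reindex[symmetric])
        also have "\<dots> = (\<Sum>n<p. - ((u powi (int n - int p)) *\<^sub>C B n x))"
        proof (rule sum.cong)
          fix n assume n: "n \<in> {..<p}"
          then have "int n - int p = - int (Suc (p - Suc n))" by auto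
          then have "u powi (int n - int p) = (1/u) ^ Suc (p - Suc n)"
            by (simp only: power_int_minus power_int_of_nat) (simp add: power_divide field_simps)
          then show "(1/u) ^ Suc (p - Suc n) *\<^sub>C (U ^^ (p - Suc n)) (x - S (U x)) =
            - ((u powi (int n - int p)) *\<^sub>C B n x)" using n by (simp add: B_def)
        qed simp
        finally show ?thesis by (simp add: sum_negf)
      qed
      also have "(\<Sum>n=p..<k. (u powi (int n - int p)) *\<^sub>C B n x) = (\<Sum>j<k-p. u ^ j *\<^sub>C S ((S ^^ j) x))"
      proof -
        have "(\<Sum>n=p..<k. (u powi (int n - int p)) *\<^sub>C B n x) =
          (\<Sum>j=0..<k-p. (u powi (int (j + p) - int p)) *\<^sub>C B (j + p) x)"
          using sum.shift_bounds_nat_ivl[of "\<lambda>n. (u powi (int n - int p)) *\<^sub>C B n x" 0 p "k - p"] k by simp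
        then show ?thesis by (simp add: B_def lessThan_atLeast0)
      qed
      also have "\<dots> = S (\<Sum>j<k-p. u ^ j *\<^sub>C (S ^^ j) x)"
        using x csubspaceD[OF sM] bopD(1)[OF bop_funpow[OF S]]
        by (subst bop_sum[OF S sM]) (auto simp: bopD(3)[OF S])
      also have "(\<Sum>j<k-p. u ^ j *\<^sub>C (S ^^ j) x) = R x - u ^ (k-p) *\<^sub>C (S ^^ (k-p)) (R x)"
        using geometric_remainder[OF S sM bopD(1)[OF R(1) x] R(3)[OF x], of "k - p"] by (simp add: algebra_simps)
      also have "S \<dots> = S (R x) - S (u ^ (k-p) *\<^sub>C (S ^^ (k-p)) (R x))"
        using bopD(1)[OF R(1) x] csubspaceD[OF sM] bopD(1)[OF bop_funpow[OF S]] by (intro bop_diff[OF S sM]) auto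
      finally show ?thesis by (simp add: G_def)
    qed
    have bnd: "norm (S (u ^ j *\<^sub>C (S ^^ j) (R x))) \<le> (K * L) * (cmod u * K) ^ j" if x: "x \<in> M" "norm x \<le> 1" for x j
    proof -
      note m = bopD(1)[OF R(1) x(1)]
      have "norm (S (u ^ j *\<^sub>C (S ^^ j) (R x))) = norm (u ^ j *\<^sub>C (S ^^ Suc j) (R x))"
        using m bopD(1)[OF bop_funpow[OF S]] by (simp add: bopD(3)[OF S])
      also have "\<dots> \<le> cmod u ^ j * (K ^ Suc j * norm (R x))"
        using bop_funpow_bound[OF S K(2) less_imp_le[OF K(1)] m, of "Suc j"]
        unfolding norm_scaleC norm_power by (intro mult_left_mono) auto
      also have "\<dots> \<le> cmod u ^ j * (K ^ Suc j * L)"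
        using order_trans[OF L(2)[OF x(1)], of L] mult_left_mono[OF x(2), of L] L(1) K(1)
        by (intro mult_left_mono) auto
      finally show ?thesis by (simp add: power_mult_distrib mult_ac)
    qed
    have "uniform_limit {x \<in> M. norm x \<le> 1}
             (\<lambda>k x. \<Sum>n<k. (u powi (int n - int p)) *\<^sub>C B n x) (resolvent M A z) sequentially"
    proof (rule uniform_limitI)
      fix e :: real assume e: "e > 0"
      have "(\<lambda>j. (K * L) * (cmod u * K) ^ j) \<longlonglongrightarrow> 0"
        using u K by (intro tendsto_mult_right_zero LIMSEQ_power_zero) auto
      then have "eventually (\<lambda>j. (K * L) * (cmod u * K) ^ j < e) sequentially"
        using e by (rule order_tendstoD)
      then obtain J where J: "\<And>j. j \<ge> J \<Longrightarrow> (K * L) * (cmod u * K) ^ j < e"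
        by (auto simp: eventually_sequentially)
      have "dist (\<Sum>n<k. (u powi (int n - int p)) *\<^sub>C B n x) (resolvent M A z x) < e"
        if k: "k \<ge> J + p" and x: "x \<in> M" "norm x \<le> 1" for k x
      proof -
        have "dist (\<Sum>n<k. (u powi (int n - int p)) *\<^sub>C B n x) (resolvent M A z x)
          = norm (S (u ^ (k - p) *\<^sub>C (S ^^ (k - p)) (R x)))"
          using k x by (simp add: part res dist_norm)
        also have "\<dots> < e" using bnd[OF x, of "k - p"] J[of "k - p"] k by linarith
        finally show ?thesis .
      qed
      then show "\<forall>\<^sub>F k in sequentially. \<forall>x\<in>{x \<in> M. norm x \<le> 1}.
          dist (\<Sum>n<k. (u powi (int n - int p)) *\<^sub>C B n x) (resolvent M A z x) < e"
        unfolding eventually_sequentially by blast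
    qed
    ultimately show ?thesis by (simp add: u_def)
  qed
  have "r > 0" using K by (simp add: r_def)
  moreover have "\<exists>x\<in>M. B 0 x \<noteq> 0" using x0 p1 by (intro bexI[of _ x0]) (auto simp: B_def)
  ultimately show ?thesis unfolding pole_of_resolvent_def using B p1 main by blast
qed

text \<open>
  Uniqueness of vector-valued power series coefficients: the first nonzero coefficient would
  dominate the tail as the argument tends to \<open>0\<close>.
\<close>

lemma cvec_power_series_zero:
  fixes c :: "nat \<Rightarrow> 'a::complex_banach"
  assumes r: "r > 0" and s: "\<And>u. u \<noteq> 0 \<Longrightarrow> cmod u < r \<Longrightarrow> (\<lambda>n. u ^ n *\<^sub>C c n) sums 0"
  shows "c n = 0"
proof (induction n rule: less_induct)
  case (less n)
  \<comment> \<open>convergence at the radius \<open>\<rho>\<close> bounds the coefficients; the argument is then scaled by \<open>t \<le> 1/2\<close>\<close>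
  define \<rho> where "\<rho> = r / 2"
  have \<rho>: "\<rho> > 0" "\<rho> < r" using r by (auto simp: \<rho>_def)
  have "(\<lambda>m. complex_of_real \<rho> ^ m *\<^sub>C c m) sums 0" using \<rho> by (intro s) auto
  then have "(\<lambda>m. complex_of_real \<rho> ^ m *\<^sub>C c m) \<longlonglongrightarrow> 0" by (intro summable_LIMSEQ_zero sums_summable)
  then have "Bseq (\<lambda>m. complex_of_real \<rho> ^ m *\<^sub>C c m)" by (intro convergent_imp_Bseq convergentI)
  then obtain K where K: "K > 0" "\<And>m. norm (complex_of_real \<rho> ^ m *\<^sub>C c m) \<le> K"
    unfolding Bseq_def by blast
  have K': "\<rho> ^ m * norm (c m) \<le> K" for m
    using K(2)[of m] \<rho> by (simp add: norm_scaleC norm_power)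
  have main: "\<rho> ^ n * norm (c n) \<le> 2 * K * t" if t: "0 < t" "t \<le> 1/2" for t :: real
  proof -
    let ?u = "complex_of_real (t * \<rho>)"
    have "t * \<rho> \<le> \<rho>" using t \<rho> by (simp add: mult_left_le_one_le)
    then have "t * \<rho> < r" using \<rho> by linarith
    then have "cmod ?u < r" using t \<rho> by (simp add: norm_mult)
    then have "(\<lambda>m. ?u ^ m *\<^sub>C c m) sums 0" using t \<rho> by (intro s) auto
    then have "(\<lambda>m. ?u ^ (m + Suc n) *\<^sub>C c (m + Suc n)) sums (0 - (\<Sum>m<Suc n. ?u ^ m *\<^sub>C c m))"
      by (rule sums_split_initial_segment)
    also have "(\<Sum>m<Suc n. ?u ^ m *\<^sub>C c m) = ?u ^ n *\<^sub>C c n" using less by simp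
    finally have 1: "(\<lambda>m. ?u ^ (m + Suc n) *\<^sub>C c (m + Suc n)) sums (- (?u ^ n *\<^sub>C c n))" by simp
    have 2: "norm (?u ^ (m + Suc n) *\<^sub>C c (m + Suc n)) \<le> (K * t ^ Suc n) * t ^ m" for m
    proof -
      have "norm (?u ^ (m + Suc n) *\<^sub>C c (m + Suc n)) = t ^ (m + Suc n) * (\<rho> ^ (m + Suc n) * norm (c (m + Suc n)))"
        using t \<rho> by (simp add: norm_scaleC norm_power norm_mult power_mult_distrib del: power_Suc power_Suc2)
      also have "\<dots> \<le> t ^ (m + Suc n) * K" using t by (intro mult_left_mono K') auto
      finally show ?thesis by (simp add: power_add mult_ac)
    qed
    have g: "(\<lambda>m. (K * t ^ Suc n) * t ^ m) sums ((K * t ^ Suc n) * (1 / (1 - t)))"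
      using t by (intro sums_mult geometric_sums) auto
    have "norm (- (?u ^ n *\<^sub>C c n)) \<le> (K * t ^ Suc n) * (1 / (1 - t))"
      using norm_suminf_le[OF 2 sums_summable[OF g]] sums_unique[OF g] sums_unique[OF 1] by simp
    also have "\<dots> \<le> (K * t ^ Suc n) * 2"
      using t K by (intro mult_left_mono) (auto simp: field_simps)
    finally have "t ^ n * (\<rho> ^ n * norm (c n)) \<le> t ^ n * (2 * K * t)"
      using t \<rho> by (simp add: norm_scaleC norm_power norm_mult power_mult_distrib mult_ac)
    then show ?thesis using t by simp
  qed
  have "\<rho> ^ n * norm (c n) \<le> 0"
  proof (rule field_le_epsilon)
    fix e :: real assume e: "e > 0"
    define t where "t = min (1/2) (e / (2 * K))"
    have "t > 0" "t \<le> 1/2" "t \<le> e / (2 * K)" using e K by (auto simp: t_def)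
    moreover from this have "2 * K * t \<le> e" using K(1) by (simp add: field_simps)
    ultimately show "\<rho> ^ n * norm (c n) \<le> 0 + e" using main[of t] by simp
  qed
  then show ?case using zero_less_power[OF \<rho>(1), of n] by (auto simp: mult_le_0_iff)
qed

lemma bop_sums:
  assumes T: "T \<in> bop M" and sM: "cvec.subspace M" and f: "\<And>n. f n \<in> M" and s: "f sums l" and l: "l \<in> M"
  shows "(\<lambda>n. T (f n)) sums T l"
proof -
  obtain K where K: "K > 0" "\<And>x. x \<in> M \<Longrightarrow> norm (T x) \<le> K * norm x" using bop_bound[OF T] by blast
  have m: "(\<Sum>i<n. f i) \<in> M" for n using f by (intro cvec.subspace_sum sM) auto
  have "(\<lambda>n. (\<Sum>i<n. f i) - l) \<longlonglongrightarrow> 0" using s unfolding sums_def by (simp add: LIM_zero)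
  then have "(\<lambda>n. K * norm ((\<Sum>i<n. f i) - l)) \<longlonglongrightarrow> 0"
    by (intro tendsto_mult_right_zero tendsto_norm_zero)
  moreover have "\<forall>\<^sub>F n in sequentially. norm (T (\<Sum>i<n. f i) - T l) \<le> K * norm ((\<Sum>i<n. f i) - l)"
    using K(2)[OF csubspaceD(3)[OF sM m l]] bop_diff[OF T sM m l] by simp
  ultimately have "(\<lambda>n. T (\<Sum>i<n. f i) - T l) \<longlonglongrightarrow> 0" by (rule Lim_null_comparison[rotated])
  then have "(\<lambda>n. T (\<Sum>i<n. f i)) \<longlonglongrightarrow> T l" by (rule LIM_zero_cancel)
  then show ?thesis unfolding sums_def using bop_sum[OF T sM, of _ f] f by simp
qed

lemma scaleC_sums: "f sums l \<Longrightarrow> (\<lambda>n. c *\<^sub>C f n) sums (c *\<^sub>C (l :: 'a :: complex_banach))"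
proof -
  have "(\<lambda>x::'a. c *\<^sub>C x) \<in> bop UNIV" by (intro bop_intros)
  then show "f sums l \<Longrightarrow> (\<lambda>n. c *\<^sub>C f n) sums (c *\<^sub>C l)" using bop_sums[of "\<lambda>x. c *\<^sub>C x" UNIV f l] by simp
qed

text \<open>
  Comparing coefficients in \<open>(U - u) R(u) = I\<close>, where \<open>R(u)\<close> is the sum of \<open>u^(n-p) B n\<close>, gives
  \<open>U B 0 = 0\<close> and \<open>U B n = B (n-1)\<close> except that \<open>U B p = B (p-1) + I\<close>. Hence
  \<open>U^p B (p-1) = 0\<close> and \<open>U^(p+1) B p = U^p\<close>, so the constant coefficient \<open>B p\<close> is a weak Drazin inverse.
\<close>

lemma pole_imp_Drazin:
  assumes sM: "cvec.subspace M" and A: "A \<in> bop M" and P: "pole_of_resolvent M A w"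
  shows "Drazin_on M (op_shift A w)"
proof -
  define U where "U = op_shift A w"
  have U: "U \<in> bop M" unfolding U_def by (intro sM A bop_shift)
  obtain r p B where r: "r > 0" and p: "p \<ge> 1" and B: "\<And>n. B n \<in> bop M"
    and reg: "\<And>z. z \<in> ball w r - {w} \<Longrightarrow> z \<notin> op_spectrum M A"
    and lim: "\<And>z. z \<in> ball w r - {w} \<Longrightarrow> uniform_limit {x \<in> M. norm x \<le> 1}
             (\<lambda>k x. \<Sum>n<k. ((z - w) powi (int n - int p)) *\<^sub>C B n x) (resolvent M A z) sequentially"
    using P unfolding pole_of_resolvent_def by blast
  note mem = bopD(1)[OF U] bopD(1)[OF B] csubspaceD[OF sM]
  have ex: "\<exists>G\<in>bop M. (\<forall>x\<in>M. op_shift U u (G x) = x \<and> G (op_shift U u x) = x \<and>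
      (\<lambda>n. u ^ n *\<^sub>C B n x) sums (u ^ p *\<^sub>C G x))" if u: "u \<noteq> 0" "cmod u < r" for u
  proof -
    define z where "z = w + u"
    have z: "z \<in> ball w r - {w}" using u by (auto simp: z_def dist_norm)
    have sh: "op_shift U u = op_shift A z" by (simp add: U_def op_shift_op_shift z_def)
    have "invertible_op M (op_shift A z)" using reg[OF z] by (simp add: op_spectrum_def)
    then obtain G where G: "G \<in> bop M" "\<And>x. x \<in> M \<Longrightarrow> G (op_shift A z x) = x" "\<And>x. x \<in> M \<Longrightarrow> op_shift A z (G x) = x"
      unfolding invertible_op_def by metis
    have s1: "(\<lambda>n. u powi (int n - int p) *\<^sub>C B n x) sums G x" if x: "x \<in> M" "norm x \<le> 1" for x
    proof -
      have "(\<lambda>k. \<Sum>n<k. ((z - w) powi (int n - int p)) *\<^sub>C B n x) \<longlonglongrightarrow> resolvent M A z x"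
        by (rule tendsto_uniform_limitI[OF lim[OF z]]) (use x in simp)
      then show ?thesis using resolvent_eq_inverse[OF G(1,3,2) x(1)] by (simp add: sums_def z_def)
    qed
    have s2: "(\<lambda>n. u powi (int n - int p) *\<^sub>C B n x) sums G x" if x: "x \<in> M" for x
    proof -
      \<comment> \<open>convergence is given on the unit ball only; linearity extends it to all of \<open>M\<close>\<close>
      define t where "t = complex_of_real (norm x + 1)"
      have tr: "cmod t = norm x + 1" unfolding t_def norm_of_real by simp
      have t: "t \<noteq> 0" using tr norm_ge_zero[of x] by (metis add_nonneg_eq_0_iff norm_zero zero_le_one zero_neq_one)
      have y: "(1/t) *\<^sub>C x \<in> M" by (rule csubspaceD(5)[OF sM x])
      have "norm ((1/t) *\<^sub>C x) \<le> 1" by (simp add: norm_scaleC norm_divide tr divide_le_eq_1 add_nonneg_pos)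
      from scaleC_sums[OF s1[OF y this], of t]
      have "(\<lambda>n. t *\<^sub>C (u powi (int n - int p) *\<^sub>C B n ((1/t) *\<^sub>C x))) sums (t *\<^sub>C G ((1/t) *\<^sub>C x))" .
      then show ?thesis using t by (simp add: bopD(3)[OF B x] bopD(3)[OF G(1) x] scaleC_scaleC mult.commute)
    qed
    have "(\<lambda>n. u ^ n *\<^sub>C B n x) sums (u ^ p *\<^sub>C G x)" if x: "x \<in> M" for x
    proof -
      have "u ^ p * u powi (int n - int p) = u ^ n" for n
        using u by (simp add: power_int_diff)
      then show ?thesis using scaleC_sums[OF s2[OF x], of "u ^ p"] by (simp add: scaleC_scaleC)
    qed
    then show ?thesis using G unfolding sh by blast
  qed
  have com: "B n (U x) = U (B n x)" if x: "x \<in> M" for n x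
  proof -
    have "B n (U x) - U (B n x) = 0"
    proof (rule cvec_power_series_zero[OF r, of "\<lambda>n. B n (U x) - U (B n x)"])
      fix u assume u: "u \<noteq> 0" "cmod u < r"
      obtain G where G: "G \<in> bop M" "\<And>x. x \<in> M \<Longrightarrow> op_shift U u (G x) = x" "\<And>x. x \<in> M \<Longrightarrow> G (op_shift U u x) = x"
        and s: "\<And>x. x \<in> M \<Longrightarrow> (\<lambda>n. u ^ n *\<^sub>C B n x) sums (u ^ p *\<^sub>C G x)"
        using ex[OF u] by blast
      note memG = mem bopD(1)[OF G(1)]
      have "U (G x) = x + u *\<^sub>C G x" using G(2)[OF x] by (simp add: op_shift_def algebra_simps)
      moreover have "G (U x) = x + u *\<^sub>C G x"
        using G(3)[OF x] x memG by (simp add: op_shift_def bop_diff[OF G(1) sM] bopD(3)[OF G(1)] algebra_simps)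
      ultimately have GU: "G (U x) = U (G x)" by simp
      have "(\<lambda>n. U (u ^ n *\<^sub>C B n x)) sums U (u ^ p *\<^sub>C G x)"
        using x memG by (intro bop_sums[OF U sM _ s[OF x]]) auto
      then have "(\<lambda>n. u ^ n *\<^sub>C U (B n x)) sums (u ^ p *\<^sub>C U (G x))"
        using x memG by (simp add: bopD(3)[OF U])
      from sums_diff[OF s[OF bopD(1)[OF U x]] this]
      show "(\<lambda>n. u ^ n *\<^sub>C (B n (U x) - U (B n x))) sums 0" by (simp add: GU cvec.scale_right_diff_distrib)
    qed
    then show ?thesis by simp
  qed
  have rec: "U (B n x) = (if n = 0 then 0 else B (n - 1) x) + (if n = p then x else 0)" if x: "x \<in> M" for n x
  proof -
    define c where "c n = U (B n x) - (if n = 0 then 0 else B (n - 1) x) - (if n = p then x else 0)" for n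
    have "c n = 0"
    proof (rule cvec_power_series_zero[OF r])
      fix u assume u: "u \<noteq> 0" "cmod u < r"
      obtain G where G: "G \<in> bop M" "\<And>x. x \<in> M \<Longrightarrow> op_shift U u (G x) = x"
        and s: "\<And>x. x \<in> M \<Longrightarrow> (\<lambda>n. u ^ n *\<^sub>C B n x) sums (u ^ p *\<^sub>C G x)"
        using ex[OF u] by blast
      note memG = mem bopD(1)[OF G(1)]
      have UG: "U (G x) = x + u *\<^sub>C G x" using G(2)[OF x] by (simp add: op_shift_def algebra_simps)
      have "(\<lambda>n. U (u ^ n *\<^sub>C B n x)) sums U (u ^ p *\<^sub>C G x)"
        using x memG by (intro bop_sums[OF U sM _ s[OF x]]) auto
      then have 1: "(\<lambda>n. u ^ n *\<^sub>C U (B n x)) sums (u ^ p *\<^sub>C U (G x))"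
        using x memG by (simp add: bopD(3)[OF U])
      have "(\<lambda>n. u ^ Suc n *\<^sub>C B n x) sums (u ^ Suc p *\<^sub>C G x)"
        using scaleC_sums[OF s[OF x], of u] by (simp add: scaleC_scaleC)
      then have 2: "(\<lambda>n. u ^ n *\<^sub>C (if n = 0 then 0 else B (n - 1) x)) sums (u ^ Suc p *\<^sub>C G x)"
        using sums_Suc[of "\<lambda>n. u ^ n *\<^sub>C (if n = 0 then 0 else B (n - 1) x)" "u ^ Suc p *\<^sub>C G x"] by simp
      have 3: "(\<lambda>n. u ^ n *\<^sub>C (if n = p then x else 0)) sums (u ^ p *\<^sub>C x)"
        using sums_single[of p "\<lambda>n. u ^ n *\<^sub>C x"] by (simp add: if_distrib cong: if_cong)
      have "u ^ p *\<^sub>C U (G x) - u ^ Suc p *\<^sub>C G x - u ^ p *\<^sub>C x = 0"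
        by (simp add: UG scaleC_add_right scaleC_scaleC mult.commute)
      then show "(\<lambda>n. u ^ n *\<^sub>C c n) sums 0"
        using sums_diff[OF sums_diff[OF 1 2] 3] by (simp add: c_def cvec.scale_right_diff_distrib)
    qed
    then show ?thesis by (simp add: c_def algebra_simps)
  qed
  have z: "j < p \<Longrightarrow> (U ^^ Suc j) (B j x) = 0" if x: "x \<in> M" for j x
  proof (induction j)
    case 0 then show ?case using rec[OF x, of 0] by simp
  next
    case (Suc j)
    have "(U ^^ Suc (Suc j)) (B (Suc j) x) = (U ^^ Suc j) (U (B (Suc j) x))" by (simp add: funpow_swap1)
    then show ?case using Suc rec[OF x, of "Suc j"] by simp
  qed
  have "(U ^^ Suc p) (B p x) = (U ^^ p) x" if x: "x \<in> M" for x
  proof -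
    have "(U ^^ Suc p) (B p x) = (U ^^ p) (U (B p x))" by (simp add: funpow_swap1)
    also have "U (B p x) = B (p - 1) x + x" using rec[OF x, of p] p by simp
    also have "(U ^^ p) \<dots> = (U ^^ p) (B (p - 1) x) + (U ^^ p) x"
      using x mem by (intro bopD(2)[OF bop_funpow[OF U]]) auto
    also have "(U ^^ p) (B (p - 1) x) = 0" using z[OF x, of "p - 1"] p by simp
    finally show ?thesis by simp
  qed
  then show ?thesis unfolding Drazin_on_def U_def[symmetric] using com B by blast
qed

lemma invertible_imp_Drazin: "invertible_op M U \<Longrightarrow> Drazin_on M U"
  unfolding invertible_op_def Drazin_on_def by (metis funpow_0 funpow_Suc_right comp_apply)

lemma meromorphic_iff_Drazin:
  assumes M: "closed_csubspace M" and A: "A \<in> bop M"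
  shows "meromorphic_op M A \<longleftrightarrow> (\<forall>z. z \<noteq> 0 \<longrightarrow> Drazin_on M (op_shift A z))"
proof -
  have sM: "cvec.subspace M" using M by (simp add: closed_csubspace_def)
  have "pole_of_resolvent M A z \<longleftrightarrow> Drazin_on M (op_shift A z)" if "z \<in> op_spectrum M A" for z
    using Drazin_imp_pole[OF M A _ that] pole_imp_Drazin[OF sM A] by blast
  moreover have "Drazin_on M (op_shift A z)" if "z \<notin> op_spectrum M A" for z
    using that invertible_imp_Drazin unfolding op_spectrum_def by blast
  ultimately show ?thesis unfolding meromorphic_op_def by blast
qed

section \<open>Left Drazin invertible operators\<close>

text \<open>
  \<open>P = B U\<close> is a bounded projector commuting with \<open>U\<close>. On its range \<open>U\<close> has the left
  inverse \<open>B\<close> (compressed to that range), on its kernel \<open>U^n = 0\<close>.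
\<close>

definition left_Drazin_split :: "('a::complex_banach \<Rightarrow> 'a) \<Rightarrow> bool" where
  "left_Drazin_split U \<longleftrightarrow> (\<exists>B\<in>bop UNIV. \<exists>n. \<forall>x.
     B (U (B (U x))) = B (U x) \<and> U (B (U x)) = B (U (U x)) \<and> (U ^^ n) (x - B (U x)) = 0)"

lemma ascent_finite_iff: "ascent M A < \<infinity> \<longleftrightarrow> (\<exists>n. nullspace M A \<inter> (A ^^ n) ` M = {0})"
proof
  assume "ascent M A < \<infinity>"
  then have "{enat n | n. nullspace M A \<inter> (A ^^ n) ` M = {0}} \<noteq> {}"
    unfolding ascent_def by (metis (lifting) Inf_enat_def less_irrefl)
  then show "\<exists>n. nullspace M A \<inter> (A ^^ n) ` M = {0}" by blast
next
  assume "\<exists>n. nullspace M A \<inter> (A ^^ n) ` M = {0}"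
  then obtain n where "nullspace M A \<inter> (A ^^ n) ` M = {0}" by blast
  then have "ascent M A \<le> enat n" unfolding ascent_def by (intro Inf_lower) blast
  then show "ascent M A < \<infinity>" using le_less_trans by fastforce
qed

lemma enat_Inf_mem: "A \<noteq> {} \<Longrightarrow> Inf A \<in> (A :: enat set)"
  unfolding Inf_enat_def by (auto intro: LeastI)

lemma ascent_attained:
  assumes "ascent M A < \<infinity>"
  shows "nullspace M A \<inter> (A ^^ the_enat (ascent M A)) ` M = {0}"
proof -
  have "{enat n | n. nullspace M A \<inter> (A ^^ n) ` M = {0}} \<noteq> {}"
    using assms ascent_finite_iff[of M A] by auto
  then have "Inf {enat n | n. nullspace M A \<inter> (A ^^ n) ` M = {0}} \<in> {enat n | n. nullspace M A \<inter> (A ^^ n) ` M = {0}}"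
    by (rule enat_Inf_mem)
  then have "ascent M A \<in> {enat n | n. nullspace M A \<inter> (A ^^ n) ` M = {0}}"
    by (simp only: ascent_def)
  then obtain n where "ascent M A = enat n" "nullspace M A \<inter> (A ^^ n) ` M = {0}" by blast
  then show ?thesis by simp
qed

text \<open>
  The ascent of the definition is the usual one: the kernels of the powers stabilise.
\<close>

lemma ascent_condition:
  assumes U: "U \<in> bop UNIV"
  shows "nullspace UNIV U \<inter> range (U ^^ n) = {0} \<longleftrightarrow> (\<forall>x. (U ^^ Suc n) x = 0 \<longrightarrow> (U ^^ n) x = 0)"
  using bop_UNIV_simps(3)[OF U] bop_UNIV_simps(3)[OF bop_funpow[OF U], of n]
  by (auto simp: nullspace_def image_iff)

lemma kernels_stabilize:
  fixes U :: "'a::zero \<Rightarrow> 'a"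
  assumes st: "\<And>x. (U ^^ Suc n) x = 0 \<Longrightarrow> (U ^^ n) x = 0" and x: "(U ^^ (n + k)) x = 0"
  shows "(U ^^ n) x = 0"
  using x
proof (induction k arbitrary: x)
  case (Suc k)
  have "(U ^^ Suc n) ((U ^^ k) x) = 0" using Suc.prems by (metis add_Suc_right add_Suc comp_apply funpow_add)
  then have "(U ^^ (n + k)) x = 0" using st by (metis comp_apply funpow_add)
  then show ?case by (rule Suc.IH)
qed simp

lemma kernels_eq:
  assumes U: "U \<in> bop UNIV"
    and a: "\<And>x. (U ^^ Suc a) x = 0 \<Longrightarrow> (U ^^ a) x = 0" and n: "\<And>x. (U ^^ Suc n) x = 0 \<Longrightarrow> (U ^^ n) x = 0"
  shows "(U ^^ a) x = 0 \<longleftrightarrow> (U ^^ n) x = 0"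
proof -
  have z: "(U ^^ (k + l)) x = 0" if "(U ^^ l) x = 0" for k l
    using that bop_UNIV_simps(3)[OF bop_funpow[OF U], of k] by (simp add: funpow_add)
  show ?thesis
    using kernels_stabilize[where U=U and n=n and k=a and x=x] kernels_stabilize[where U=U and n=a and k=n and x=x] z[of n a] z[of a n] a n
    by (metis add.commute)
qed

text \<open>
  Let \<open>J = U^n\<close> with \<open>n \<ge> 1\<close> and \<open>X = (range U + ker J) \<oplus> W\<close>. Write
  \<open>x = U (y x) + m x + \<Omega> x\<close> with \<open>m x\<close> in \<open>ker J\<close> and \<open>\<Omega> x\<close> in \<open>W\<close>, choosing the three parts
  of norm at most \<open>K * norm x\<close>. The choice \<open>y\<close> is nonlinear, but it is linear modulo \<open>ker J\<close>, so any
  operator vanishing on \<open>ker J\<close> becomes linear and bounded after composition with \<open>y\<close>. Iterating the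
  decomposition \<open>n\<close> times gives \<open>P x = (\<Sum>k<n. U^k (\<Omega> (y^k x))) + J (y^n x)\<close>, which differs
  from \<open>x\<close> by an element of \<open>ker J\<close> and vanishes on \<open>ker J\<close>. Thus \<open>P\<close> is a projector with kernel
  \<open>ker J\<close>; it commutes with \<open>U\<close> because \<open>y (U x)\<close> and \<open>x\<close> agree modulo \<open>ker J\<close>.
  For the same reason \<open>B = P \<circ> y\<close> satisfies \<open>B U = P\<close>.
\<close>

lemma left_Drazin_imp_split_aux:
  fixes U :: "'a::complex_banach \<Rightarrow> 'a"
  assumes U: "U \<in> bop UNIV" and W: "closed_csubspace W"
    and st: "\<And>x. (U ^^ Suc (Suc q)) x = 0 \<Longrightarrow> (U ^^ Suc q) x = 0"
    and int: "\<And>a v. (U ^^ Suc q) v = 0 \<Longrightarrow> U a + v \<in> W \<Longrightarrow> U a + v = 0"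
    and sum: "\<And>x. \<exists>a v w. x = U a + v + w \<and> (U ^^ Suc q) v = 0 \<and> w \<in> W"
  shows "left_Drazin_split U"
proof -
  define n where "n = Suc q"
  define J where "J = U ^^ n"
  have J: "J \<in> bop UNIV" unfolding J_def by (rule bop_funpow[OF U])
  have pow: "U ^^ k \<in> bop UNIV" for k by (rule bop_funpow[OF U])
  note lin = bop_UNIV_simps[OF U] bop_UNIV_simps[OF J] 
  have st': "J (U x) = 0 \<Longrightarrow> J x = 0" for x using st[of x] by (simp add: J_def n_def funpow_swap1)
  have JU: "J (U x) = U (J x)" for x by (simp add: J_def funpow_swap1)
  have sW: "cvec.subspace W" "closed W" using W by (auto simp: closed_csubspace_def)
  let ?D = "(UNIV :: 'a set) \<times> ({v. J v = 0} \<times> W)"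
  let ?T = "\<lambda>(a, v, w). U a + v + w"
  have "bounded_linear ?T"
  proof -
    have "?T = (\<lambda>t. U (fst t) + fst (snd t) + snd (snd t))" by auto
    moreover have "bounded_linear (\<lambda>t::'a\<times>'a\<times>'a. U (fst t))"
      by (rule bounded_linear_compose[OF bop_bounded_linear[OF U] bounded_linear_fst])
    moreover have "bounded_linear (\<lambda>t::'a\<times>'a\<times>'a. fst (snd t))"
      by (rule bounded_linear_compose[OF bounded_linear_fst bounded_linear_snd])
    moreover have "bounded_linear (\<lambda>t::'a\<times>'a\<times>'a. snd (snd t))"
      by (rule bounded_linear_compose[OF bounded_linear_snd bounded_linear_snd])
    ultimately show ?thesis by (simp add: bounded_linear_add)
  qed
  moreover have "subspace ?D"
    using closed_csubspace_kernel[OF J] sW(1)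
    by (intro subspace_Times csubspace_subspace) (auto simp: closed_csubspace_def)
  moreover have "closed ?D"
    using closed_csubspace_kernel[OF J] sW(2) by (intro closed_Times) (auto simp: closed_csubspace_def)
  moreover have "?T ` ?D = UNIV"
  proof -
    have "x \<in> ?T ` ?D" for x
    proof -
      obtain a v w where "x = U a + v + w" "J v = 0" "w \<in> W" using sum[of x] by (auto simp: J_def n_def)
      then show ?thesis by (intro image_eqI[of _ _ "(a, v, w)"]) auto
    qed
    then show ?thesis by blast
  qed
  ultimately obtain K where "\<And>x. \<exists>t\<in>?D. ?T t = x \<and> norm t \<le> K * norm x"
    by (rule bounded_preimage) blast
  then obtain t where t: "\<And>x. t x \<in> ?D" "\<And>x. ?T (t x) = x" "\<And>x. norm (t x) \<le> K * norm x"
    by metis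
  define y where "y x = fst (t x)" for x
  define m where "m x = fst (snd (t x))" for x
  define \<Omega> where "\<Omega> x = snd (snd (t x))" for x
  have dec: "x = U (y x) + m x + \<Omega> x" for x
    using t(2)[of x] by (simp add: y_def m_def \<Omega>_def split_beta)
  have m: "J (m x) = 0" and \<Omega>W: "\<Omega> x \<in> W" for x
    using t(1)[of x] by (auto simp: m_def \<Omega>_def mem_Times_iff)
  have yb: "norm (y x) \<le> K * norm x" for x
    using t(3)[of x] norm_fst_le[of "fst (t x)" "snd (t x)"] by (simp add: y_def)
  have \<Omega>b: "norm (\<Omega> x) \<le> K * norm x" for x
    using t(3)[of x] norm_snd_le[of "snd (t x)" "fst (t x)"]
      norm_snd_le[of "snd (snd (t x))" "fst (snd (t x))"] by (simp add: \<Omega>_def)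
  \<comment> \<open>the decomposition is unique up to the kernel of \<open>J\<close>\<close>
  have uniq: "\<Omega> x = w \<and> J (y x) = J a" if "x = U a + v + w" "J v = 0" "w \<in> W" for x a v w
  proof -
    have "U (y x - a) + (m x - v) = w - \<Omega> x"
      using dec[of x] that(1) by (simp add: lin algebra_simps)
    moreover have "w - \<Omega> x \<in> W" using that(3) \<Omega>W csubspaceD(3)[OF sW(1)] by blast
    moreover have "J (m x - v) = 0" using m that by (simp add: lin)
    ultimately have 0: "U (y x - a) + (m x - v) = 0" "w - \<Omega> x = 0"
      using int[of "m x - v" "y x - a"] by (auto simp: J_def n_def)
    then have "J (U (y x - a)) = J (v - m x)" by (simp add: eq_neg_iff_add_eq_0[symmetric])
    also have "\<dots> = 0" using m that by (simp add: lin)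
    finally have "J (y x - a) = 0" by (rule st')
    then show ?thesis using 0(2) by (simp add: lin)
  qed
  \<comment> \<open>\<open>\<Omega>\<close> and \<open>J \<circ> y\<close> depend only on the class modulo \<open>ker J\<close>\<close>
  have cong: "\<Omega> a = \<Omega> b \<and> J (y a) = J (y b)" if "J a = J b" for a b
  proof (rule uniq)
    show "a = U (y b) + (m b + (a - b)) + \<Omega> b" using dec[of b] by (simp add: algebra_simps)
    show "J (m b + (a - b)) = 0" using m that by (simp add: lin)
  qed (rule \<Omega>W)
  have add: "\<Omega> (a + b) = \<Omega> a + \<Omega> b \<and> J (y (a + b)) = J (y a + y b)" for a b
  proof (rule uniq)
    have "a + b = (U (y a) + m a + \<Omega> a) + (U (y b) + m b + \<Omega> b)" using dec by metis
    then show "a + b = U (y a + y b) + (m a + m b) + (\<Omega> a + \<Omega> b)" by (simp add: lin algebra_simps)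
  qed (use m \<Omega>W csubspaceD[OF sW(1)] in \<open>auto simp: lin\<close>)
  have scale: "\<Omega> (c *\<^sub>C a) = c *\<^sub>C \<Omega> a \<and> J (y (c *\<^sub>C a)) = J (c *\<^sub>C y a)" for c a
  proof (rule uniq)
    have "c *\<^sub>C a = c *\<^sub>C (U (y a) + m a + \<Omega> a)" using dec by metis
    then show "c *\<^sub>C a = U (c *\<^sub>C y a) + c *\<^sub>C m a + c *\<^sub>C \<Omega> a" by (simp add: lin scaleC_add_right)
  qed (use m \<Omega>W csubspaceD[OF sW(1)] in \<open>auto simp: lin\<close>)
  have UU: "\<Omega> (U a) = 0 \<and> J (y (U a)) = J a" for a
    by (rule uniq) (use csubspaceD(1)[OF sW(1)] in \<open>auto simp: lin\<close>)
  have \<Omega>: "\<Omega> \<in> bop UNIV" by (rule bopI[of _ _ K]) (use add scale \<Omega>b in auto)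
  have congk: "J ((y ^^ k) a) = J ((y ^^ k) b)" if "J a = J b" for k a b
  proof (induction k)
    case (Suc k)
    show ?case using cong[OF Suc] by simp
  qed (simp add: that)
  have comp: "(\<lambda>x. T ((y ^^ k) x)) \<in> bop UNIV"
    if T: "T \<in> bop UNIV" and Tc: "\<And>a b. J a = J b \<Longrightarrow> T a = T b" for T k
  proof -
    note T' = bop_UNIV_simps[OF T]
    have yadd: "J ((y ^^ k) (a + b)) = J ((y ^^ k) a + (y ^^ k) b)" for a b
    proof (induction k)
      case (Suc k)
      show ?case using cong[OF Suc] add[of "(y ^^ k) a" "(y ^^ k) b"] by simp
    qed simp
    have yscale: "J ((y ^^ k) (c *\<^sub>C a)) = J (c *\<^sub>C (y ^^ k) a)" for a c
    proof (induction k)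
      case (Suc k)
      show ?case using cong[OF Suc] scale[of c "(y ^^ k) a"] by simp
    qed simp
    have yk: "norm ((y ^^ k) x) \<le> \<bar>K\<bar> ^ k * norm x" for x
    proof (induction k)
      case (Suc k)
      have "norm ((y ^^ Suc k) x) \<le> \<bar>K\<bar> * norm ((y ^^ k) x)"
        using order_trans[OF yb[of "(y ^^ k) x"] mult_right_mono[OF abs_ge_self norm_ge_zero]] by simp
      also have "\<dots> \<le> \<bar>K\<bar> * (\<bar>K\<bar> ^ k * norm x)" using Suc by (intro mult_left_mono) auto
      finally show ?case by (simp add: mult.assoc)
    qed simp
    obtain L where L: "L > 0" "\<And>x. norm (T x) \<le> L * norm x" using bop_bound[OF T] by auto
    have "norm (T ((y ^^ k) x)) \<le> (L * \<bar>K\<bar> ^ k) * norm x" for x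
      using order_trans[OF L(2) mult_left_mono[OF yk less_imp_le[OF L(1)]]] by (simp add: mult.assoc)
    then show ?thesis
    proof (rule bopI[rotated 3])
      show "T ((y ^^ k) (a + b)) = T ((y ^^ k) a) + T ((y ^^ k) b)" for a b
        using Tc[OF yadd] T'(1) by simp
      show "T ((y ^^ k) (c *\<^sub>C a)) = c *\<^sub>C T ((y ^^ k) a)" for a c
        using Tc[OF yscale] T'(2) by simp
    qed simp
  qed
  define P where "P x = (\<Sum>k<n. (U ^^ k) (\<Omega> ((y ^^ k) x))) + J ((y ^^ n) x)" for x
  have P: "P \<in> bop UNIV"
  proof -
    have "(\<lambda>x. (U ^^ k) (\<Omega> ((y ^^ k) x))) \<in> bop UNIV" for k
      by (rule bop_comp[OF pow comp[OF \<Omega>]]) (use cong in blast)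
    then have "(\<lambda>x. \<Sum>k<n. (U ^^ k) (\<Omega> ((y ^^ k) x))) \<in> bop UNIV" by (intro bop_sum_of_ops) auto
    moreover have "(\<lambda>x. J ((y ^^ n) x)) \<in> bop UNIV" by (rule comp[OF J])
    ultimately show ?thesis unfolding P_def by (intro bop_add) auto
  qed
  have Pc: "P a = P b" if "J a = J b" for a b
    unfolding P_def using congk[OF that] cong[OF congk[OF that]] by simp
  have step: "J x = J (U (y x)) + J (\<Omega> x)" for x
  proof -
    have "J x = J (U (y x) + m x + \<Omega> x)" using dec by metis
    then show ?thesis using m by (simp add: lin)
  qed
  \<comment> \<open>the decomposition applied repeatedly to its own first component\<close>
  have "J x = J ((\<Sum>k<j. (U ^^ k) (\<Omega> ((y ^^ k) x))) + (U ^^ j) ((y ^^ j) x))" for x j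
  proof (induction j)
    case (Suc j)
    have JUj: "J ((U ^^ j) z) = (U ^^ j) (J z)" for z
      unfolding J_def by (metis add.commute comp_apply funpow_add)
    have "J ((U ^^ j) ((y ^^ j) x)) = J ((U ^^ Suc j) ((y ^^ Suc j) x)) + J ((U ^^ j) (\<Omega> ((y ^^ j) x)))"
      using step[of "(y ^^ j) x"] bop_UNIV_simps(1)[OF pow, of j] by (simp add: JUj funpow_swap1 JU[symmetric])
    then show ?case using Suc by (simp add: lin)
  qed (simp add: lin)
  from this[of _ n] have JP: "J (P x) = J x" for x unfolding P_def J_def by simp
  have PP: "P (P x) = P x" for x by (rule Pc[OF JP])
  have PU: "P (U x) = U (P x)" for x
  proof -
    have yU: "J ((y ^^ Suc k) (U x)) = J ((y ^^ k) x)" for k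
      using congk[of "y (U x)" x k] UU by (simp add: funpow_swap1)
    have "P (U x) = (\<Sum>k<q. (U ^^ Suc k) (\<Omega> ((y ^^ Suc k) (U x)))) + J ((y ^^ Suc q) (U x))"
      unfolding P_def n_def sum.lessThan_Suc_shift using UU by simp
    also have "\<dots> = (\<Sum>k<q. (U ^^ Suc k) (\<Omega> ((y ^^ k) x))) + J ((y ^^ q) x)"
      using cong[OF yU] yU by simp
    also have "J ((y ^^ q) x) = (U ^^ n) (\<Omega> ((y ^^ q) x)) + U (J ((y ^^ n) x))"
      using step[of "(y ^^ q) x"] JU by (simp add: n_def J_def)
    finally show ?thesis unfolding P_def by (simp add: lin n_def algebra_simps)
  qed
  have B: "(\<lambda>x. P (y x)) \<in> bop UNIV" using comp[OF P Pc, of 1] by simp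
  have BU: "P (y (U x)) = P x" for x using UU by (intro Pc) simp
  show ?thesis unfolding left_Drazin_split_def
  proof (rule bexI[OF _ B], intro exI[of _ n] allI conjI)
    show "(U ^^ n) (x - P (y (U x))) = 0" for x
      using JP[of x] by (simp add: BU flip: J_def) (simp add: lin)
  qed (simp_all add: BU PP PU)
qed

text \<open>
  The stable kernel is unchanged if the exponent is raised by one; this makes the exponent
  positive, as the explicit projector requires.
\<close>

lemma left_Drazin_imp_split:
  assumes U: "U \<in> bop UNIV" and D: "left_Drazin UNIV U"
  shows "left_Drazin_split U"
proof -
  define a where "a = the_enat (ascent UNIV U)"
  have fin: "ascent UNIV U < \<infinity>" using D by (simp add: left_Drazin_def)
  have st: "(U ^^ Suc a) x = 0 \<Longrightarrow> (U ^^ a) x = 0" for x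
    using ascent_attained[OF fin] ascent_condition[OF U, of a] by (simp add: a_def)
  obtain W where W: "closed_csubspace W" and int: "ssum (range U) (nullspace UNIV (U ^^ a)) \<inter> W = {0}"
    and sum: "ssum (ssum (range U) (nullspace UNIV (U ^^ a))) W = UNIV"
    using D unfolding left_Drazin_def complemented_in_def a_def[symmetric] by blast
  have eq: "(U ^^ Suc a) x = 0 \<longleftrightarrow> (U ^^ a) x = 0" for x
    using st bop_UNIV_simps(3)[OF U] by auto
  show ?thesis
  proof (rule left_Drazin_imp_split_aux[OF U W, of a])
    show "(U ^^ Suc (Suc a)) x = 0 \<Longrightarrow> (U ^^ Suc a) x = 0" for x
      using st[of "U x"] by (simp add: funpow_swap1)
    show "U b + v = 0" if "(U ^^ Suc a) v = 0" "U b + v \<in> W" for b v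
    proof -
      have "U b + v \<in> ssum (range U) (nullspace UNIV (U ^^ a))"
        using that(1) unfolding eq ssum_def nullspace_def by blast
      then show ?thesis using that(2) int by blast
    qed
    show "\<exists>b v w. x = U b + v + w \<and> (U ^^ Suc a) v = 0 \<and> w \<in> W" for x
    proof -
      have "x \<in> ssum (ssum (range U) (nullspace UNIV (U ^^ a))) W" using sum by blast
      then show ?thesis unfolding eq unfolding ssum_def nullspace_def by blast
    qed
  qed
qed

text \<open>
  With \<open>B\<close> compressed by \<open>P\<close> one has \<open>B^j U^j = P\<close> for \<open>j \<ge> 1\<close>, so \<open>U^j B^j\<close> is a projector. For
  \<open>j = 1\<close>, adding \<open>I - P\<close> gives a projector onto \<open>range U + ker (U^a)\<close>, where \<open>a\<close> is the ascent; for
  \<open>j = a + 1\<close> its range is the range of \<open>U^j\<close>, which is therefore closed.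
\<close>

lemma split_imp_left_and_upper_Drazin:
  assumes U: "U \<in> bop UNIV" and D: "left_Drazin_split U"
  shows "left_Drazin UNIV U" "upper_Drazin UNIV U"
proof -
  obtain B0 n where B0: "B0 \<in> bop UNIV" and BB: "\<And>x. B0 (U (B0 (U x))) = B0 (U x)"
    and UB: "\<And>x. B0 (U (U x)) = U (B0 (U x))" and nil: "\<And>x. (U ^^ n) (x - B0 (U x)) = 0"
    using D unfolding left_Drazin_split_def by metis
  define P where "P x = B0 (U x)" for x
  define B where "B x = P (B0 (P x))" for x
  have P: "P \<in> bop UNIV" unfolding P_def by (rule bop_comp[OF B0 U])
  have B: "B \<in> bop UNIV" unfolding B_def by (rule bop_comp[OF P bop_comp[OF B0 P]])
  note lin = bop_UNIV_simps[OF U] bop_UNIV_simps[OF P] bop_UNIV_simps[OF B]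
  have PP: "P (P x) = P x" and PU: "P (U x) = U (P x)" for x by (simp_all add: P_def BB UB)
  have BU: "B (U x) = P x" for x
  proof -
    have "B (U x) = P (B0 (U (P x)))" by (simp add: B_def PU)
    then show ?thesis by (simp add: P_def[symmetric] PP)
  qed
  have PB: "P (B x) = B x" and BP: "B (P x) = B x" for x by (simp_all add: B_def PP)
  have PUk: "P ((U ^^ k) x) = (U ^^ k) (P x)" for k x by (induction k) (simp_all add: PU)
  have Bk: "(B ^^ k) ((U ^^ k) (P x)) = P x" for k x
  proof (induction k)
    case (Suc k)
    have "(B ^^ Suc k) ((U ^^ Suc k) (P x)) = (B ^^ k) (B (U ((U ^^ k) (P x))))" by (simp add: funpow_swap1)
    then show ?case using Suc by (simp add: BU PUk PP)
  qed simp
  have ker: "(U ^^ n) x = 0 \<longleftrightarrow> P x = 0" for x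
  proof
    assume "(U ^^ n) x = 0"
    then have "(U ^^ n) (P x) = 0" using PUk[of n x] by (simp add: lin)
    then show "P x = 0" using Bk[of n x] bop_UNIV_simps(3)[OF bop_funpow[OF B]] by simp
  next
    assume "P x = 0"
    then show "(U ^^ n) x = 0" using nil[of x] by (simp add: P_def)
  qed
  have stn: "(U ^^ n) x = 0" if "(U ^^ Suc n) x = 0" for x
  proof -
    have "P (U x) = 0" using that ker[of "U x"] by (simp add: funpow_swap1)
    then have "B (U (P x)) = 0" by (simp add: PU[symmetric] lin)
    then show ?thesis unfolding ker by (simp add: BU PP)
  qed
  have fin: "ascent UNIV U < \<infinity>"
    unfolding ascent_finite_iff using ascent_condition[OF U, of n] stn by blast
  define a where "a = the_enat (ascent UNIV U)"
  have sta: "(U ^^ Suc a) x = 0 \<Longrightarrow> (U ^^ a) x = 0" for x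
    using ascent_attained[OF fin] ascent_condition[OF U, of a] by (simp add: a_def)
  have kera: "(U ^^ a) x = 0 \<longleftrightarrow> P x = 0" for x
    using kernels_eq[OF U sta stn] ker by simp
  define V where "V = ssum (range U) (nullspace UNIV (U ^^ a))"
  define F where "F x = U (B x)" for x
  define E where "E x = F x + (x - P x)" for x
  have F: "F \<in> bop UNIV" unfolding F_def by (rule bop_comp[OF U B])
  have E: "E \<in> bop UNIV" unfolding E_def by (intro F P bop_intros)
  note linF = bop_UNIV_simps[OF F] bop_UNIV_simps[OF E]
  have FF: "F (F x) = F x" and FP: "F (P x) = F x" and PF: "P (F x) = F x" for x
    by (simp_all add: F_def BU PB BP PU)
  have EE: "E (E x) = E x" for x unfolding E_def by (simp add: lin linF FF FP PF PP)
  have VE: "V = {x. E x = x}"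
  proof
    show "V \<subseteq> {x. E x = x}"
    proof
      fix x assume "x \<in> V"
      then obtain v k where x: "x = U v + k" "P k = 0"
        unfolding V_def ssum_def nullspace_def kera by blast
      have "F k = 0" using FP[of k] x(2) linF(3) by simp
      then have "F x = P x" using x by (simp add: linF lin) (simp add: F_def BU PU)
      then show "x \<in> {x. E x = x}" by (simp add: E_def)
    qed
    show "{x. E x = x} \<subseteq> V"
    proof
      fix x assume "x \<in> {x. E x = x}"
      then have "x = U (B x) + (x - P x)" by (simp add: E_def F_def)
      moreover have "P (x - P x) = 0" by (simp add: lin PP)
      ultimately show "x \<in> V" unfolding V_def ssum_def nullspace_def kera by blast
    qed
  qed
  have "complemented_in UNIV V"
    unfolding complemented_in_def
  proof (intro conjI exI[of _ "{x. E x = 0}"])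
    show "closed_csubspace V" unfolding VE by (rule closed_csubspace_range(1)[OF E EE])
    show "closed_csubspace {x. E x = 0}" by (rule closed_csubspace_kernel[OF E])
    show "V \<inter> {x. E x = 0} = {0}" unfolding VE using linF(9) by auto
    show "ssum V {x. E x = 0} = UNIV"
    proof -
      have "x \<in> ssum V {x. E x = 0}" for x
      proof -
        have "x = E x + (x - E x)" "E x \<in> V" "E (x - E x) = 0" by (simp_all add: VE EE linF)
        then show ?thesis unfolding ssum_def by blast
      qed
      then show ?thesis by blast
    qed
  qed auto
  then show "left_Drazin UNIV U" using fin unfolding left_Drazin_def V_def a_def by blast
  define j where "j = a + 1"
  have 1: "(U ^^ j) (P x) = (U ^^ j) x" for x
  proof -
    have "(U ^^ a) (x - P x) = 0" unfolding kera by (simp add: lin PP)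
    then have "(U ^^ a) (P x) = (U ^^ a) x" using bop_UNIV_simps(5)[OF bop_funpow[OF U]] by simp
    then show ?thesis by (simp add: j_def)
  qed
  define H where "H x = (U ^^ j) ((B ^^ j) x)" for x
  have H: "H \<in> bop UNIV" unfolding H_def by (rule bop_comp[OF bop_funpow[OF U] bop_funpow[OF B]])
  have HU: "H ((U ^^ j) x) = (U ^^ j) x" for x
    unfolding H_def using Bk[of j x] 1 by metis
  have "range (U ^^ j) = {x. H x = x}"
  proof
    show "range (U ^^ j) \<subseteq> {x. H x = x}" using HU by auto
    show "{x. H x = x} \<subseteq> range (U ^^ j)" unfolding H_def by (metis (mono_tags) mem_Collect_eq rangeI subsetI)
  qed
  moreover have "H (H x) = H x" for x using HU unfolding H_def by simp
  ultimately have "closed (range (U ^^ j))"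
    using closed_csubspace_range(1)[OF H] by (simp add: closed_csubspace_def)
  then show "upper_Drazin UNIV U" unfolding upper_Drazin_def using fin by (simp add: a_def j_def)
qed

lemma bop_through:
  assumes S: "S \<in> bop N" and R: "R \<in> bop UNIV" and m: "\<And>x. R x \<in> N"
  shows "(\<lambda>x. S (R x)) \<in> bop UNIV"
proof -
  obtain K where K: "K > 0" "\<And>x. x \<in> N \<Longrightarrow> norm (S x) \<le> K * norm x" using bop_bound[OF S] by blast
  obtain L where L: "\<And>x. norm (R x) \<le> L * norm x" using bop_bound[OF R] by auto
  have "norm (S (R x)) \<le> (K * L) * norm x" for x
    using order_trans[OF K(2)[OF m] mult_left_mono[OF L less_imp_le[OF K(1)]]] by (simp add: mult.assoc)
  then show ?thesis
    by (intro bopI[of _ _ "K * L"]) (simp_all add: bop_UNIV_simps[OF R] bopD(2,3)[OF S] m)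
qed

text \<open>
  The Drazin part splits once more into an invertible and a nilpotent piece; the invertible
  piece joins the left invertible part.
\<close>

lemma left_invertible_plus_Drazin:
  assumes U: "U \<in> bop UNIV" and L: "L \<in> bop UNIV" and Q: "Q \<in> bop UNIV"
    and QQ: "\<And>x. Q (Q x) = Q x" and UQ: "\<And>x. U (Q x) = Q (U x)" and LU: "\<And>x. L (U x) = Q x"
    and D: "Drazin_on {x. Q x = 0} U"
  shows "left_Drazin_split U"
proof -
  let ?N = "{x. Q x = 0}"
  note lin = bop_UNIV_simps[OF U] bop_UNIV_simps[OF Q] bop_UNIV_simps[OF L]
  have sN: "cvec.subspace ?N" using closed_csubspace_kernel[OF Q] by (simp add: closed_csubspace_def)
  have UN: "U \<in> bop ?N" by (rule bop_restrict[OF U]) (simp add: UQ[symmetric] lin)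
  obtain S p where S: "S \<in> bop ?N" "\<And>x. x \<in> ?N \<Longrightarrow> S (U x) = U (S x)"
    "\<And>x. x \<in> ?N \<Longrightarrow> S (U (S x)) = S x" "\<And>x. x \<in> ?N \<Longrightarrow> (U ^^ p) (x - S (U x)) = 0"
    using Drazin_inverse[OF sN UN D] by metis
  define k where "k x = x - Q x" for x
  have k: "k \<in> bop UNIV" unfolding k_def by (intro Q bop_intros)
  have kN: "k x \<in> ?N" for x by (simp add: k_def lin QQ)
  have kid: "k x = x" if "x \<in> ?N" for x using that by (simp add: k_def)
  have kU: "k (U x) = U (k x)" for x by (simp add: k_def lin UQ)
  have kQ: "k (Q x) = 0" for x by (simp add: k_def QQ)
  define B where "B x = L x + S (k x)" for x
  have B: "B \<in> bop UNIV" unfolding B_def by (intro bop_add subspace_UNIV L bop_through[OF S(1) k kN])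
  have BU: "B (U x) = Q x + S (U (k x))" for x by (simp add: B_def LU kU)
  have m: "S (U (k x)) \<in> ?N" for x by (rule bopD(1)[OF S(1) bopD(1)[OF UN kN]])
  have m': "U (k x) \<in> ?N" for x by (rule bopD(1)[OF UN kN])
  have kk: "k (Q x + S (U (k x))) = S (U (k x))" for x
    using bop_UNIV_simps(1)[OF k] kQ kid[OF m] by simp
  show ?thesis unfolding left_Drazin_split_def
  proof (rule bexI[OF _ B], intro exI[of _ p] allI conjI)
    fix x
    have "Q (S (U (k x))) = 0" using m by simp
    then show "B (U (B (U x))) = B (U x)"
      unfolding BU kk by (simp add: lin QQ S(3)[OF m'])
    show "U (B (U x)) = B (U (U x))"
      unfolding BU kU by (simp add: lin UQ S(2)[OF m'])
    have "x - B (U x) = k x - S (U (k x))" by (simp add: BU k_def)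
    then show "(U ^^ p) (x - B (U x)) = 0" using S(4)[OF kN] by simp
  qed
qed

section \<open>Separating functionals and the identity theorem\<close>

definition sublinear :: "('a::real_vector \<Rightarrow> real) \<Rightarrow> bool" where
  "sublinear p \<longleftrightarrow> (\<forall>x y. p (x + y) \<le> p x + p y) \<and> (\<forall>c>0. \<forall>x. p (c *\<^sub>R x) \<le> c * p x)"

lemma sublinearD:
  assumes "sublinear p"
  shows "p (x + y) \<le> p x + p y" "c > 0 \<Longrightarrow> p (c *\<^sub>R x) = c * p x" "p 0 = 0" "- p (- x) \<le> p x"
proof -
  show add: "p (x + y) \<le> p x + p y" for x y using assms unfolding sublinear_def by blast
  have le: "p (c *\<^sub>R x) \<le> c * p x" if "c > 0" for c x using assms that unfolding sublinear_def by blast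
  show "p (c *\<^sub>R x) = c * p x" if "c > 0"
    using le[OF that, of x] le[of "1 / c" "c *\<^sub>R x"] that by (simp add: field_simps)
  show p0: "p 0 = 0" using le[of 2 0] le[of "1/2" 0] by simp
  show "- p (- x) \<le> p x" using add[of x "- x"] p0 by simp
qed

text \<open>
  \<open>q\<close> is \<open>p\<close> forced to be as small as possible in the direction \<open>- y\<close>. A minimal sublinear \<open>p\<close>
  coincides with all its deflations, hence \<open>p (- y) = - p y\<close>: minimal sublinear functionals are linear.
\<close>

lemma sublinear_deflate:
  fixes p :: "'a::real_vector \<Rightarrow> real" and y :: 'a
  assumes p: "sublinear p"
  shows "\<exists>q. sublinear q \<and> (\<forall>x. q x \<le> p x) \<and> q (- y) \<le> - p y"
proof -
  define q where "q x = (INF t\<in>{0..}. p (x + t *\<^sub>R y) - t * p y)" for x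
  note P = sublinearD[OF p]
  have py: "p (t *\<^sub>R y) = t * p y" if "t \<ge> 0" for t
    using P(2)[of t y] P(3) that by (cases "t = 0") auto
  have low: "- p (- x) \<le> p (x + t *\<^sub>R y) - t * p y" if "t \<ge> 0" for x t
    using P(1)[of "x + t *\<^sub>R y" "- x"] py[OF that] by simp
  have bdd: "bdd_below ((\<lambda>t. p (x + t *\<^sub>R y) - t * p y) ` {0..})" for x
    using low by (intro bdd_belowI2[of _ "- p (- x)"]) auto
  have qle: "q x \<le> p (x + t *\<^sub>R y) - t * p y" if "t \<ge> 0" for x t
    unfolding q_def using that by (intro cINF_lower bdd) auto
  have qge: "a \<le> q x" if "\<And>t. t \<ge> 0 \<Longrightarrow> a \<le> p (x + t *\<^sub>R y) - t * p y" for a x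
    unfolding q_def using that by (intro cINF_greatest) auto
  have "q x \<le> p x" for x using qle[of 0 x] by simp
  moreover have "q (- y) \<le> - p y" using qle[of 1 "- y"] P(3) by simp
  moreover have "sublinear q" unfolding sublinear_def
  proof (intro conjI allI impI)
    fix x x'
    have "q (x + x') - (p (x' + s *\<^sub>R y) - s * p y) \<le> q x" if s: "s \<ge> 0" for s
    proof (rule qge)
      fix t :: real assume t: "t \<ge> 0"
      have "p (x + x' + (t + s) *\<^sub>R y) \<le> p (x + t *\<^sub>R y) + p (x' + s *\<^sub>R y)"
        using P(1)[of "x + t *\<^sub>R y" "x' + s *\<^sub>R y"] by (simp add: algebra_simps)
      then show "q (x + x') - (p (x' + s *\<^sub>R y) - s * p y) \<le> p (x + t *\<^sub>R y) - t * p y"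
        using qle[of "t + s" "x + x'"] s t by (simp add: algebra_simps)
    qed
    then have "q (x + x') - q x \<le> q x'" by (intro qge) (simp add: algebra_simps)
    then show "q (x + x') \<le> q x + q x'" by simp
  next
    fix c :: real and x assume c: "c > 0"
    have "q (c *\<^sub>R x) / c \<le> q x"
    proof (rule qge)
      fix t :: real assume t: "t \<ge> 0"
      have "q (c *\<^sub>R x) \<le> p (c *\<^sub>R (x + t *\<^sub>R y)) - c * t * p y"
        using qle[of "c * t" "c *\<^sub>R x"] c t by (simp add: algebra_simps)
      also have "\<dots> = c * (p (x + t *\<^sub>R y) - t * p y)" using P(2)[OF c, of "x + t *\<^sub>R y"] by (simp add: right_diff_distrib)
      finally show "q (c *\<^sub>R x) / c \<le> p (x + t *\<^sub>R y) - t * p y"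
        using c by (simp add: divide_le_eq mult.commute)
    qed
    then show "q (c *\<^sub>R x) \<le> c * q x" using c by (simp add: divide_le_eq mult.commute)
  qed
  ultimately show ?thesis by blast
qed

text \<open>
  Zorn's lemma: the pointwise infimum of a chain is finite, since \<open>p x \<ge> - q (- x)\<close> for
  every sublinear \<open>p \<le> q\<close>, and it is again sublinear.
\<close>

lemma minimal_sublinear:
  fixes q :: "'a::real_vector \<Rightarrow> real"
  assumes q: "sublinear q"
  shows "\<exists>p. sublinear p \<and> (\<forall>x. p x \<le> q x) \<and> (\<forall>p'. sublinear p' \<longrightarrow> (\<forall>x. p' x \<le> p x) \<longrightarrow> p' = p)"
proof -
  define S where "S = {p. sublinear p \<and> (\<forall>x. p x \<le> q x)}"
  define G where "G a b \<longleftrightarrow> (\<forall>x. b x \<le> a x)" for a b :: "'a \<Rightarrow> real"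
  have po: "partial_order_on S (relation_of G S)"
    by (rule partial_order_on_relation_ofI) (auto simp: G_def fun_eq_iff intro: order_trans antisym)
  have "\<exists>m\<in>S. \<forall>a\<in>S. G m a \<longrightarrow> a = m"
  proof (rule predicate_Zorn[OF po])
    fix C assume C: "C \<in> Chains (relation_of G S)"
    then have CS: "C \<subseteq> S" and tot: "\<And>a b. a \<in> C \<Longrightarrow> b \<in> C \<Longrightarrow> G a b \<or> G b a"
      by (auto simp: Chains_def relation_of_def)
    show "\<exists>u\<in>S. \<forall>a\<in>C. G a u"
    proof (cases "C = {}")
      case True
      then show ?thesis using q by (auto simp: S_def)
    next
      case False
      define u where "u x = (INF p\<in>C. p x)" for x
      have sub: "sublinear p" "p x \<le> q x" if "p \<in> C" for p x using that CS by (auto simp: S_def)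
      have "- q (- x) \<le> p x" if "p \<in> C" for p x
        using sublinearD(4)[OF sub(1)[OF that], of x] sub(2)[OF that, of "- x"] by simp
      then have bdd: "bdd_below ((\<lambda>p. p x) ` C)" for x by (intro bdd_belowI2[of _ "- q (- x)"])
      have ule: "u x \<le> p x" if "p \<in> C" for p x unfolding u_def using that by (intro cINF_lower bdd)
      have uge: "a \<le> u x" if "\<And>p. p \<in> C \<Longrightarrow> a \<le> p x" for a x
        unfolding u_def using that False by (intro cINF_greatest) auto
      have "sublinear u" unfolding sublinear_def
      proof (intro conjI allI impI)
        fix x y
        have "u (x + y) - p y \<le> u x" if p: "p \<in> C" for p
        proof (rule uge)
          fix p' assume p': "p' \<in> C"
          obtain r where r: "r \<in> C" "r x \<le> p' x" "r y \<le> p y"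
            using tot[OF p p'] p p' unfolding G_def by blast
          then show "u (x + y) - p y \<le> p' x"
            using ule[OF r(1), of "x + y"] sublinearD(1)[OF sub(1)[OF r(1)], of x y] by linarith
        qed
        then have "u (x + y) - u x \<le> u y" by (intro uge) (simp add: algebra_simps)
        then show "u (x + y) \<le> u x + u y" by simp
      next
        fix c :: real and x assume c: "c > 0"
        have "u (c *\<^sub>R x) / c \<le> u x"
        proof (rule uge)
          fix p assume p: "p \<in> C"
          show "u (c *\<^sub>R x) / c \<le> p x"
            using ule[OF p, of "c *\<^sub>R x"] sublinearD(2)[OF sub(1)[OF p] c] c by (simp add: divide_le_eq mult.commute)
        qed
        then show "u (c *\<^sub>R x) \<le> c * u x" using c by (simp add: divide_le_eq mult.commute)
      qed
      moreover have "u x \<le> q x" for x using False ule sub(2) by (meson ex_in_conv order_trans)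
      ultimately show ?thesis using ule by (intro bexI[of _ u]) (auto simp: S_def G_def)
    qed
  qed
  then obtain p where p: "p \<in> S" and min: "\<And>a. a \<in> S \<Longrightarrow> G p a \<Longrightarrow> a = p" by blast
  show ?thesis
  proof (intro exI[of _ p] conjI allI impI)
    show "sublinear p" "p x \<le> q x" for x using p by (auto simp: S_def)
    fix p' assume "sublinear p'" "\<forall>x. p' x \<le> p x"
    then show "p' = p" using p by (intro min) (auto simp: S_def G_def intro: order_trans)
  qed
qed

text \<open>
  Deflating the norm along \<open>v\<close> before minimising forces the value at \<open>- v\<close> to be at most
  \<open>- norm v\<close>.
\<close>

lemma real_functional_nonzero:
  fixes v :: "'a::real_normed_vector"
  assumes "v \<noteq> 0"
  shows "\<exists>\<rho>. bounded_linear \<rho> \<and> (\<rho> v :: real) \<noteq> 0"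
proof -
  have nrm: "sublinear (norm :: 'a \<Rightarrow> real)" by (auto simp: sublinear_def norm_triangle_ineq)
  obtain q where q: "sublinear q" "\<And>x. q x \<le> norm x" "q (- v) \<le> - norm v"
    using sublinear_deflate[OF nrm, of v] by blast
  obtain p where p: "sublinear p" "\<And>x. p x \<le> q x" and min: "\<And>p'. sublinear p' \<Longrightarrow> \<forall>x. p' x \<le> p x \<Longrightarrow> p' = p"
    using minimal_sublinear[OF q(1)] by blast
  note P = sublinearD[OF p(1)]
  have "p (- y) \<le> - p y" for y
  proof -
    obtain p' where p': "sublinear p'" "\<forall>x. p' x \<le> p x" "p' (- y) \<le> - p y"
      using sublinear_deflate[OF p(1), of y] by blast
    then show ?thesis using min[OF p'(1,2)] by simp
  qed
  then have neg: "p (- y) = - p y" for y using P(4)[of y] by (metis minus_le_iff order_antisym)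
  have add: "p (x + y) = p x + p y" for x y
    using P(1)[of x y] P(1)[of "- x" "- y"] neg[of "x + y"] neg[of x] neg[of y] by simp
  have scale: "p (c *\<^sub>R x) = c * p x" for c x
  proof (cases c "0 :: real" rule: linorder_cases)
    case less
    then have "p (- (c *\<^sub>R x)) = - c * p x" using P(2)[of "- c" x] by simp
    then show ?thesis by (simp add: neg)
  qed (auto simp: P)
  have le: "p x \<le> norm x" for x using p(2) q(2) by (rule order_trans)
  have "norm (p x) \<le> norm x * 1" for x using le[of x] le[of "- x"] neg[of x] by simp
  then have "bounded_linear p" by (intro bounded_linear_intro[of p 1] add) (auto simp: scale)
  moreover have "p v \<noteq> 0" using p(2)[of "- v"] q(3) neg[of v] assms norm_ge_zero[of v]
    by (metis add.inverse_neutral le_zero_eq neg_0_le_iff_le norm_eq_zero order_antisym order_trans)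
  ultimately show ?thesis by blast
qed

lemma complex_functional_nonzero:
  fixes v :: "'a::complex_banach"
  assumes "v \<noteq> 0"
  shows "\<exists>\<phi> :: 'a \<Rightarrow> complex. bounded_linear \<phi> \<and> (\<forall>c x. \<phi> (c *\<^sub>C x) = c * \<phi> x) \<and> \<phi> v \<noteq> 0"
proof -
  obtain \<rho> :: "'a \<Rightarrow> real" where \<rho>: "bounded_linear \<rho>" "\<rho> v \<noteq> 0" using real_functional_nonzero[OF assms] by blast
  interpret \<rho>: bounded_linear \<rho> by fact
  define \<phi> where "\<phi> x = Complex (\<rho> x) (- \<rho> (\<i> *\<^sub>C x))" for x
  have bi: "bounded_linear (\<lambda>x::'a. \<i> *\<^sub>C x)" by (intro bop_bounded_linear bop_intros)
  have eq: "\<phi> x = complex_of_real (\<rho> x) - \<i> * complex_of_real (\<rho> (\<i> *\<^sub>C x))" for x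
    by (simp add: \<phi>_def complex_eq_iff)
  have b: "bounded_linear \<phi>"
    unfolding eq[abs_def]
    by (intro bounded_linear_sub bounded_linear_compose[OF bounded_linear_of_real] \<rho>(1)
        bounded_linear_compose[OF bounded_linear_mult_right] bounded_linear_compose[OF \<rho>(1) bi])
  interpret \<phi>: bounded_linear \<phi> by fact
  have "\<phi> (c *\<^sub>C x) = c * \<phi> x" for c x
  proof -
    have i: "\<phi> (\<i> *\<^sub>C x) = \<i> * \<phi> x" for x
      by (simp add: \<phi>_def complex_eq_iff scaleC_scaleC \<rho>.neg)
    have "c *\<^sub>C x = Re c *\<^sub>R x + Im c *\<^sub>R (\<i> *\<^sub>C x)"
      by (simp add: scaleR_scaleC scaleC_scaleC scaleC_add_left[symmetric] complex_eq mult.commute)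
    then have "\<phi> (c *\<^sub>C x) = Re c *\<^sub>R \<phi> x + Im c *\<^sub>R (\<i> * \<phi> x)"
      by (simp add: \<phi>.add \<phi>.scaleR i)
    also have "\<dots> = (complex_of_real (Re c) + \<i> * complex_of_real (Im c)) * \<phi> x"
      by (simp add: scaleR_conv_of_real algebra_simps)
    finally show ?thesis by (simp add: complex_eq[symmetric])
  qed
  moreover have "\<phi> v \<noteq> 0" using \<rho>(2) by (simp add: \<phi>_def complex_eq_iff)
  ultimately show ?thesis using b by blast
qed

text \<open>
  Complex functionals separate points, which reduces the claim to the scalar identity theorem.
\<close>

lemma vec_analytic_identity:
  assumes f: "vec_analytic_on f S" and S: "open S" "connected S"
    and V: "open V" "V \<subseteq> S" "V \<noteq> {}" and 0: "\<And>z. z \<in> V \<Longrightarrow> f z = 0" and z: "z \<in> S"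
  shows "f z = 0"
proof (rule ccontr)
  assume "f z \<noteq> 0"
  then obtain \<phi> :: "'a \<Rightarrow> complex" where \<phi>: "bounded_linear \<phi>" "\<And>c x. \<phi> (c *\<^sub>C x) = c * \<phi> x" "\<phi> (f z) \<noteq> 0"
    using complex_functional_nonzero by blast
  have "(\<lambda>z. \<phi> (f z)) holomorphic_on S"
  proof (rule holomorphic_onI)
    fix w assume "w \<in> S"
    then obtain D where "(f has_derivative (\<lambda>h. h *\<^sub>C D)) (at w)" using f by (auto simp: vec_analytic_on_def)
    then have "((\<lambda>z. \<phi> (f z)) has_derivative (\<lambda>h. \<phi> (h *\<^sub>C D))) (at w)"
      by (rule bounded_linear.has_derivative[OF \<phi>(1)])
    then have "((\<lambda>z. \<phi> (f z)) has_field_derivative \<phi> D) (at w)"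
      unfolding has_field_derivative_def using \<phi>(2) by (simp add: mult.commute[of "\<phi> D", abs_def])
    then show "(\<lambda>z. \<phi> (f z)) field_differentiable at w within S"
      using field_differentiable_at_within field_differentiable_def by blast
  qed
  then have "\<phi> (f z) = 0"
    by (rule analytic_continuation_open[OF V(1) S(1) V(3) S(2) V(2), of _ "\<lambda>_. 0"])
      (use 0 z in \<open>auto simp: linear_0[OF bounded_linear.linear[OF \<phi>(1)]]\<close>)
  then show False using \<phi>(3) by simp
qed

section \<open>Saphar operators\<close>

text \<open>
  With complements \<open>K\<close> of the kernel and \<open>W\<close> of the range, \<open>(k, w, n) \<mapsto> A k + w + n\<close> is a
  bijection of \<open>K \<times> W \<times> N\<close> onto the space; \<open>S\<close> is the first component of its inverse.
\<close>

lemma Saphar_generalized_inverse: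
  assumes A: "A \<in> bop UNIV" and MN: "(M, N) \<in> Red A" and Sa: "Saphar_op M A"
  shows "\<exists>S\<in>bop UNIV. (\<forall>x. S x \<in> M) \<and> (\<forall>x\<in>M. A (S (A x)) = A x)"
proof -
  have M: "cvec.subspace M" and N: "cvec.subspace N" and cN: "closed N"
    and AM: "\<And>x. x \<in> M \<Longrightarrow> A x \<in> M" and MN0: "M \<inter> N = {0}" and MN1: "ssum M N = UNIV"
    using MN unfolding Red_def closed_csubspace_def by auto
  have cN': "complemented_in M (nullspace M A)" and cR: "complemented_in M (A ` M)"
    using Sa by (simp_all add: Saphar_op_def)
  obtain K where K: "closed K" "cvec.subspace K" "K \<subseteq> M" "nullspace M A \<inter> K = {0}" "ssum (nullspace M A) K = M"
    using cN' unfolding complemented_in_def closed_csubspace_def by blast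
  obtain W where W: "closed W" "cvec.subspace W" "W \<subseteq> M" "A ` M \<inter> W = {0}" "ssum (A ` M) W = M"
    using cR unfolding complemented_in_def closed_csubspace_def by blast
  note lin = bop_UNIV_simps[OF A]
  let ?D = "K \<times> (W \<times> N)"
  let ?T = "\<lambda>(a, v, w). A a + v + w"
  have "bounded_linear ?T"
  proof -
    have "?T = (\<lambda>t. A (fst t) + fst (snd t) + snd (snd t))" by auto
    moreover have "bounded_linear (\<lambda>t::'a\<times>'a\<times>'a. A (fst t))"
      by (rule bounded_linear_compose[OF bop_bounded_linear[OF A] bounded_linear_fst])
    moreover have "bounded_linear (\<lambda>t::'a\<times>'a\<times>'a. fst (snd t))"
      by (rule bounded_linear_compose[OF bounded_linear_fst bounded_linear_snd])
    moreover have "bounded_linear (\<lambda>t::'a\<times>'a\<times>'a. snd (snd t))"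
      by (rule bounded_linear_compose[OF bounded_linear_snd bounded_linear_snd])
    ultimately show ?thesis by (simp add: bounded_linear_add)
  qed
  moreover have "subspace ?D"
    by (intro subspace_Times csubspace_subspace K W N)
  moreover have "closed ?D" by (intro closed_Times K W cN)
  moreover have "?T ` ?D = UNIV"
  proof -
    have "x \<in> ?T ` ?D" for x
    proof -
      have "x \<in> ssum M N" using MN1 by simp
      then obtain m n where 1: "x = m + n" "m \<in> M" "n \<in> N" unfolding ssum_def by blast
      then obtain m' w where 2: "m = A m' + w" "m' \<in> M" "w \<in> W" using W(5) unfolding ssum_def by blast
      then obtain e k where 3: "m' = e + k" "A e = 0" "k \<in> K" using K(5) unfolding ssum_def nullspace_def by blast
      show ?thesis using 1 2 3 by (intro image_eqI[of _ _ "(k, w, n)"]) (auto simp: lin)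
    qed
    then show ?thesis by blast
  qed
  ultimately obtain C where "\<And>x. \<exists>t\<in>?D. ?T t = x \<and> norm t \<le> C * norm x"
    by (rule bounded_preimage) blast
  then obtain t where t: "\<And>x. t x \<in> ?D" "\<And>x. ?T (t x) = x" "\<And>x. norm (t x) \<le> C * norm x"
    by metis
  define S where "S x = fst (t x)" for x
  have dec: "\<exists>w\<in>W. \<exists>n\<in>N. x = A (S x) + w + n" for x
    using t(1)[of x] t(2)[of x, symmetric] unfolding S_def by (auto simp: split_beta mem_Times_iff)
  have SK: "S x \<in> K" for x using t(1)[of x] by (simp add: S_def mem_Times_iff)
  have Sb: "norm (S x) \<le> C * norm x" for x
    using t(3)[of x] norm_fst_le[of "fst (t x)" "snd (t x)"] by (simp add: S_def)
  have uniq: "S x = k" if x: "x = A k + w + n" and k: "k \<in> K" "w \<in> W" "n \<in> N" for x k w n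
  proof -
    obtain w' n' where w': "w' \<in> W" "n' \<in> N" "x = A (S x) + w' + n'" using dec by blast
    define d where "d = S x - k"
    have dK: "d \<in> K" unfolding d_def by (intro csubspaceD(3)[OF K(2)] SK k)
    have ww: "w - w' \<in> W" by (intro csubspaceD(3)[OF W(2)] k w')
    have nn: "n - n' \<in> N" by (intro csubspaceD(3)[OF N] k w')
    have e: "A d = (w - w') + (n - n')"
    proof -
      have "A (S x) + w' + n' = A k + w + n" using x w'(3) by simp
      then show ?thesis unfolding d_def lin by (simp add: algebra_simps)
    qed
    have "A d \<in> M" "w - w' \<in> M" using dK ww K(3) W(3) AM by blast+
    then have "A d - (w - w') \<in> M" by (rule csubspaceD(3)[OF M])
    then have "n - n' \<in> M" using e by (simp add: algebra_simps)
    then have "n - n' = 0" using nn MN0 by blast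
    then have "A d \<in> W" using e ww by simp
    then have "A d \<in> A ` M \<inter> W" using dK K(3) by blast
    then have "A d = 0" using W(4) by blast
    then have "d \<in> nullspace M A \<inter> K" using dK K(3) by (auto simp: nullspace_def)
    then show ?thesis using K(4) by (simp add: d_def)
  qed
  have "S \<in> bop UNIV"
  proof (rule bopI[of _ _ C])
    fix x y
    obtain w n where 1: "w \<in> W" "n \<in> N" "x = A (S x) + w + n" using dec by blast
    obtain w' n' where 2: "w' \<in> W" "n' \<in> N" "y = A (S y) + w' + n'" using dec by blast
    have "x + y = A (S x + S y) + (w + w') + (n + n')"
      by (subst 1(3), subst 2(3)) (simp add: lin algebra_simps)
    then show "S (x + y) = S x + S y"
      by (rule uniq) (intro csubspaceD(2)[OF K(2)] csubspaceD(2)[OF W(2)] csubspaceD(2)[OF N] SK 1 2)+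
    fix c
    have "c *\<^sub>C x = A (c *\<^sub>C S x) + c *\<^sub>C w + c *\<^sub>C n"
      by (subst 1(3)) (simp add: lin scaleC_add_right)
    then show "S (c *\<^sub>C x) = c *\<^sub>C S x"
      by (rule uniq) (intro csubspaceD(5)[OF K(2)] csubspaceD(5)[OF W(2)] csubspaceD(5)[OF N] SK 1)+
  qed (auto intro: Sb)
  moreover have "S x \<in> M" for x using SK K(3) by blast
  moreover have "A (S (A x)) = A x" if x: "x \<in> M" for x
  proof -
    obtain e k where 3: "x = e + k" "A e = 0" "k \<in> K" using x K(5) unfolding ssum_def nullspace_def by blast
    then have "A x = A k + 0 + 0" by (simp add: lin)
    then have "S (A x) = k" by (rule uniq) (use 3 csubspaceD(1)[OF W(2)] csubspaceD(1)[OF N] in auto)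
    then show ?thesis using 3 by (simp add: lin)
  qed
  ultimately show ?thesis by blast
qed

text \<open>
  The Kato property puts every \<open>S^k x0\<close> into the range of \<open>A\<close> on \<open>M\<close>, where \<open>A S\<close> is the identity.
  Hence \<open>x0\<close> belongs to the closed \<open>S\<close>-invariant subspace \<open>H\<close> of all \<open>x\<close> in \<open>M\<close> with
  \<open>A S S^n x = S^n x\<close> for every \<open>n\<close>. With
  \<open>R z = (I - z S)^(-1)\<close> on \<open>H\<close> this gives \<open>(A - z) S (R z) x = x\<close> for \<open>x\<close> in \<open>H\<close>, and
  \<open>(A - z) (R z x0) = A x0 = 0\<close>. So \<open>R z x0\<close> is an eigenvector, analytic in \<open>z\<close>, and applying \<open>S (R z)\<close>
  repeatedly produces an infinite chain of preimages of it under \<open>A - z\<close>.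
\<close>

lemma Saphar_noninjective:
  assumes A: "A \<in> bop UNIV" and MN: "(M, N) \<in> Red A" and Sa: "Saphar_op M A"
    and x0: "x0 \<in> M" "A x0 = 0" "x0 \<noteq> 0"
  shows "\<exists>r>0. (\<exists>f. vec_analytic_on f (ball 0 r) \<and> (\<forall>z\<in>ball 0 r. op_shift A z (f z) = 0 \<and> f z \<noteq> 0)) \<and>
    (\<forall>z\<in>ball 0 r. \<exists>g :: nat \<Rightarrow> 'a::complex_banach. g 0 \<noteq> 0 \<and> op_shift A z (g 0) = 0 \<and> (\<forall>k. op_shift A z (g (Suc k)) = g k))"
proof -
  have M: "closed_csubspace M" and AM: "\<And>x. x \<in> M \<Longrightarrow> A x \<in> M"
    using MN unfolding Red_def by auto
  have sM: "cvec.subspace M" using M by (simp add: closed_csubspace_def)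
  obtain S where S: "S \<in> bop UNIV" and SM: "\<And>x. S x \<in> M" and ASA: "\<And>x. x \<in> M \<Longrightarrow> A (S (A x)) = A x"
    using Saphar_generalized_inverse[OF A MN Sa] by blast
  have Kato: "\<And>x n. x \<in> M \<Longrightarrow> A x = 0 \<Longrightarrow> x \<in> (A ^^ n) ` M"
    using Sa unfolding Saphar_op_def Kato_op_def nullspace_def by blast
  note lin = bop_UNIV_simps[OF A] bop_UNIV_simps[OF S]
  have SkM: "(S ^^ k) x \<in> M" if "x \<in> M" for k x using that SM by (cases k) auto
  define H where "H = M \<inter> (\<Inter>n. {x. A (S ((S ^^ n) x)) - (S ^^ n) x = 0})"
  have kb: "(\<lambda>x. A (S ((S ^^ n) x)) - (S ^^ n) x) \<in> bop UNIV" for n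
    by (intro bop_sub subspace_UNIV bop_comp[OF A bop_comp[OF S bop_funpow[OF S]]] bop_funpow[OF S])
  have H: "closed_csubspace H"
    using M closed_csubspace_kernel[OF kb] unfolding closed_csubspace_def H_def
    by (intro conjI closed_Int closed_INT cvec.subspace_inter cvec.subspace_Inter) auto
  have HS: "S x \<in> H" if "x \<in> H" for x
  proof -
    have "A (S ((S ^^ n) (S x))) = (S ^^ n) (S x)" for n
    proof -
      have "A (S ((S ^^ Suc n) x)) - (S ^^ Suc n) x = 0" using that unfolding H_def by blast
      then show ?thesis by (simp add: funpow_swap1)
    qed
    then show ?thesis using SM by (simp add: H_def)
  qed
  have HAS: "A (S x) = x" if "x \<in> H" for x
  proof -
    have "A (S ((S ^^ 0) x)) - (S ^^ 0) x = 0" using that unfolding H_def by blast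
    then show ?thesis by simp
  qed
  \<comment> \<open>\<open>S\<close> lowers the exponent of a range by one: \<open>S A y\<close> and \<open>y\<close> differ by a kernel vector, which lies in all ranges\<close>
  have x0n: "(S ^^ k) x0 \<in> (A ^^ n) ` M" for k n
  proof (induction k arbitrary: n)
    case 0 then show ?case using Kato x0 by simp
  next
    case (Suc k)
    obtain v where v: "v \<in> M" "(S ^^ k) x0 = (A ^^ Suc n) v" using Suc[of "Suc n"] by blast
    define y where "y = (A ^^ n) v"
    have y: "y \<in> M" unfolding y_def using AM v(1) by (rule funpow_mem)
    have "y - S (A y) \<in> M" by (intro csubspaceD(3)[OF sM] y SM)
    then obtain v' where v': "v' \<in> M" "y - S (A y) = (A ^^ n) v'"
      using Kato[of "y - S (A y)" n] ASA[OF y] by (auto simp: lin)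
    have "(S ^^ Suc k) x0 = S (A y)" using v(2) by (simp add: y_def)
    also have "\<dots> = (A ^^ n) v - (A ^^ n) v'" using v'(2) by (simp add: y_def algebra_simps)
    also have "\<dots> = (A ^^ n) (v - v')" by (simp add: bop_UNIV_simps(5)[OF bop_funpow[OF A]])
    finally show ?case using csubspaceD(3)[OF sM v(1) v'(1)] by blast
  qed
  have x0H: "x0 \<in> H"
  proof -
    have "A (S ((S ^^ n) x0)) = (S ^^ n) x0" for n
    proof -
      obtain v where "v \<in> M" "(S ^^ n) x0 = A v" using x0n[of n 1] by auto
      then show ?thesis using ASA by simp
    qed
    then show ?thesis using x0(1) by (simp add: H_def)
  qed
  have SH: "S \<in> bop H" by (rule bop_restrict[OF S HS])
  have sH: "cvec.subspace H" using H by (simp add: closed_csubspace_def)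
  obtain K where K: "K > 0" "\<And>x. norm (S x) \<le> K * norm x" using bop_bound[OF S] by auto
  define r where "r = 1 / (2 * K)"
  have r: "r > 0" using K by (simp add: r_def)
  have zK: "cmod z * K < 1/2" if "z \<in> ball 0 r" for z using that K by (simp add: r_def field_simps)
  have Rex: "\<exists>R. R \<in> bop H \<and> (\<forall>x\<in>H. R x - z *\<^sub>C S (R x) = x \<and> R (x - z *\<^sub>C S x) = x \<and> norm (R x) \<le> 2 * norm x)"
    if z: "z \<in> ball 0 r" for z
  proof -
    have z1: "cmod z * K < 1" using zK[OF z] by simp
    obtain R where R: "R \<in> bop H" "\<And>x. x \<in> H \<Longrightarrow> R (x - z *\<^sub>C S x) = x" "\<And>x. x \<in> H \<Longrightarrow> R x - z *\<^sub>C S (R x) = x"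
      "\<And>x. x \<in> H \<Longrightarrow> norm (R x) \<le> norm x / (1 - cmod z * K)"
      using neumann_inverse[OF H SH K(2) z1 less_imp_le[OF K(1)]] by metis
    have "norm (R x) \<le> 2 * norm x" if "x \<in> H" for x
    proof -
      have "norm x / (1 - cmod z * K) \<le> norm x / (1/2)" using zK[OF z] by (intro divide_left_mono) auto
      then show ?thesis using R(4)[OF that] by simp
    qed
    then show ?thesis using R by blast
  qed
  have "\<forall>z\<in>ball 0 r. \<exists>R. R \<in> bop H \<and> (\<forall>x\<in>H. R x - z *\<^sub>C S (R x) = x \<and>
      R (x - z *\<^sub>C S x) = x \<and> norm (R x) \<le> 2 * norm x)"
    using Rex by (rule ballI)
  from bchoice[OF this] obtain R where
    RR: "\<forall>z\<in>ball 0 r. R z \<in> bop H \<and> (\<forall>x\<in>H. R z x - z *\<^sub>C S (R z x) = x \<and>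
      R z (x - z *\<^sub>C S x) = x \<and> norm (R z x) \<le> 2 * norm x)" by blast
  then have Rb: "\<And>z. z \<in> ball 0 r \<Longrightarrow> R z \<in> bop H" by blast
  have R: "R z x - z *\<^sub>C S (R z x) = x" "R z (x - z *\<^sub>C S x) = x" "norm (R z x) \<le> 2 * norm x"
    if "z \<in> ball 0 r" "x \<in> H" for z x
    using bspec[OF conjunct2[OF bspec[OF RR that(1)]] that(2)] by auto
  have RH: "R z x \<in> H" if "z \<in> ball 0 r" "x \<in> H" for z x using bopD(1)[OF Rb] that by blast
  have eig: "op_shift A z (R z x0) = 0" if z: "z \<in> ball 0 r" for z
  proof -
    have "0 = A (R z x0 - z *\<^sub>C S (R z x0))" using R(1)[OF z x0H] x0 by simp
    also have "\<dots> = A (R z x0) - z *\<^sub>C R z x0" by (simp add: lin HAS[OF RH[OF z x0H]])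
    finally show ?thesis by (simp add: op_shift_def)
  qed
  have nz: "R z x0 \<noteq> 0" if z: "z \<in> ball 0 r" for z using R(1)[OF z x0H] x0 lin by force
  have step: "op_shift A z (S (R z x)) = x" if z: "z \<in> ball 0 r" and x: "x \<in> H" for z x
    using R(1)[OF z x] by (simp add: op_shift_def HAS[OF RH[OF z x]])
  \<comment> \<open>the resolvent identity, applied twice below to bound the error of the derivative quadratically\<close>
  have resolv: "R z' x - R z x = (z' - z) *\<^sub>C R z' (S (R z x))"
    if z: "z \<in> ball 0 r" "z' \<in> ball 0 r" and x: "x \<in> H" for z z' x
  proof -
    let ?y = "R z x"
    have y: "?y \<in> H" by (rule RH[OF z(1) x])
    have m: "?y - z' *\<^sub>C S ?y \<in> H" "(z' - z) *\<^sub>C S ?y \<in> H"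
      by (intro csubspaceD(3,5)[OF sH] y HS)+
    have "x = (?y - z' *\<^sub>C S ?y) + (z' - z) *\<^sub>C S ?y"
      using R(1)[OF z(1) x] by (simp add: cvec.scale_left_diff_distrib)
    then have "R z' x = R z' (?y - z' *\<^sub>C S ?y) + R z' ((z' - z) *\<^sub>C S ?y)"
      using bopD(2)[OF Rb[OF z(2)] m] by simp
    then show ?thesis using R(2)[OF z(2) y] bopD(3)[OF Rb[OF z(2)] HS[OF y]] by simp
  qed
  have "vec_analytic_on (\<lambda>z. R z x0) (ball 0 r)"
    unfolding vec_analytic_on_def
  proof (intro ballI exI)
    fix z :: complex assume z: "z \<in> ball 0 r"
    define D where "D = R z (S (R z x0))"
    have DH: "S (R z x0) \<in> H" "D \<in> H" "S D \<in> H" unfolding D_def by (intro RH HS z x0H)+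
    define e where "e = r - cmod z"
    have e: "e > 0" using z by (simp add: e_def)
    have bl: "bounded_linear (\<lambda>h. h *\<^sub>C D)"
      by (rule bounded_linear_intro[of _ "norm D"]) (auto simp: scaleC_add_left norm_scaleC scaleR_scaleC scaleC_scaleC scaleR_conv_of_real)
    show "((\<lambda>z. R z x0) has_derivative (\<lambda>h. h *\<^sub>C D)) (at z)"
    proof (rule has_derivativeI_sandwich[OF e bl])
      fix z' assume z': "z' \<noteq> z" "dist z' z < e"
      have "cmod z' < r" using z'(2) norm_triangle_ineq[of "z' - z" z] by (simp add: e_def dist_norm)
      then have zb: "z' \<in> ball 0 r" by simp
      have "R z' x0 - R z x0 - (z' - z) *\<^sub>C D = (z' - z) *\<^sub>C (R z' (S (R z x0)) - R z (S (R z x0)))"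
        by (simp add: resolv[OF z zb x0H] D_def cvec.scale_right_diff_distrib)
      also have "\<dots> = (z' - z) *\<^sub>C ((z' - z) *\<^sub>C R z' (S D))"
        by (simp only: resolv[OF z zb DH(1)] D_def)
      finally have "norm (R z' x0 - R z x0 - (z' - z) *\<^sub>C D) = cmod (z' - z) * (cmod (z' - z) * norm (R z' (S D)))"
        by (simp add: norm_scaleC norm_mult)
      also have "\<dots> \<le> cmod (z' - z) * (cmod (z' - z) * (2 * norm (S D)))"
        by (intro mult_left_mono R(3)[OF zb DH(3)]) auto
      finally show "norm (R z' x0 - R z x0 - (z' - z) *\<^sub>C D) / norm (z' - z) \<le> cmod (z' - z) * (2 * norm (S D))"
        using z'(1) by (simp add: divide_le_eq mult_ac)
    next
      have "((\<lambda>z'. cmod (z' - z) * (2 * norm (S D))) \<longlongrightarrow> cmod (z - z) * (2 * norm (S D))) (at z)"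
        by (intro tendsto_intros)
      then show "((\<lambda>z'. cmod (z' - z) * (2 * norm (S D))) \<longlongrightarrow> 0) (at z)" by simp
    qed
  qed
  moreover have "\<exists>g :: nat \<Rightarrow> 'a. g 0 \<noteq> 0 \<and> op_shift A z (g 0) = 0 \<and> (\<forall>k. op_shift A z (g (Suc k)) = g k)"
    if z: "z \<in> ball 0 r" for z
  proof -
    define g where "g k = ((\<lambda>x. S (R z x)) ^^ k) (R z x0)" for k
    have gH: "g k \<in> H" for k unfolding g_def by (rule funpow_mem[of H]) (use RH HS z x0H in auto)
    have "op_shift A z (g (Suc k)) = g k" for k using step[OF z gH] by (simp add: g_def)
    then show ?thesis using nz[OF z] eig[OF z] by (intro exI[of _ g]) (simp add: g_def)
  qed
  ultimately show ?thesis using r eig nz by blast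
qed

section \<open>Reducing projectors\<close>

lemma Drazin_on_cong:
  assumes D: "Drazin_on M U" and m: "\<And>x. x \<in> M \<Longrightarrow> U x \<in> M" and eq: "\<And>x. x \<in> M \<Longrightarrow> U' x = U x"
  shows "Drazin_on M U'"
proof -
  obtain S p where S: "S \<in> bop M" "\<And>x. x \<in> M \<Longrightarrow> S (U x) = U (S x)"
    "\<And>x. x \<in> M \<Longrightarrow> (U ^^ Suc p) (S x) = (U ^^ p) x"
    using D unfolding Drazin_on_def by blast
  have mem: "S x \<in> M" if "x \<in> M" for x using bopD(1)[OF S(1) that] .
  have pw: "(U' ^^ k) x = (U ^^ k) x" if "x \<in> M" for k x
    by (induction k) (simp_all add: eq funpow_mem[OF m that])
  have "S (U' x) = U' (S x) \<and> (U' ^^ Suc p) (S x) = (U' ^^ p) x" if x: "x \<in> M" for x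
    unfolding pw[OF x] pw[OF mem[OF x]] eq[OF x] eq[OF mem[OF x]] using S(2,3)[OF x] by simp
  then show ?thesis unfolding Drazin_on_def using S(1) by blast
qed

text \<open>
  Compressing the weak Drazin inverse to the kernel of \<open>Q\<close> suffices.
\<close>

lemma Drazin_on_kernel:
  assumes U: "U \<in> bop UNIV" and Q: "Q \<in> bop UNIV"
    and QQ: "\<And>x. Q (Q x) = Q x" and UQ: "\<And>x. U (Q x) = Q (U x)" and D: "Drazin_on UNIV U"
  shows "Drazin_on {x. Q x = 0} U"
proof -
  obtain S p where S: "S \<in> bop UNIV" "\<And>x. S (U x) = U (S x)" "\<And>x. (U ^^ Suc p) (S x) = (U ^^ p) x"
    using D unfolding Drazin_on_def by blast
  define k where "k x = x - Q x" for x
  have k: "k \<in> bop UNIV" unfolding k_def by (intro Q bop_intros)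
  have kU: "k (U x) = U (k x)" for x by (simp add: k_def UQ bop_UNIV_simps[OF U])
  have kUn: "k ((U ^^ n) x) = (U ^^ n) (k x)" for n x by (induction n) (simp_all add: kU)
  have "(\<lambda>x. k (S x)) \<in> bop {x. Q x = 0}"
    by (rule bop_restrict[OF bop_comp[OF k S(1)]]) (simp add: k_def bop_UNIV_simps[OF Q] QQ)
  moreover have "k (S (U x)) = U (k (S x))" for x by (simp add: S(2) kU)
  moreover have "(U ^^ Suc p) (k (S x)) = (U ^^ p) x" if "Q x = 0" for x
  proof -
    have "(U ^^ Suc p) (k (S x)) = (U ^^ p) (k x)" by (simp only: kUn[symmetric] S(3))
    then show ?thesis using that by (simp add: k_def)
  qed
  ultimately show ?thesis unfolding Drazin_on_def
    by (intro bexI[of _ "\<lambda>x. k (S x)"] exI[of _ p]) simp_all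
qed

text \<open>
  The two exponents are added, so that one exponent works for both summands.
\<close>

lemma Drazin_on_glue:
  assumes U: "U \<in> bop UNIV" and Q: "Q \<in> bop UNIV"
    and QQ: "\<And>x. Q (Q x) = Q x" and UQ: "\<And>x. U (Q x) = Q (U x)"
    and D1: "Drazin_on {x. Q x = 0} U" and D2: "Drazin_on {x. Q x = x} U"
  shows "Drazin_on UNIV U"
proof -
  obtain S p where S: "S \<in> bop {x. Q x = 0}" "\<And>x. Q x = 0 \<Longrightarrow> S (U x) = U (S x)"
    "\<And>x. Q x = 0 \<Longrightarrow> (U ^^ Suc p) (S x) = (U ^^ p) x"
    using D1 unfolding Drazin_on_def by blast
  obtain R q where R: "R \<in> bop {x. Q x = x}" "\<And>x. Q x = x \<Longrightarrow> R (U x) = U (R x)"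
    "\<And>x. Q x = x \<Longrightarrow> (U ^^ Suc q) (R x) = (U ^^ q) x"
    using D2 unfolding Drazin_on_def by blast
  define k where "k x = x - Q x" for x
  have k: "k \<in> bop UNIV" unfolding k_def by (intro Q bop_intros)
  have kU: "k (U x) = U (k x)" for x by (simp add: k_def UQ bop_UNIV_simps[OF U])
  have Qk: "Q (k x) = 0" for x by (simp add: k_def bop_UNIV_simps[OF Q] QQ)
  have sp: "k x + Q x = x" for x by (simp add: k_def)
  define G where "G x = S (k x) + R (Q x)" for x
  have G: "G \<in> bop UNIV" unfolding G_def
    by (intro bop_add subspace_UNIV bop_through[OF S(1) k] bop_through[OF R(1) Q]) (simp_all add: Qk QQ)
  have com: "G (U x) = U (G x)" for x
    unfolding G_def kU UQ[symmetric] by (simp add: S(2) R(2) Qk QQ bop_UNIV_simps[OF U])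
  note pw = bop_UNIV_simps(1)[OF bop_funpow[OF U]]
  have "(U ^^ Suc (q + p)) (G x) = (U ^^ (q + p)) x" for x
  proof -
    have "(U ^^ Suc (q + p)) (G x) = (U ^^ q) ((U ^^ Suc p) (S (k x))) + (U ^^ p) ((U ^^ Suc q) (R (Q x)))"
      unfolding G_def pw by (metis add.commute add_Suc_right comp_apply funpow_add)
    also have "\<dots> = (U ^^ (q + p)) (k x) + (U ^^ (q + p)) (Q x)"
      unfolding S(3)[OF Qk] R(3)[OF QQ] by (metis add.commute comp_apply funpow_add)
    finally show ?thesis by (simp only: pw[symmetric] sp)
  qed
  then show ?thesis unfolding Drazin_on_def using G com by blast
qed

lemma op_shift_commute:
  assumes "Q \<in> bop UNIV" "\<And>x. A (Q x) = Q (A x)"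
  shows "op_shift A z (Q x) = Q (op_shift A z x)"
  using assms by (simp add: op_shift_def bop_UNIV_simps)

lemma scalar_invertible:
  assumes "cvec.subspace M" "z \<noteq> 0" "\<And>x. x \<in> M \<Longrightarrow> A x = 0"
  shows "invertible_op M (op_shift A z)"
  unfolding invertible_op_def
proof (rule bexI[of _ "\<lambda>x. (- 1 / z) *\<^sub>C x"])
  show "(\<lambda>x. (- 1 / z) *\<^sub>C x) \<in> bop M" by (intro bop_scale bop_id assms)
  show "\<forall>x\<in>M. (- 1 / z) *\<^sub>C op_shift A z x = x \<and> op_shift A z ((- 1 / z) *\<^sub>C x) = x"
  proof (intro ballI conjI)
    fix x assume x: "x \<in> M"
    show "(- 1 / z) *\<^sub>C op_shift A z x = x"
      using assms(2,3) x by (simp add: op_shift_def scaleC_scaleC)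
    have e: "A ((- 1 / z) *\<^sub>C x) = 0" by (rule assms(3)[OF csubspaceD(5)[OF assms(1) x]])
    show "op_shift A z ((- 1 / z) *\<^sub>C x) = x"
      unfolding op_shift_def e using assms(2) by (simp add: scaleC_scaleC)
  qed
qed

lemma Drazin_nearby_invertible:
  assumes M: "closed_csubspace M" and U: "U \<in> bop M" and D: "Drazin_on M U"
  shows "\<exists>r>0. \<forall>u. u \<noteq> 0 \<and> cmod u < r \<longrightarrow> invertible_op M (op_shift U u)"
proof -
  have sM: "cvec.subspace M" using M by (simp add: closed_csubspace_def)
  obtain S p where S: "S \<in> bop M" "\<And>x. x \<in> M \<Longrightarrow> S (U x) = U (S x)"
    "\<And>x. x \<in> M \<Longrightarrow> S (U (S x)) = S x" "\<And>x. x \<in> M \<Longrightarrow> (U ^^ p) (x - S (U x)) = 0"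
    using Drazin_inverse[OF sM U D] by metis
  obtain K where K: "K > 0" "\<And>x. x \<in> M \<Longrightarrow> norm (S x) \<le> K * norm x" using bop_bound[OF S(1)] by blast
  have "invertible_op M (op_shift U u)" if u: "u \<noteq> 0" "cmod u < 1 / K" for u
  proof -
    have u1: "cmod u * K < 1" using u K by (simp add: field_simps)
    obtain R where R: "R \<in> bop M" "\<And>x. x \<in> M \<Longrightarrow> R (x - u *\<^sub>C S x) = x" "\<And>x. x \<in> M \<Longrightarrow> R x - u *\<^sub>C S (R x) = x"
      using neumann_inverse[OF M S(1) K(2) u1 less_imp_le[OF K(1)]] by metis
    note * = Drazin_shift_invertible[OF M U S K(2) less_imp_le[OF K(1)] u1 u(1) R]
    show ?thesis unfolding invertible_op_def by (rule bexI[OF _ *(1)]) (use *(2,3) in blast)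
  qed
  then show ?thesis using K(1) by (intro exI[of _ "1 / K"]) auto
qed

text \<open>
  A nilpotent operator has the Drazin inverse \<open>0\<close>, for which the radius of the punctured disc of
  invertibility is unbounded.
\<close>

lemma nilpotent_shift_invertible:
  assumes M: "closed_csubspace M" and E: "E \<in> bop M" and nil: "\<And>x. x \<in> M \<Longrightarrow> (E ^^ m) x = 0" and z: "z \<noteq> 0"
  shows "invertible_op M (op_shift E z)"
proof -
  have sM: "cvec.subspace M" using M by (simp add: closed_csubspace_def)
  have 0: "0 \<in> M" by (rule csubspaceD(1)[OF sM])
  note * = Drazin_shift_invertible[OF M E bop_zero[OF 0], of m 0 z "\<lambda>x. x"]
  have E0: "E 0 = 0" by (rule bop_0[OF E 0])
  show ?thesis unfolding invertible_op_def
    by (rule bexI[OF _ *(1)], intro ballI conjI *(2,3)) (simp_all add: z E0 nil bop_id)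
qed

section \<open>Left meromorphic splittings\<close>

definition splits_left_meromorphic :: "('a::complex_banach \<Rightarrow> 'a) \<Rightarrow> ('a \<Rightarrow> 'a) \<Rightarrow> ('a \<Rightarrow> 'a) \<Rightarrow> bool" where
  "splits_left_meromorphic A Q T \<longleftrightarrow> Q \<in> bop UNIV \<and> T \<in> bop UNIV \<and> (\<forall>x. Q (Q x) = Q x) \<and>
     (\<forall>x. A (Q x) = Q (A x)) \<and> (\<forall>x. T (A x) = Q x) \<and> meromorphic_op {x. Q x = 0} A"

text \<open>
  On the range of \<open>Q\<close> the operator \<open>A (I - Q)\<close> is zero, and a nonzero shift of zero is invertible.
\<close>

lemma meromorphic_kernel_iff:
  assumes A: "A \<in> bop UNIV" and Q: "Q \<in> bop UNIV"
    and QQ: "\<And>x. Q (Q x) = Q x" and AQ: "\<And>x. A (Q x) = Q (A x)"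
  shows "meromorphic_op UNIV (\<lambda>x. A (x - Q x)) \<longleftrightarrow> meromorphic_op {x. Q x = 0} A"
proof -
  let ?N = "{x. Q x = 0}"
  define E where "E x = A (x - Q x)" for x
  note linear = bop_UNIV_simps[OF A] bop_UNIV_simps[OF Q]
  have N: "closed_csubspace ?N" by (rule closed_csubspace_kernel[OF Q])
  have sN: "cvec.subspace ?N" using N by (simp add: closed_csubspace_def)
  have E: "E \<in> bop UNIV" unfolding E_def by (intro Q bop_intros bop_comp[OF A])
  have AN: "A \<in> bop ?N" by (rule bop_restrict[OF A]) (simp add: AQ[symmetric] linear)
  have "Drazin_on UNIV (op_shift E z) \<longleftrightarrow> Drazin_on ?N (op_shift A z)" if z: "z \<noteq> 0" for z
  proof -
    define V where "V = op_shift E z"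
    define U where "U = op_shift A z"
    have V: "V \<in> bop UNIV" unfolding V_def by (rule bop_shift[OF subspace_UNIV E])
    have U: "U \<in> bop ?N" unfolding U_def by (rule bop_shift[OF sN AN])
    have VQ: "V (Q x) = Q (V x)" for x by (simp add: V_def op_shift_def E_def linear AQ QQ)
    have UV: "U x = V x" if "x \<in> ?N" for x using that by (simp add: U_def V_def op_shift_def E_def)
    have Um: "U x \<in> ?N" if "x \<in> ?N" for x by (rule bopD(1)[OF U that])
    have Vm: "V x \<in> ?N" if "x \<in> ?N" for x using Um[OF that] UV[OF that] by simp
    have "Drazin_on UNIV V \<longleftrightarrow> Drazin_on ?N U"
    proof
      assume "Drazin_on UNIV V"
      then have "Drazin_on ?N V" by (rule Drazin_on_kernel[OF V Q QQ VQ])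
      then show "Drazin_on ?N U" by (rule Drazin_on_cong) (fact Vm, fact UV)
    next
      assume "Drazin_on ?N U"
      then have D: "Drazin_on ?N V" by (rule Drazin_on_cong) (fact Um, simp add: UV)
      have "cvec.subspace {x. Q x = x}"
        using closed_csubspace_range(1)[OF Q QQ] by (simp add: closed_csubspace_def)
      then have "Drazin_on {x. Q x = x} V"
        unfolding V_def by (intro invertible_imp_Drazin scalar_invertible z) (simp_all add: E_def linear)
      with D show "Drazin_on UNIV V" by (rule Drazin_on_glue[OF V Q QQ VQ])
    qed
    then show ?thesis unfolding U_def V_def .
  qed
  then show ?thesis
    unfolding E_def[symmetric] meromorphic_iff_Drazin[OF closed_csubspace_UNIV E] meromorphic_iff_Drazin[OF N AN] by blast
qed

lemma quasipolar_iff_splits: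
  assumes A: "A \<in> bop UNIV"
  shows "left_meromorphic_quasipolar A \<longleftrightarrow> (\<exists>Q T. splits_left_meromorphic A Q T)"
proof
  assume "left_meromorphic_quasipolar A"
  then obtain Q T where Q: "Q \<in> bop UNIV" "Q \<circ> Q = Q" "A \<circ> Q = Q \<circ> A"
    and m: "meromorphic_op UNIV (\<lambda>x. A (x - Q x))" and T: "T \<in> bop UNIV" "Q = T \<circ> A"
    unfolding left_meromorphic_quasipolar_def projector_def by blast
  have QQ: "Q (Q x) = Q x" for x using fun_cong[OF Q(2), of x] by simp
  have AQ: "A (Q x) = Q (A x)" for x using fun_cong[OF Q(3), of x] by simp
  have TA: "T (A x) = Q x" for x using fun_cong[OF T(2), of x] by simp
  show "\<exists>Q T. splits_left_meromorphic A Q T"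
    unfolding splits_left_meromorphic_def
    using m[unfolded meromorphic_kernel_iff[OF A Q(1) QQ AQ]] Q(1) T(1) QQ AQ TA
    by (intro exI[of _ Q] exI[of _ T]) simp
next
  assume "\<exists>Q T. splits_left_meromorphic A Q T"
  then obtain Q T where Q: "Q \<in> bop UNIV" "T \<in> bop UNIV" and QQ: "\<And>x. Q (Q x) = Q x"
    and AQ: "\<And>x. A (Q x) = Q (A x)" and TA: "\<And>x. T (A x) = Q x" and m: "meromorphic_op {x. Q x = 0} A"
    unfolding splits_left_meromorphic_def by blast
  show "left_meromorphic_quasipolar A"
    unfolding left_meromorphic_quasipolar_def projector_def
    using m[folded meromorphic_kernel_iff[OF A Q(1) QQ AQ]] Q QQ AQ TA
    by (intro exI[of _ Q] conjI bexI[of _ T]) (simp_all add: fun_eq_iff)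
qed

lemma point_spectrum_subset_left_spectrum: "point_spectrum UNIV A \<subseteq> left_spectrum UNIV A"
proof
  fix z assume "z \<in> point_spectrum UNIV A"
  then obtain x where x: "x \<noteq> 0" "A x = z *\<^sub>C x" unfolding point_spectrum_def by blast
  have "\<not> left_invertible UNIV (op_shift A z)"
  proof
    assume "left_invertible UNIV (op_shift A z)"
    then obtain B where B: "B \<in> bop UNIV" "\<And>x. B (op_shift A z x) = x" unfolding left_invertible_def by blast
    then show False using B(2)[of x] x bop_UNIV_simps(3)[OF B(1)] by (simp add: op_shift_def)
  qed
  then show "z \<in> left_spectrum UNIV A" by (simp add: left_spectrum_def)
qed

locale left_meromorphic_splitting =
  fixes A Q T :: "'a::complex_banach \<Rightarrow> 'a"
  assumes A: "A \<in> bop UNIV" and split: "splits_left_meromorphic A Q T"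
begin

lemma Q: "Q \<in> bop UNIV" and T: "T \<in> bop UNIV" and QQ: "Q (Q x) = Q x" and AQ: "A (Q x) = Q (A x)"
  and TA: "T (A x) = Q x" and mero: "meromorphic_op {x. Q x = 0} A"
  using split unfolding splits_left_meromorphic_def by blast+

lemmas linear = bop_UNIV_simps[OF A] bop_UNIV_simps[OF Q] bop_UNIV_simps[OF T]

lemma kernel: "closed_csubspace {x. Q x = 0}" and range: "closed_csubspace {x. Q x = x}"
  using closed_csubspace_kernel[OF Q] closed_csubspace_range(1)[OF Q QQ] .

lemma A_kernel: "A \<in> bop {x. Q x = 0}"
  by (rule bop_restrict[OF A]) (simp add: AQ[symmetric] linear)

lemma Drazin_kernel: "z \<noteq> 0 \<Longrightarrow> Drazin_on {x. Q x = 0} (op_shift A z)"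
  using mero unfolding meromorphic_iff_Drazin[OF kernel A_kernel] by blast

text \<open>
  With \<open>S = Q T Q\<close> one has \<open>S (A - z) = (I - z S) Q\<close>, and \<open>I - z S\<close> is invertible for
  small \<open>z\<close>.
\<close>

lemma shift_left_inverse_near_0:
  "\<exists>\<epsilon>>0. \<forall>z. cmod z < \<epsilon> \<longrightarrow> (\<exists>L\<in>bop UNIV. \<forall>x. L (op_shift A z x) = Q x)"
proof -
  define S where "S x = Q (T (Q x))" for x
  have S: "S \<in> bop UNIV" unfolding S_def by (intro bop_comp[OF Q bop_comp[OF T Q]])
  note lin = linear bop_UNIV_simps[OF S]
  have SA: "S (A x) = Q x" and SQ: "S (Q x) = S x" for x
    by (simp_all add: S_def AQ[symmetric] TA QQ)
  obtain K where K: "K > 0" "\<And>x. norm (S x) \<le> K * norm x" using bop_bound[OF S] by auto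
  have "\<exists>L\<in>bop UNIV. \<forall>x. L (op_shift A z x) = Q x" if z: "cmod z < 1 / K" for z
  proof -
    have z1: "cmod z * K < 1" using z K by (simp add: field_simps)
    obtain R where R: "R \<in> bop UNIV" "\<And>x. R (x - z *\<^sub>C S x) = x"
      using neumann_inverse[OF closed_csubspace_UNIV S K(2) z1 less_imp_le[OF K(1)]] by auto
    have "S (op_shift A z x) = Q x - z *\<^sub>C S (Q x)" for x by (simp add: op_shift_def lin SA SQ)
    then show ?thesis using R by (intro bexI[OF _ bop_comp[OF R(1) S]]) simp
  qed
  then show ?thesis using K(1) by (intro exI[of _ "1 / K"]) auto
qed

lemma shift_left_Drazin_split:
  "\<exists>\<epsilon>>0. \<forall>z. z \<noteq> 0 \<and> cmod z < \<epsilon> \<longrightarrow> left_Drazin_split (op_shift A z)"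
proof -
  obtain \<epsilon> where \<epsilon>: "\<epsilon> > 0" "\<And>z. cmod z < \<epsilon> \<Longrightarrow> \<exists>L\<in>bop UNIV. \<forall>x. L (op_shift A z x) = Q x"
    using shift_left_inverse_near_0 by blast
  have "left_Drazin_split (op_shift A z)" if z: "z \<noteq> 0" "cmod z < \<epsilon>" for z
  proof -
    obtain L where L: "L \<in> bop UNIV" "\<And>x. L (op_shift A z x) = Q x" using \<epsilon>(2)[OF z(2)] by blast
    have sh: "op_shift A z \<in> bop UNIV" by (intro bop_shift subspace_UNIV A)
    show ?thesis
      by (rule left_invertible_plus_Drazin[OF sh L(1) Q QQ op_shift_commute[where A=A and Q=Q, OF Q AQ] L(2) Drazin_kernel[OF z(1)]])
  qed
  then show ?thesis using \<epsilon>(1) by blast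
qed

text \<open>
  In a punctured neighbourhood of any small \<open>s > 0\<close> the shifts of \<open>A\<close> on the kernel of \<open>Q\<close> are
  invertible, as \<open>s\<close> is at worst a pole for that part; the disc of radius \<open>t\<close> around \<open>w = s + t\<close>
  avoids \<open>s\<close>.
\<close>

lemma left_invertible_disc:
  assumes e: "e > 0"
  shows "\<exists>w d. d > 0 \<and> ball w d \<subseteq> ball 0 e \<and> (\<forall>z\<in>ball w d. left_invertible UNIV (op_shift A z))"
proof -
  obtain \<epsilon> where \<epsilon>: "\<epsilon> > 0" "\<And>z. cmod z < \<epsilon> \<Longrightarrow> \<exists>L\<in>bop UNIV. \<forall>x. L (op_shift A z x) = Q x"
    using shift_left_inverse_near_0 by blast
  define s where "s = min e \<epsilon> / 2"
  have s: "s > 0" "2 * s \<le> e" "2 * s \<le> \<epsilon>" using e \<epsilon>(1) by (auto simp: s_def)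
  let ?N = "{x. Q x = 0}" and ?z0 = "complex_of_real s"
  have sN: "cvec.subspace ?N" using kernel by (simp add: closed_csubspace_def)
  have shN: "op_shift A z \<in> bop ?N" for z by (intro bop_shift sN A_kernel)
  obtain r where r: "r > 0" "\<And>u. u \<noteq> 0 \<Longrightarrow> cmod u < r \<Longrightarrow> invertible_op ?N (op_shift (op_shift A ?z0) u)"
    using Drazin_nearby_invertible[OF kernel shN Drazin_kernel[of ?z0]] s(1) by auto
  define t where "t = min r s / 2"
  have t: "t > 0" "2 * t \<le> r" "2 * t \<le> s" using r(1) s(1) by (auto simp: t_def)
  define w where "w = complex_of_real (s + t)"
  have left: "left_invertible UNIV (op_shift A z)" and small: "cmod z < e" if z: "z \<in> ball w t" for z
  proof -
    have d: "cmod (z - w) < t" using z by (simp add: dist_norm norm_minus_commute)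
    have "cmod z \<le> cmod (z - w) + cmod w" using norm_triangle_ineq[of "z - w" w] by simp
    also have "cmod w = s + t" unfolding w_def norm_of_real using s t by simp
    finally have zs: "cmod z < 2 * s" using d t by linarith
    then show "cmod z < e" using s by linarith
    define u where "u = z - ?z0"
    have u: "u = (z - w) + complex_of_real t" by (simp add: u_def w_def)
    have "cmod u \<le> cmod (z - w) + t" using norm_triangle_ineq[of "z - w" "complex_of_real t"] t(1) by (simp add: u)
    then have u1: "cmod u < r" using d t by linarith
    have u2: "u \<noteq> 0"
    proof
      assume "u = 0"
      then have "z - w = - complex_of_real t" using u by (simp add: add_eq_0_iff)
      then show False using d t(1) by simp
    qed
    have "invertible_op ?N (op_shift A z)" using r(2)[OF u2 u1] by (simp add: op_shift_op_shift u_def)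
    then obtain G where G: "G \<in> bop ?N" "\<And>x. x \<in> ?N \<Longrightarrow> G (op_shift A z x) = x"
      unfolding invertible_op_def by blast
    have "cmod z < \<epsilon>" using zs s(3) by linarith
    then obtain L where L: "L \<in> bop UNIV" "\<And>x. L (op_shift A z x) = Q x" using \<epsilon>(2) by blast
    define k where "k x = x - Q x" for x
    have k: "k \<in> bop UNIV" unfolding k_def by (intro Q bop_intros)
    have kN: "k x \<in> ?N" for x by (simp add: k_def linear QQ)
    have sh: "op_shift A z \<in> bop UNIV" by (intro bop_shift subspace_UNIV A)
    have "k (op_shift A z x) = op_shift A z (k x)" for x
      unfolding k_def by (simp add: bop_UNIV_simps(5)[OF sh] op_shift_commute[where A=A and Q=Q, OF Q AQ])
    then have "L (op_shift A z x) + G (k (op_shift A z x)) = x" for x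
      using L(2) G(2)[OF kN] by (simp add: k_def)
    moreover have "(\<lambda>x. L x + G (k x)) \<in> bop UNIV"
      by (intro bop_add subspace_UNIV L(1) bop_through[OF G(1) k kN])
    ultimately show "left_invertible UNIV (op_shift A z)"
      unfolding left_invertible_def by (intro bexI[of _ "\<lambda>x. L x + G (k x)"]) simp_all
  qed
  show ?thesis using left small t(1) by (intro exI[of _ w] exI[of _ t]) auto
qed

lemma left_inverse_range: "left_invertible {x. Q x = x} A"
proof -
  have "(\<lambda>x. Q (T x)) \<in> bop {x. Q x = x}" by (rule bop_restrict[OF bop_comp[OF Q T]]) (simp add: QQ)
  moreover have "Q (T (A x)) = x" if "Q x = x" for x using that by (simp add: TA)
  ultimately show ?thesis unfolding left_invertible_def by (intro bexI[of _ "\<lambda>x. Q (T x)"]) simp_all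
qed

lemma Red: "({x. Q x = x}, {x. Q x = 0}) \<in> Red A"
proof -
  have "x \<in> ssum {x. Q x = x} {x. Q x = 0}" for x
  proof -
    have "x = Q x + (x - Q x)" "Q (Q x) = Q x" "Q (x - Q x) = 0" by (simp_all add: linear QQ)
    then show ?thesis unfolding ssum_def by blast
  qed
  moreover have "{x. Q x = x} \<inter> {x. Q x = 0} = {0}" using linear by auto
  moreover have "A ` {x. Q x = x} \<subseteq> {x. Q x = x}" by (auto simp: AQ[symmetric])
  moreover have "A ` {x. Q x = 0} \<subseteq> {x. Q x = 0}" by (auto simp: AQ[symmetric] linear)
  ultimately show ?thesis unfolding Red_def using kernel range by auto
qed

text \<open>
  A left inverse makes the kernel trivial and \<open>A Q T Q\<close> a projector onto the range.
\<close>

lemma Saphar: "Saphar_op {x. Q x = x} A"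
proof -
  let ?M = "{x. Q x = x}"
  have sM: "cvec.subspace ?M" using range by (simp add: closed_csubspace_def)
  have null: "nullspace ?M A = {0}"
  proof -
    have "x = 0" if "Q x = x" "A x = 0" for x using TA[of x] that by (simp add: linear)
    then show ?thesis by (auto simp: nullspace_def linear)
  qed
  have c0: "closed_csubspace {0}" by (auto simp: closed_csubspace_def cvec.subspace_def)
  have "complemented_in ?M {0}"
    unfolding complemented_in_def
  proof (intro conjI exI[of _ ?M] c0 range)
    show "ssum {0} ?M = ?M" unfolding ssum_def by auto
  qed (auto simp: linear)
  \<comment> \<open>projector onto the range of \<open>A\<close> on the range of \<open>Q\<close>\<close>
  define F where "F x = A (Q (T (Q x)))" for x
  have F: "F \<in> bop UNIV" unfolding F_def by (intro bop_comp[OF A bop_comp[OF Q bop_comp[OF T Q]]])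
  have FA: "F y = y" if "y \<in> A ` ?M" for y using that by (auto simp: F_def AQ[symmetric] TA QQ)
  have FM: "F y \<in> A ` ?M" for y unfolding F_def using QQ by blast
  have FF: "F (F y) = F y" for y by (rule FA[OF FM])
  have R: "A ` ?M = {y. F y = y}" using FA FM by (auto) (metis)
  have AM: "A ` ?M \<subseteq> ?M" by (auto simp: AQ[symmetric])
  have cR: "closed_csubspace (A ` ?M)" unfolding R by (rule closed_csubspace_range(1)[OF F FF])
  have "complemented_in ?M (A ` ?M)"
    unfolding complemented_in_def
  proof (intro conjI exI[of _ "?M \<inter> {y. F y = 0}"] cR AM)
    show "closed_csubspace (?M \<inter> {y. F y = 0})"
      using range closed_csubspace_kernel[OF F] cvec.subspace_inter unfolding closed_csubspace_def by blast
    have "0 \<in> A ` ?M" using linear by (auto simp: image_iff intro: exI[of _ 0])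
    then show "A ` ?M \<inter> (?M \<inter> {y. F y = 0}) = {0}" using FA by (auto simp: linear bop_UNIV_simps[OF F])
    show "ssum (A ` ?M) (?M \<inter> {y. F y = 0}) = ?M"
    proof
      show "ssum (A ` ?M) (?M \<inter> {y. F y = 0}) \<subseteq> ?M"
        unfolding ssum_def using AM csubspaceD(2)[OF sM] by blast
      show "?M \<subseteq> ssum (A ` ?M) (?M \<inter> {y. F y = 0})"
      proof
        fix x assume x: "x \<in> ?M"
        have "F x \<in> ?M" using FM AM by blast
        then have "x - F x \<in> ?M \<inter> {y. F y = 0}"
          using csubspaceD(3)[OF sM x] by (simp add: bop_UNIV_simps[OF F] FF)
        moreover have "x = F x + (x - F x)" by simp
        ultimately show "x \<in> ssum (A ` ?M) (?M \<inter> {y. F y = 0})" unfolding ssum_def using FM by blast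
      qed
    qed
  qed simp
  moreover have "0 \<in> (A ^^ n) ` ?M" for n
    using bop_UNIV_simps(3)[OF bop_funpow[OF A]] linear by (auto simp: image_iff intro!: exI[of _ 0])
  ultimately show ?thesis
    using \<open>complemented_in ?M {0}\<close> cR null unfolding Saphar_op_def Kato_op_def closed_csubspace_def by auto
qed

lemma GSMD: "admits_GSMD A"
  unfolding admits_GSMD_def using Red Saphar mero by blast

text \<open>
  An analytic solution vanishes on a disc of left invertibility, hence everywhere by the
  identity theorem.
\<close>

lemma SVEP: "SVEP_at A 0"
  unfolding SVEP_at_def
proof (intro allI impI ballI)
  fix r :: real and f :: "complex \<Rightarrow> 'a" and z :: complex
  assume r: "r > 0" and f: "vec_analytic_on f (ball 0 r) \<and> (\<forall>z\<in>ball 0 r. op_shift A z (f z) = 0)" and z: "z \<in> ball 0 r"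
  obtain w d where d: "d > 0" "ball w d \<subseteq> ball 0 r" "\<And>z. z \<in> ball w d \<Longrightarrow> left_invertible UNIV (op_shift A z)"
    using left_invertible_disc[OF r] by blast
  have 0: "f z = 0" if z: "z \<in> ball w d" for z
  proof -
    obtain B where B: "B \<in> bop UNIV" "\<And>x. B (op_shift A z x) = x"
      using d(3)[OF z] unfolding left_invertible_def by blast
    have "op_shift A z (f z) = 0" using f z d(2) by blast
    then show ?thesis using B(2)[of "f z"] bop_UNIV_simps(3)[OF B(1)] by simp
  qed
  show "f z = 0"
    by (rule vec_analytic_identity[OF conjunct1[OF f] open_ball connected_ball open_ball d(2) _ 0 z])
      (use d(1) in auto)
qed

lemma not_interior_left_spectrum: "0 \<notin> interior (left_spectrum UNIV A)"
proof
  assume "0 \<in> interior (left_spectrum UNIV A)"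
  then obtain e where e: "e > 0" "ball 0 e \<subseteq> left_spectrum UNIV A" using mem_interior by blast
  obtain w d where d: "d > 0" "ball w d \<subseteq> ball 0 e" "\<And>z. z \<in> ball w d \<Longrightarrow> left_invertible UNIV (op_shift A z)"
    using left_invertible_disc[OF e(1)] by blast
  have "w \<in> ball w d" using d(1) by simp
  then show False using d(2,3) e(2) unfolding left_spectrum_def by blast
qed

lemma not_islimpt_Drazin_spectra:
  "\<not> 0 islimpt left_Drazin_spectrum UNIV A" "\<not> 0 islimpt upper_Drazin_spectrum UNIV A"
proof -
  obtain e where e: "e > 0" "\<And>z. z \<noteq> 0 \<Longrightarrow> cmod z < e \<Longrightarrow> left_Drazin_split (op_shift A z)"
    using shift_left_Drazin_split by blast
  have "z \<notin> left_Drazin_spectrum UNIV A \<and> z \<notin> upper_Drazin_spectrum UNIV A" if "z \<noteq> 0" "cmod z < e" for z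
    using split_imp_left_and_upper_Drazin[OF bop_shift[OF subspace_UNIV A] e(2)[OF that]]
    by (simp add: left_Drazin_spectrum_def upper_Drazin_spectrum_def)
  then show "\<not> 0 islimpt left_Drazin_spectrum UNIV A" "\<not> 0 islimpt upper_Drazin_spectrum UNIV A"
    using e(1) unfolding islimpt_approachable by (auto simp: dist_norm)
qed

end

lemma Red_left_invertible_imp_splits:
  assumes A: "A \<in> bop UNIV" and R: "(M, N) \<in> Red A" and m: "meromorphic_op N A"
    and B: "B \<in> bop M" "\<And>x. x \<in> M \<Longrightarrow> B (A x) = x"
  shows "\<exists>Q T. splits_left_meromorphic A Q T"
proof -
  have MN: "closed_csubspace M" "closed_csubspace N" "M \<inter> N = {0}" "ssum M N = UNIV"
    and AM: "\<And>x. x \<in> M \<Longrightarrow> A x \<in> M" and AN: "\<And>x. x \<in> N \<Longrightarrow> A x \<in> N"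
    using R unfolding Red_def by auto
  obtain Q where Q: "Q \<in> bop UNIV" "\<And>x. Q x \<in> M" "\<And>x. x - Q x \<in> N"
    "\<And>x. x \<in> M \<Longrightarrow> Q x = x" "\<And>x. x \<in> N \<Longrightarrow> Q x = 0"
    by (rule direct_sum_projection[OF MN]) blast
  have N: "{x. Q x = 0} = N" using Q(3,5) by (auto) (metis diff_zero)
  have AQ: "A (Q x) = Q (A x)" for x
  proof -
    have "Q (A x) = Q (A (Q x + (x - Q x)))" by simp
    also have "\<dots> = Q (A (Q x)) + Q (A (x - Q x))"
      by (simp only: bop_UNIV_simps(1)[OF A] bop_UNIV_simps(1)[OF Q(1)])
    also have "\<dots> = A (Q x)" using Q(4)[OF AM[OF Q(2)]] Q(5)[OF AN[OF Q(3)]] by simp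
    finally show ?thesis by simp
  qed
  have T: "(\<lambda>x. B (Q x)) \<in> bop UNIV" by (rule bop_through[OF B(1) Q(1,2)])
  have TA: "B (Q (A x)) = Q x" for x using B(2)[OF Q(2)] by (simp add: AQ[symmetric])
  show ?thesis unfolding splits_left_meromorphic_def
    using Q(1) T Q(4)[OF Q(2)] AQ TA m[folded N]
    by (intro exI[of _ Q] exI[of _ "\<lambda>x. B (Q x)"]) simp
qed

text \<open>
  If the Saphar part were injective, its generalized inverse would be a left inverse. So it has a
  nonzero kernel vector, and the eigenvectors with infinite chains of preimages exist on a disc.
\<close>

lemma GSMD_without_splitting:
  assumes A: "A \<in> bop UNIV" and G: "admits_GSMD A" and ns: "\<not> (\<exists>Q T. splits_left_meromorphic A Q T)"
  shows "\<not> SVEP_at A 0" "0 \<in> interior (point_spectrum UNIV A)"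
    "0 \<in> interior (left_Drazin_spectrum UNIV A)" "0 \<in> interior (upper_Drazin_spectrum UNIV A)"
proof -
  obtain M N where R: "(M, N) \<in> Red A" and S: "Saphar_op M A" and m: "meromorphic_op N A"
    using G unfolding admits_GSMD_def by blast
  have "\<exists>x0\<in>M. A x0 = 0 \<and> x0 \<noteq> 0"
  proof (rule ccontr)
    assume "\<not> ?thesis"
    then have inj: "x = 0" if "x \<in> M" "A x = 0" for x using that by blast
    have sM: "cvec.subspace M" and AM: "\<And>x. x \<in> M \<Longrightarrow> A x \<in> M"
      using R unfolding Red_def closed_csubspace_def by auto
    obtain B where B: "B \<in> bop UNIV" "\<And>x. B x \<in> M" "\<And>x. x \<in> M \<Longrightarrow> A (B (A x)) = A x"
      using Saphar_generalized_inverse[OF A R S] by blast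
    have "B (A x) = x" if x: "x \<in> M" for x
    proof -
      have "A (B (A x) - x) = 0" using B(3)[OF x] by (simp add: bop_UNIV_simps[OF A])
      then show ?thesis using inj[OF csubspaceD(3)[OF sM B(2) x]] by simp
    qed
    moreover have "B \<in> bop M" by (rule bop_restrict[OF B(1,2)])
    ultimately show False using Red_left_invertible_imp_splits[OF A R m] ns by blast
  qed
  then obtain x0 where x0: "x0 \<in> M" "A x0 = 0" "x0 \<noteq> 0" by blast
  obtain r where r: "r > 0"
    and f: "\<exists>f. vec_analytic_on f (ball 0 r) \<and> (\<forall>z\<in>ball 0 r. op_shift A z (f z) = 0 \<and> f z \<noteq> 0)"
    and g: "\<And>z. z \<in> ball 0 r \<Longrightarrow>
      \<exists>g. g 0 \<noteq> 0 \<and> op_shift A z (g 0) = 0 \<and> (\<forall>k::nat. op_shift A z (g (Suc k)) = g k)"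
    using Saphar_noninjective[OF A R S x0] by blast
  have "0 \<in> ball (0::complex) r" using r by simp
  then show "\<not> SVEP_at A 0" unfolding SVEP_at_def using f r by blast
  have "ball 0 r \<subseteq> point_spectrum UNIV A"
    using f unfolding point_spectrum_def op_shift_def by auto
  then show "0 \<in> interior (point_spectrum UNIV A)" using r mem_interior by blast
  have "\<not> ascent UNIV (op_shift A z) < \<infinity>" if z: "z \<in> ball 0 r" for z
  proof -
    obtain g :: "nat \<Rightarrow> 'a" where g: "g 0 \<noteq> 0" "op_shift A z (g 0) = 0" "\<And>k. op_shift A z (g (Suc k)) = g k"
      using g[OF z] by blast
    have "(op_shift A z ^^ n) (g (n + k)) = g k" for n k
      by (induction n arbitrary: k) (simp_all add: funpow_swap1 g(3))
    then have "(op_shift A z ^^ n) (g n) = g 0" for n by (metis add_0_right)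
    then have "g 0 \<in> nullspace UNIV (op_shift A z) \<inter> range (op_shift A z ^^ n)" for n
      using g(2) unfolding nullspace_def by (metis (mono_tags) IntI UNIV_I mem_Collect_eq rangeI)
    then show ?thesis using g(1) unfolding ascent_finite_iff by blast
  qed
  then have "ball 0 r \<subseteq> left_Drazin_spectrum UNIV A" "ball 0 r \<subseteq> upper_Drazin_spectrum UNIV A"
    unfolding left_Drazin_spectrum_def upper_Drazin_spectrum_def left_Drazin_def upper_Drazin_def by blast+
  then show "0 \<in> interior (left_Drazin_spectrum UNIV A)" "0 \<in> interior (upper_Drazin_spectrum UNIV A)"
    using r mem_interior by blast+
qed

section \<open>Sums of left Drazin invertible and meromorphic operators\<close>

text \<open>
  Let \<open>F\<close> be the projector splitting \<open>C\<close> and \<open>k = I - P\<close>. The two need not commute, but the kernel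
  of \<open>F\<close> is the kernel of a power of \<open>C\<close> and hence invariant under \<open>k\<close>, i.e. \<open>F k F = F k\<close>.
  This makes \<open>Q = k F k\<close> idempotent. On the kernel of \<open>Q\<close>, the operator \<open>A\<close> is nilpotent on the range of \<open>k\<close> and
  equals \<open>D\<close> on the range of \<open>P\<close>.
\<close>

lemma left_Drazin_plus_meromorphic_splits:
  assumes A: "A \<in> bop UNIV" and C: "C \<in> bop UNIV" and D: "D \<in> bop UNIV" and P: "P \<in> bop UNIV"
    and LD: "left_Drazin UNIV C" and mD: "meromorphic_op UNIV D"
    and PP: "\<And>x. P (P x) = P x" and CP: "\<And>x. C (P x) = P (C x)" and DP: "\<And>x. D (P x) = P (D x)"
    and A_eq: "\<And>x. A x = C (x - P x) + D (P x)"
  shows "\<exists>Q T. splits_left_meromorphic A Q T"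
proof -
  obtain B n where B: "B \<in> bop UNIV" and BB: "\<And>x. B (C (B (C x))) = B (C x)"
    and CB: "\<And>x. B (C (C x)) = C (B (C x))" and nil: "\<And>x. (C ^^ n) (x - B (C x)) = 0"
    using left_Drazin_imp_split[OF C LD] unfolding left_Drazin_split_def by metis
  define k where "k x = x - P x" for x
  define F where "F x = B (C x)" for x
  have k: "k \<in> bop UNIV" unfolding k_def by (intro P bop_intros)
  have F: "F \<in> bop UNIV" unfolding F_def by (rule bop_comp[OF B C])
  note lin = bop_UNIV_simps[OF A] bop_UNIV_simps[OF B] bop_UNIV_simps[OF C] bop_UNIV_simps[OF D]
    bop_UNIV_simps[OF P] bop_UNIV_simps[OF k] bop_UNIV_simps[OF F]
  have kk: "k (k x) = k x" and kP: "k (P x) = 0" and Pk: "P (k x) = 0" and Ck: "C (k x) = k (C x)"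
    and Dk: "D (k x) = k (D x)" for x
    by (simp_all add: k_def lin PP CP DP)
  have FF: "F (F x) = F x" and CF: "C (F x) = F (C x)" for x by (simp_all add: F_def BB CB)
  have Ckn: "(C ^^ m) (k x) = k ((C ^^ m) x)" and CFn: "(C ^^ m) (F x) = F ((C ^^ m) x)" for m x
    by (induction m) (simp_all add: Ck CF)
  have CnF: "(C ^^ n) (F x) = (C ^^ n) x" for x
    using nil[of x] by (simp add: bop_UNIV_simps(5)[OF bop_funpow[OF C]] F_def)
  have Bn: "F x = 0" if "(C ^^ m) (F x) = 0" for m x
    using that
  proof (induction m)
    case (Suc m)
    have "F ((C ^^ m) (F x)) = B ((C ^^ Suc m) (F x))" by (simp add: F_def)
    also have "\<dots> = 0" using Suc.prems by (simp add: lin)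
    finally have "(C ^^ m) (F x) = 0" by (simp add: CFn FF)
    then show ?case by (rule Suc.IH)
  qed simp
  \<comment> \<open>\<open>k\<close> preserves the kernel of \<open>F\<close>, as \<open>F v = 0\<close> holds exactly if \<open>C^n v = 0\<close>\<close>
  have FkF: "F (k (F x)) = F (k x)" for x
  proof -
    have "(C ^^ n) (F (k (x - F x))) = F (k ((C ^^ n) (x - F x)))" by (simp only: CFn Ckn)
    also have "\<dots> = 0" by (simp add: bop_UNIV_simps(5)[OF bop_funpow[OF C]] CnF lin)
    finally have "F (k (x - F x)) = 0" by (rule Bn)
    then show ?thesis by (simp add: lin)
  qed
  define Q where "Q x = k (F (k x))" for x
  define T where "T x = k (B (k x))" for x
  have Q: "Q \<in> bop UNIV" unfolding Q_def by (intro bop_comp[OF k bop_comp[OF F k]])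
  have T: "T \<in> bop UNIV" unfolding T_def by (intro bop_comp[OF k bop_comp[OF B k]])
  have QQ: "Q (Q x) = Q x" for x by (simp add: Q_def kk FkF)
  have Ak: "A (k x) = C (k x)" for x using A_eq[of "k x"] by (simp add: Pk lin)
  have kA: "k (A x) = C (k x)" for x unfolding A_eq by (simp add: lin DP kP) (simp add: k_def[symmetric] Ck kk flip: lin)
  have AQ: "A (Q x) = Q (A x)" for x by (simp add: Q_def Ak kA Ck CF)
  have TA: "T (A x) = Q x" for x by (simp add: T_def Q_def kA F_def)
  define E where "E x = A (x - Q x)" for x
  have E: "E \<in> bop UNIV" unfolding E_def by (intro Q bop_intros bop_comp[OF A])
  have PQ: "P (Q x) = 0" and QP: "Q (P x) = 0" for x by (simp_all add: Q_def Pk kP lin)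
  have AP: "A (P x) = P (A x)" for x by (simp add: A_eq lin PP CP DP)
  have EP: "E (P x) = P (E x)" for x unfolding E_def AP[symmetric] by (simp add: lin QP PQ)
  let ?K = "{x. P x = 0}"
  have K: "closed_csubspace ?K" by (rule closed_csubspace_kernel[OF P])
  have EK: "E \<in> bop ?K" by (rule bop_restrict[OF E]) (simp add: EP[symmetric] bop_UNIV_simps[OF E])
  have nilE: "(E ^^ Suc n) x = 0" if "x \<in> ?K" for x
  proof -
    have kx: "k x = x" using that by (simp add: k_def)
    define y where "y = x - Q x"
    have ky: "k y = y" using kx by (simp add: y_def lin Q_def kk)
    have Qy: "Q y = 0" by (simp add: y_def bop_UNIV_simps[OF Q] QQ)
    have AkC: "A z = C z" if "k z = z" for z using Ak[of z] that by simp
    have Cy: "k ((C ^^ m) y) = (C ^^ m) y" for m by (simp add: Ckn[symmetric] ky)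
    have QC: "Q ((C ^^ m) y) = (C ^^ m) (Q y)" for m
      unfolding Q_def Cy by (simp add: CFn[symmetric] Ckn[symmetric] ky)
    have Em: "(E ^^ Suc m) x = (C ^^ Suc m) y" for m
    proof (induction m)
      case 0
      show ?case using AkC[OF ky] by (simp add: E_def y_def[symmetric])
    next
      case (Suc m)
      have "(E ^^ Suc (Suc m)) x = E ((C ^^ Suc m) y)" using Suc by simp
      also have "\<dots> = A ((C ^^ Suc m) y)"
        unfolding E_def QC Qy by (simp add: bop_UNIV_simps(3)[OF bop_funpow[OF C]] lin)
      also have "\<dots> = C ((C ^^ Suc m) y)" by (rule AkC[OF Cy])
      finally show ?case by simp
    qed
    have "(C ^^ n) y = (C ^^ n) (F y)" by (simp add: CnF)
    also have "\<dots> = k ((C ^^ n) (F y))" unfolding CnF Cy ..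
    also have "\<dots> = (C ^^ n) (Q y)" by (simp add: Q_def ky Ckn)
    also have "\<dots> = 0" by (simp add: Qy bop_UNIV_simps(3)[OF bop_funpow[OF C]])
    finally show ?thesis unfolding Em by (simp add: lin)
  qed
  have "Drazin_on UNIV (op_shift E z)" if z: "z \<noteq> 0" for z
  proof -
    define V where "V = op_shift E z"
    have V: "V \<in> bop UNIV" unfolding V_def by (rule bop_shift[OF subspace_UNIV E])
    have VP: "V (P x) = P (V x)" for x by (simp add: V_def op_shift_def EP lin)
    have 1: "Drazin_on ?K V" unfolding V_def
      by (intro invertible_imp_Drazin nilpotent_shift_invertible[OF K EK nilE z])
    define W where "W = op_shift D z"
    have W: "W \<in> bop UNIV" unfolding W_def by (rule bop_shift[OF subspace_UNIV D])
    have Wk: "W (k x) = k (W x)" for x by (simp add: W_def op_shift_def Dk lin)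
    have "Drazin_on UNIV W" using mD z unfolding meromorphic_iff_Drazin[OF closed_csubspace_UNIV D] W_def by blast
    then have "Drazin_on {x. k x = 0} W" by (rule Drazin_on_kernel[OF W k kk Wk])
    moreover have range: "{x. k x = 0} = {x. P x = x}" by (auto simp: k_def)
    ultimately have "Drazin_on {x. P x = x} W" by simp
    then have 2: "Drazin_on {x. P x = x} V"
    proof (rule Drazin_on_cong)
      fix x assume "x \<in> {x. P x = x}"
      then have x: "P x = x" by simp
      show "W x \<in> {x. P x = x}" using x by (simp add: W_def op_shift_def lin DP[symmetric])
      have "Q x = 0" using QP[of x] x by simp
      then show "V x = W x" using x by (simp add: V_def W_def op_shift_def E_def A_eq lin)
    qed
    show ?thesis using Drazin_on_glue[OF V P PP VP 1 2] unfolding V_def .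
  qed
  then have "meromorphic_op UNIV E" unfolding meromorphic_iff_Drazin[OF closed_csubspace_UNIV E] by blast
  then have "meromorphic_op {x. Q x = 0} A"
    using meromorphic_kernel_iff[OF A Q QQ AQ] unfolding E_def by simp
  then show ?thesis unfolding splits_left_meromorphic_def using Q T QQ AQ TA
    by (intro exI[of _ Q] exI[of _ T]) simp
qed

context left_meromorphic_splitting
begin

text \<open>
  On the range of \<open>P\<close> the operator \<open>A + P\<close> is \<open>A + 1\<close>, which is Drazin invertible as the shift
  of a meromorphic operator by the nonzero number \<open>- 1\<close>.
\<close>

lemma complement:
  defines "P \<equiv> \<lambda>x. x - Q x"
  shows "projector P" "A \<circ> P = P \<circ> A" "meromorphic_op UNIV (A \<circ> P)"
    "left_Drazin UNIV (\<lambda>x. A x + P x)" "left_Drazin UNIV (\<lambda>x. A (x - P x) + P x)"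
proof -
  have P: "P \<in> bop UNIV" unfolding P_def by (intro Q bop_intros)
  show "projector P" unfolding projector_def using P by (auto simp: P_def fun_eq_iff linear QQ)
  show "A \<circ> P = P \<circ> A" by (auto simp: P_def fun_eq_iff linear AQ)
  show "meromorphic_op UNIV (A \<circ> P)"
    using mero meromorphic_kernel_iff[OF A Q QQ AQ] by (simp add: P_def comp_def)
  define L where "L x = Q (T (Q x))" for x
  have L: "L \<in> bop UNIV" unfolding L_def by (intro bop_comp[OF Q bop_comp[OF T Q]])
  have QP: "Q (P x) = 0" for x by (simp add: P_def linear QQ)
  have LA: "L (A x) = Q x" for x by (simp add: L_def AQ[symmetric] TA QQ)
  have LQ: "L (Q x) = L x" for x by (simp add: L_def QQ)
  have LP: "L (P x) = 0" for x by (simp add: L_def QP linear)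
  have AP: "(\<lambda>x. A x + P x) \<in> bop UNIV" by (intro bop_add subspace_UNIV A P)
  have sN: "cvec.subspace {x. Q x = 0}" using kernel by (simp add: closed_csubspace_def)
  have "left_Drazin_split (\<lambda>x. A x + P x)"
  proof (rule left_invertible_plus_Drazin[OF AP L Q QQ])
    show "A (Q x) + P (Q x) = Q (A x + P x)" for x by (simp add: linear AQ P_def QQ)
    show "L (A x + P x) = Q x" for x by (simp add: bop_UNIV_simps[OF L] LA LP)
    have "Drazin_on {x. Q x = 0} (op_shift A (- 1))" by (rule Drazin_kernel) simp
    then show "Drazin_on {x. Q x = 0} (\<lambda>x. A x + P x)"
    proof (rule Drazin_on_cong)
      show "op_shift A (- 1) x \<in> {x. Q x = 0}" if "x \<in> {x. Q x = 0}" for x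
        by (rule bopD(1)[OF bop_shift[OF sN A_kernel] that])
    qed (simp add: op_shift_def P_def)
  qed
  then show "left_Drazin UNIV (\<lambda>x. A x + P x)" by (rule split_imp_left_and_upper_Drazin(1)[OF AP])
  let ?U = "\<lambda>x. A (x - P x) + P x"
  have U: "?U \<in> bop UNIV" by (intro P bop_intros bop_comp[OF A])
  have G: "(\<lambda>x. L x + P x) \<in> bop UNIV" by (intro bop_add subspace_UNIV L P)
  have GU: "L (?U x) + P (?U x) = x" for x
    by (simp add: P_def) (simp add: bop_UNIV_simps[OF L] LQ LA linear QQ AQ)
  have "left_Drazin_split ?U"
    unfolding left_Drazin_split_def
    by (rule bexI[OF _ G], intro exI[of _ 0] allI) (simp only: GU, simp)
  then show "left_Drazin UNIV ?U" by (rule split_imp_left_and_upper_Drazin(1)[OF U])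
qed

lemma regular_left_inverse:
  "\<exists>C\<in>bop UNIV. A \<circ> C \<circ> A = C \<circ> A \<circ> A \<and> C \<circ> C \<circ> A = C \<and> C = C \<circ> A \<circ> C \<and>
     meromorphic_op UNIV (\<lambda>x. A x - (A \<circ> C \<circ> A) x)"
proof -
  define C where "C x = Q (T (Q x))" for x
  have C: "C \<in> bop UNIV" unfolding C_def by (intro bop_comp[OF Q bop_comp[OF T Q]])
  have CA: "C (A x) = Q x" for x by (simp add: C_def AQ[symmetric] TA QQ)
  have CQ: "C (Q x) = C x" and QC: "Q (C x) = C x" for x by (simp_all add: C_def QQ)
  have "(\<lambda>x. A x - (A \<circ> C \<circ> A) x) = (\<lambda>x. A (x - Q x))" by (simp add: CA linear)
  then have "meromorphic_op UNIV (\<lambda>x. A x - (A \<circ> C \<circ> A) x)"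
    using mero meromorphic_kernel_iff[OF A Q QQ AQ] by simp
  then show ?thesis using C by (intro bexI[of _ C]) (simp_all add: fun_eq_iff CA CQ QC AQ)
qed

end

section \<open>The equivalences\<close>

lemma left_gD_meromorphic_imp_quasipolar:
  assumes A: "A \<in> bop UNIV" and G: "left_gD_meromorphic_invertible A"
  shows "left_meromorphic_quasipolar A"
proof -
  obtain B where B: "B \<in> bop UNIV" "A \<circ> B \<circ> A = B \<circ> A \<circ> A" "B \<circ> B \<circ> A = B"
    and m: "meromorphic_op UNIV (\<lambda>x. A x - (A \<circ> B \<circ> A) x)"
    using G unfolding left_gD_meromorphic_invertible_def by blast
  have ABA: "A (B (A x)) = B (A (A x))" and BBA: "B (B (A x)) = B x" for x
    using fun_cong[OF B(2), of x] fun_cong[OF B(3), of x] by simp_all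
  define Q where "Q x = B (A x)" for x
  have Q: "Q \<in> bop UNIV" unfolding Q_def by (rule bop_comp[OF B(1) A])
  have QQ: "Q (Q x) = Q x" for x by (simp add: Q_def ABA BBA)
  have "(\<lambda>x. A x - (A \<circ> B \<circ> A) x) = (\<lambda>x. A (x - Q x))" by (simp add: Q_def bop_UNIV_simps[OF A])
  then have "meromorphic_op UNIV (\<lambda>x. A (x - Q x))" using m by simp
  then show ?thesis unfolding left_meromorphic_quasipolar_def projector_def
    using Q QQ B(1) ABA by (intro exI[of _ Q] conjI bexI[of _ B]) (simp_all add: fun_eq_iff Q_def)
qed

theorem theorem5p5:
  fixes A :: "'a::complex_banach \<Rightarrow> 'a"
  assumes "infinite_dimensional (UNIV :: 'a set)"
    and "A \<in> bop UNIV"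
  shows
    "(left_gD_meromorphic_invertible A \<longleftrightarrow>
        (\<exists>C\<in>bop UNIV. A \<circ> C \<circ> A = C \<circ> A \<circ> A \<and> C \<circ> C \<circ> A = C \<and> C = C \<circ> A \<circ> C \<and>
           meromorphic_op UNIV (\<lambda>x. A x - (A \<circ> C \<circ> A) x))) \<and>
     (left_gD_meromorphic_invertible A \<longleftrightarrow>
        (\<exists>(M, N)\<in>Red A. left_invertible M A \<and> meromorphic_op N A)) \<and>
     (left_gD_meromorphic_invertible A \<longleftrightarrow>
        (\<exists>P. projector P \<and> A \<circ> P = P \<circ> A \<and>
           left_Drazin UNIV (\<lambda>x. A x + P x) \<and> meromorphic_op UNIV (A \<circ> P))) \<and>
     (left_gD_meromorphic_invertible A \<longleftrightarrow>
        (\<exists>P. projector P \<and> A \<circ> P = P \<circ> A \<and>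
           left_Drazin UNIV (\<lambda>x. A (x - P x) + P x) \<and> meromorphic_op UNIV (A \<circ> P))) \<and>
     (left_gD_meromorphic_invertible A \<longleftrightarrow>
        (\<exists>C\<in>bop UNIV. \<exists>D\<in>bop UNIV. \<exists>P\<in>bop UNIV.
           left_Drazin UNIV C \<and> meromorphic_op UNIV D \<and> projector P \<and>
           C \<circ> P = P \<circ> C \<and> D \<circ> P = P \<circ> D \<and> A = (\<lambda>x. C (x - P x) + D (P x)))) \<and>
     (left_gD_meromorphic_invertible A \<longleftrightarrow> left_meromorphic_quasipolar A) \<and>
     (left_gD_meromorphic_invertible A \<longleftrightarrow>
        admits_GSMD A \<and> 0 \<notin> interior (left_spectrum UNIV A)) \<and>
     (left_gD_meromorphic_invertible A \<longleftrightarrow> admits_GSMD A \<and> SVEP_at A 0) \<and>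
     (left_gD_meromorphic_invertible A \<longleftrightarrow>
        admits_GSMD A \<and> \<not> 0 islimpt left_Drazin_spectrum UNIV A) \<and>
     (left_gD_meromorphic_invertible A \<longleftrightarrow>
        admits_GSMD A \<and> 0 \<notin> interior (left_Drazin_spectrum UNIV A)) \<and>
     (left_gD_meromorphic_invertible A \<longleftrightarrow>
        admits_GSMD A \<and> \<not> 0 islimpt upper_Drazin_spectrum UNIV A) \<and>
     (left_gD_meromorphic_invertible A \<longleftrightarrow>
        admits_GSMD A \<and> 0 \<notin> interior (upper_Drazin_spectrum UNIV A)) \<and>
     (left_gD_meromorphic_invertible A \<longleftrightarrow>
        admits_GSMD A \<and> 0 \<notin> interior (point_spectrum UNIV A))"
proof -
  note A = assms(2)
  let ?S = "\<exists>Q T. splits_left_meromorphic A Q T"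
  have split: "left_meromorphic_splitting A Q T" if "splits_left_meromorphic A Q T" for Q T
    by unfold_locales (rule A, rule that)
  have inverse: "\<exists>C\<in>bop UNIV. A \<circ> C \<circ> A = C \<circ> A \<circ> A \<and> C \<circ> C \<circ> A = C \<and> C = C \<circ> A \<circ> C \<and>
      meromorphic_op UNIV (\<lambda>x. A x - (A \<circ> C \<circ> A) x)" if ?S
    using that left_meromorphic_splitting.regular_left_inverse[OF split] by blast
  have hub: "left_gD_meromorphic_invertible A \<longleftrightarrow> ?S"
    using left_gD_meromorphic_imp_quasipolar[OF A] quasipolar_iff_splits[OF A] inverse
    unfolding left_gD_meromorphic_invertible_def by blast
  have ii: "?S \<longleftrightarrow> (\<exists>C\<in>bop UNIV. A \<circ> C \<circ> A = C \<circ> A \<circ> A \<and> C \<circ> C \<circ> A = C \<and> C = C \<circ> A \<circ> C \<and>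
      meromorphic_op UNIV (\<lambda>x. A x - (A \<circ> C \<circ> A) x))"
    using inverse hub unfolding left_gD_meromorphic_invertible_def by blast
  have iii: "?S \<longleftrightarrow> (\<exists>(M, N)\<in>Red A. left_invertible M A \<and> meromorphic_op N A)"
  proof
    assume ?S
    then obtain Q T where "left_meromorphic_splitting A Q T" using split by blast
    then interpret left_meromorphic_splitting A Q T .
    show "\<exists>(M, N)\<in>Red A. left_invertible M A \<and> meromorphic_op N A"
      using Red left_inverse_range mero by blast
  next
    assume "\<exists>(M, N)\<in>Red A. left_invertible M A \<and> meromorphic_op N A"
    then obtain M N where MN: "(M, N) \<in> Red A" "left_invertible M A" "meromorphic_op N A" by blast
    obtain B where B: "B \<in> bop M" "\<And>x. x \<in> M \<Longrightarrow> B (A x) = x"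
      using MN(2) unfolding left_invertible_def by blast
    show ?S by (rule Red_left_invertible_imp_splits[OF A MN(1,3) B])
  qed
  have vi_S: ?S if C: "C \<in> bop UNIV" and D: "D \<in> bop UNIV" and P: "projector P" and
    LD: "left_Drazin UNIV C" and mD: "meromorphic_op UNIV D" and CP: "C \<circ> P = P \<circ> C" and DP: "D \<circ> P = P \<circ> D"
    and A_eq: "A = (\<lambda>x. C (x - P x) + D (P x))" for C D P
  proof (rule left_Drazin_plus_meromorphic_splits[OF A C D _ LD mD])
    show "P \<in> bop UNIV" "P (P x) = P x" for x using P unfolding projector_def by (auto simp: fun_eq_iff)
    show "C (P x) = P (C x)" "D (P x) = P (D x)" for x using CP DP by (auto simp: fun_eq_iff)
    show "A x = C (x - P x) + D (P x)" for x using A_eq by (rule fun_cong)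
  qed
  have complement: "\<exists>P. projector P \<and> A \<circ> P = P \<circ> A \<and> meromorphic_op UNIV (A \<circ> P) \<and>
      left_Drazin UNIV (\<lambda>x. A x + P x) \<and> left_Drazin UNIV (\<lambda>x. A (x - P x) + P x)" if s: ?S
  proof -
    obtain Q T where "left_meromorphic_splitting A Q T" using s split by blast
    then interpret left_meromorphic_splitting A Q T .
    show ?thesis using complement by blast
  qed
  have P_facts: "P \<in> bop UNIV" "P (P x) = P x" "A (P x) = P (A x)" "A \<circ> P \<in> bop UNIV"
    if "projector P" "A \<circ> P = P \<circ> A" for P x
  proof -
    show P: "P \<in> bop UNIV" and "P (P x) = P x" using that(1) unfolding projector_def by (auto simp: fun_eq_iff)
    show "A (P x) = P (A x)" using fun_cong[OF that(2), of x] by simp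
    show "A \<circ> P \<in> bop UNIV" using bop_comp[OF A P] by (simp add: comp_def)
  qed
  have iv: "?S \<longleftrightarrow> (\<exists>P. projector P \<and> A \<circ> P = P \<circ> A \<and>
           left_Drazin UNIV (\<lambda>x. A x + P x) \<and> meromorphic_op UNIV (A \<circ> P))" (is "_ \<longleftrightarrow> ?R")
  proof
    show ?R if ?S using complement[OF that] by blast
    assume ?R
    then obtain P where P: "projector P" "A \<circ> P = P \<circ> A" and LD: "left_Drazin UNIV (\<lambda>x. A x + P x)"
      and m: "meromorphic_op UNIV (A \<circ> P)" by blast
    note p = P_facts[OF P]
    show ?S
    proof (rule vi_S[OF _ p(4) P(1) LD m])
      show "(\<lambda>x. A x + P x) \<in> bop UNIV" by (intro bop_add subspace_UNIV A p(1))
    qed (simp_all add: fun_eq_iff bop_UNIV_simps[OF A] bop_UNIV_simps[OF p(1)] p(2,3))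
  qed
  have v: "?S \<longleftrightarrow> (\<exists>P. projector P \<and> A \<circ> P = P \<circ> A \<and>
           left_Drazin UNIV (\<lambda>x. A (x - P x) + P x) \<and> meromorphic_op UNIV (A \<circ> P))" (is "_ \<longleftrightarrow> ?R")
  proof
    show ?R if ?S using complement[OF that] by blast
    assume ?R
    then obtain P where P: "projector P" "A \<circ> P = P \<circ> A" and LD: "left_Drazin UNIV (\<lambda>x. A (x - P x) + P x)"
      and m: "meromorphic_op UNIV (A \<circ> P)" by blast
    note p = P_facts[OF P]
    show ?S
    proof (rule vi_S[OF _ p(4) P(1) LD m])
      show "(\<lambda>x. A (x - P x) + P x) \<in> bop UNIV" by (intro p(1) bop_intros bop_comp[OF A])
    qed (simp_all add: fun_eq_iff bop_UNIV_simps[OF A] bop_UNIV_simps[OF p(1)] p(2,3))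
  qed
  have vi: "?S \<longleftrightarrow> (\<exists>C\<in>bop UNIV. \<exists>D\<in>bop UNIV. \<exists>P\<in>bop UNIV.
           left_Drazin UNIV C \<and> meromorphic_op UNIV D \<and> projector P \<and>
           C \<circ> P = P \<circ> C \<and> D \<circ> P = P \<circ> D \<and> A = (\<lambda>x. C (x - P x) + D (P x)))" (is "_ \<longleftrightarrow> ?R")
  proof
    show ?S if ?R using that vi_S by blast
    assume ?S
    then obtain P where P: "projector P" "A \<circ> P = P \<circ> A" and m: "meromorphic_op UNIV (A \<circ> P)"
      and LD: "left_Drazin UNIV (\<lambda>x. A x + P x)" using complement by blast
    note p = P_facts[OF P]
    have C: "(\<lambda>x. A x + P x) \<in> bop UNIV" by (intro bop_add subspace_UNIV A p(1))
    show ?R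
      by (rule bexI[OF _ C], rule bexI[OF _ p(4)], rule bexI[OF _ p(1)], intro conjI LD m P(1))
        (simp_all add: fun_eq_iff bop_UNIV_simps[OF A] bop_UNIV_simps[OF p(1)] p(2,3))
  qed
  have local: "admits_GSMD A \<and> SVEP_at A 0 \<and> 0 \<notin> interior (left_spectrum UNIV A) \<and>
     \<not> 0 islimpt left_Drazin_spectrum UNIV A \<and> \<not> 0 islimpt upper_Drazin_spectrum UNIV A" if s: ?S
  proof -
    obtain Q T where "left_meromorphic_splitting A Q T" using s split by blast
    then interpret left_meromorphic_splitting A Q T .
    show ?thesis using GSMD SVEP not_interior_left_spectrum not_islimpt_Drazin_spectra by blast
  qed
  have pt: "interior (point_spectrum UNIV A) \<subseteq> interior (left_spectrum UNIV A)"
    by (intro interior_mono point_spectrum_subset_left_spectrum)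
  have lim: "x \<in> interior Z \<Longrightarrow> x islimpt Z" for x :: complex and Z
    by (rule interior_limit_point)
  \<comment> \<open>without a splitting every one of the remaining conditions fails\<close>
  note bad = GSMD_without_splitting[OF A]
  have viii: "?S \<longleftrightarrow> admits_GSMD A \<and> 0 \<notin> interior (left_spectrum UNIV A)" using local bad(2) pt by blast
  have ix: "?S \<longleftrightarrow> admits_GSMD A \<and> SVEP_at A 0" using local bad(1) by blast
  have x: "?S \<longleftrightarrow> admits_GSMD A \<and> \<not> 0 islimpt left_Drazin_spectrum UNIV A" using local bad(3) lim by blast
  have xi: "?S \<longleftrightarrow> admits_GSMD A \<and> 0 \<notin> interior (left_Drazin_spectrum UNIV A)" using local bad(3) lim by blast
  have xii: "?S \<longleftrightarrow> admits_GSMD A \<and> \<not> 0 islimpt upper_Drazin_spectrum UNIV A" using local bad(4) lim by blast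
  have xiii: "?S \<longleftrightarrow> admits_GSMD A \<and> 0 \<notin> interior (upper_Drazin_spectrum UNIV A)" using local bad(4) lim by blast
  have xiv: "?S \<longleftrightarrow> admits_GSMD A \<and> 0 \<notin> interior (point_spectrum UNIV A)" using local bad(2) pt by blast
  show ?thesis
    unfolding hub
    by (intro conjI ii iii iv v vi quasipolar_iff_splits[OF A, symmetric] viii ix x xi xii xiii xiv)
qed

end
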